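(* Let $\mathscr{Z}$ be a Banach space and let $\mathscr{A},\mathscr{C}:\mathbb{R}\to\mathscr{B}(\mathscr{Z})$ and $u:\mathbb{R}\to\mathbb{R}$ satisfy the standing assumptions (D1)–(D6) listed in the context. Suppose that the linear measure differential equation $Dz=\mathscr{A}(t)z+\mathscr{C}(t)z\,Du$ possesses an exponential dichotomy with $(P,K,\alpha)$ on $\mathbb{R}$. Let $\mathscr{H}:\mathbb{R}\times\mathscr{Z}\to\mathscr{Z}$ be Lebesgue–Stieltjes integrable with respect to $u$ with $\mathscr{H}(t,0)=0$ for all $t$. Assume: (a) there is a constant $C_g>0$ such that for every point of discontinuity $t$ of $u$, $\left\|\left(Id+\lim_{r\to t^+}\int_t^r\mathscr{C}(s)\,du(s)\right)^{-1}\right\|\le C_g$; (b) $u$ is nondecreasing and of bounded variation on $\mathbb{R}$, i.e. $V_u:=\sup\{\mathrm{var}_c^d u: c,d\in\mathbb{R},\,c<d\}<\infty$; (c) $\mathscr{H}$ is uniformly bounded, $\|\mathscr{H}(t,z)\|\le M_H$ for all $(t,z)\in\mathbb{R}\times\mathscr{Z}$ and some $M_H>0$, and is Lipschitz continuous in $z$, $\|\mathscr{H}(t,z)-\mathscr{H}(t,w)\|\le L_H\|z-w\|$ for all $t\in\mathbb{R}$, $z,w\in\mathscr{Z}$. If $L_H$ is sufficiently small (that is, smaller than some positive constant depending only on the linear equation, its dichotomy data, $u$ and $C_g$), then the nonlinear measure differential equation $$Dz=\mathscr{A}(t)z+\mathscr{C}(t)z\,Du+\mathscr{H}(t,z)\,Du$$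 has a stable invariant manifold $\mathscr{M}_{gra}$; that is, there are $C>0$ and a map $m\in\mathscr{X}$ (the class $\mathscr{X}$ defined with this $C$) such that $\mathscr{M}_{gra}=\{(s,\zeta,m(s,\zeta)): s\in\mathbb{R},\ \zeta\in\mathscr{E}^s(s)\}$ is invariant: any solution $z(t)$ of the nonlinear equation with $(s,z(s))\in\mathscr{M}_{gra}$ for some $s$ satisfies $(t,z(t))\in\mathscr{M}_{gra}$ for all $t\in\mathbb{R}$.
   Context: $\mathscr{B}(\mathscr{Z})$ is the space of bounded linear operators on $(\mathscr{Z},\|\cdot\|)$, $Id$ the identity, $\mathrm{var}_c^d$ the total variation on $[c,d]$. $Dz$ and $Du$ denote distributional derivatives, but the equations are understood in integral form. Standing assumptions: (D1) $\mathscr{A}$ is Perron integrable (on compact intervals). (D2) $u$ is of locally bounded variation and left-continuous. (D3) $du$ is the Lebesgue–Stieltjes measure generated by $u$, and $\mathscr{C}$ is Perron–Stieltjes integrable with respect to $u$ (on compact intervals). (D4) There is a Lebesgue measurable $m_1:\mathbb{R}\to\mathbb{R}$ such that for all $c<d$, $\int_c^d m_1(s)ds<\infty$ and $\|\int_c^d\mathscr{A}(s)ds\|\le\int_c^d m_1(s)ds$. (D5) There is a $du$-measurable $m_2:\mathbb{R}\to\mathbb{R}$ such that for all $c<d$, $\int_c^d m_2(s)du(s)<\infty$ and $\|\int_c^d\mathscr{C}(s)du(s)\|\le\int_c^d m_2(s)du(s)$. (D6) For every discontinuity point $t$ of $u$, $\left(Id+\lim_{r\to t^+}\int_t^r\mathscr{C}(s)du(s)\right)^{-1}\in\mathscr{B}(\mathscr{Z})$.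 A solution of the nonlinear equation is a function $z$ with $z(t)=z(t_0)+\int_{t_0}^t\mathscr{A}(s)z(s)ds+\int_{t_0}^t\mathscr{C}(s)z(s)du(s)+\int_{t_0}^t\mathscr{H}(s,z(s))du(s)$ for all $t,t_0$ in its interval of definition ($\mathscr{H}=0$ for the linear equation). Under (D1)–(D6) the linear equation has a unique fundamental operator $U:\mathbb{R}\times\mathbb{R}\to\mathscr{B}(\mathscr{Z})$ with $U(t,s)=Id+\int_s^t\mathscr{A}(r)U(r,s)dr+\int_s^t\mathscr{C}(r)U(r,s)du(r)$; $U(t,t_0)z_0$ is the solution with $z(t_0)=z_0$. Exponential dichotomy with $(P,K,\alpha)$ on $\mathbb{R}$: there are projections $P(t)\in\mathscr{B}(\mathscr{Z})$, $t\in\mathbb{R}$, and constants $K,\alpha>0$ with $P(t)U(t,s)=U(t,s)P(s)$ for all $t,s$, $\|U(t,s)P(s)\|\le Ke^{-\alpha(t-s)}$ for $t\ge s$, and $\|U(t,s)(Id-P(s))\|\le Ke^{\alpha(t-s)}$ for $t<s$. Put $\mathscr{E}^s(s)=P(s)\mathscr{Z}$ and $\mathscr{E}^u(s)=(Id-P(s))\mathscr{Z}$. Class $\mathscr{X}$ (for a given constant $C>0$): all maps $m:\{(s,\zeta): s\in\mathbb{R},\zeta\in\mathscr{E}^s(s)\}\to\mathscr{Z}$ with $m(s,0)=0$, $m(s,\zeta)\in\mathscr{E}^u(s)$, and $\|m(s,\zeta)-m(s,\widetilde\zeta)\|\le C\|\zeta-\widetilde\zeta\|$ for all $s\in\mathbb{R}$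 and $\zeta,\widetilde\zeta\in\mathscr{E}^s(s)$. For $z\in\mathscr{Z}$, $(s,z)\in\mathscr{M}_{gra}$ means $z=\zeta+m(s,\zeta)$ for some $\zeta\in\mathscr{E}^s(s)$. *)

theory Defs
  imports "HOL-Analysis.Analysis"
begin

section \<open>Oriented integrals\<close>

definition oriented :: "(real \<Rightarrow> real \<Rightarrow> 'b::real_normed_vector) \<Rightarrow> real \<Rightarrow> real \<Rightarrow> 'b" where
  "oriented F a b = (if a \<le> b then F a b else - F b a)"

text \<open>
  Perron integrals of vector-valued functions are taken in the sense of Kurzweil, that is, they are
  the gauge integrals \<^const>\<open>has_integral\<close> of the library.
\<close>

definition perron_integral ::
    "(real \<Rightarrow> 'b::real_normed_vector) \<Rightarrow> real \<Rightarrow> real \<Rightarrow> 'b" where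
  "perron_integral f = oriented (\<lambda>a b. integral {a..b} f)"

text \<open>
  The Perron--Stieltjes (Kurzweil--Stieltjes) integral of \<open>f\<close> with respect to \<open>u\<close> over \<open>[a, b]\<close>: the
  gauge integral in which the length of a subinterval \<open>[c, d]\<close> is replaced by \<open>u d - u c\<close>.
\<close>

definition has_ps_integral ::
    "(real \<Rightarrow> 'b::real_normed_vector) \<Rightarrow> (real \<Rightarrow> real) \<Rightarrow> 'b \<Rightarrow> real \<Rightarrow> real \<Rightarrow> bool" where
  "has_ps_integral f u I a b \<longleftrightarrow>
     (\<forall>e>0. \<exists>\<gamma>. gauge \<gamma> \<and>
        (\<forall>p. p tagged_division_of {a..b} \<and> \<gamma> fine p \<longrightarrow>
           norm ((\<Sum>(x, k)\<in>p. (u (Sup k) - u (Inf k)) *\<^sub>R f x) - I) < e))"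

definition ps_integrable ::
    "(real \<Rightarrow> 'b::real_normed_vector) \<Rightarrow> (real \<Rightarrow> real) \<Rightarrow> real \<Rightarrow> real \<Rightarrow> bool" where
  "ps_integrable f u a b \<longleftrightarrow> (\<exists>I. has_ps_integral f u I a b)"

definition ps_integral ::
    "(real \<Rightarrow> 'b::real_normed_vector) \<Rightarrow> (real \<Rightarrow> real) \<Rightarrow> real \<Rightarrow> real \<Rightarrow> 'b" where
  "ps_integral f u = oriented (\<lambda>a b. THE I. has_ps_integral f u I a b)"

text \<open>
  The completed measure \<open>du\<close> generated by a nondecreasing left-continuous \<open>u\<close>, with
  \<open>du [a, b) = u b - u a\<close>. Since \<^const>\<open>interval_measure\<close> expects a right-continuous function, it is
  applied to the reflection of \<open>u\<close>, and its result is reflected back.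
\<close>

definition stieltjes_measure :: "(real \<Rightarrow> real) \<Rightarrow> real measure" where
  "stieltjes_measure u = completion (distr (interval_measure (\<lambda>x. - u (- x))) borel uminus)"

lemma emeasure_stieltjes_measure:
  assumes "mono u" and left: "\<And>t. continuous (at_left t) u" and "a \<le> b"
  shows "emeasure (stieltjes_measure u) {a..<b} = ennreal (u b - u a)"
proof -
  let ?F = "\<lambda>x. - u (- x)"
  have "emeasure (stieltjes_measure u) {a..<b} =
        emeasure (interval_measure ?F) (uminus -` {a..<b})"
    by (simp add: stieltjes_measure_def emeasure_completion main_part_sets emeasure_distr)
  also have "uminus -` {a..<b} = {-b<..-a}"
    by auto
  also have "emeasure (interval_measure ?F) {-b<..-a} = ennreal (?F (-a) - ?F (-b))"
  proof (rule emeasure_interval_measure_Ioc)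
    show "continuous (at_right x) ?F" for x
    proof -
      have "(u \<longlongrightarrow> u (- x)) (at_left (- x))"
        using left by (simp add: continuous_within)
      then have "((\<lambda>y. u (- y)) \<longlongrightarrow> u (- x)) (at_right x)"
        by (simp add: at_left_minus filterlim_filtermap)
      then show ?thesis
        by (auto simp: continuous_within intro: tendsto_minus)
    qed
  qed (use assms in \<open>auto simp: mono_def\<close>)
  finally show ?thesis by simp
qed

text \<open>
  The library's \<^const>\<open>has_bochner_integral\<close> is restricted to second countable value spaces.
  The following is the same definition for an arbitrary normed space; the approximation by simple
  functions makes the values almost surely separable.
\<close>

definition bochner_integral_is ::
    "'a measure \<Rightarrow> ('a \<Rightarrow> 'b::real_normed_vector) \<Rightarrow> 'b \<Rightarrow> bool" where
  "bochner_integral_is M f I \<longleftrightarrow>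
     f \<in> borel_measurable M \<and>
     (\<exists>s. (\<forall>i. Bochner_Integration.simple_bochner_integrable M (s i)) \<and>
          (\<lambda>i. \<integral>\<^sup>+x. ennreal (norm (f x - s i x)) \<partial>M) \<longlonglongrightarrow> 0 \<and>
          (\<lambda>i. Bochner_Integration.simple_bochner_integral M (s i)) \<longlonglongrightarrow> I)"

text \<open>
  Lebesgue--Stieltjes integrals from \<open>a\<close> to \<open>b\<close> are over \<open>[a, b)\<close>, which for left-continuous \<open>u\<close>
  is the convention that agrees with the Perron--Stieltjes integral.
\<close>

definition has_ls_integral ::
    "(real \<Rightarrow> 'b::real_normed_vector) \<Rightarrow> (real \<Rightarrow> real) \<Rightarrow> 'b \<Rightarrow> real \<Rightarrow> real \<Rightarrow> bool" where
  "has_ls_integral f u I a b \<longleftrightarrow>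
     bochner_integral_is (restrict_space (stieltjes_measure u) {a..<b}) f I"

definition ls_integrable ::
    "(real \<Rightarrow> 'b::real_normed_vector) \<Rightarrow> (real \<Rightarrow> real) \<Rightarrow> real \<Rightarrow> real \<Rightarrow> bool" where
  "ls_integrable f u a b \<longleftrightarrow> (\<exists>I. has_ls_integral f u I a b)"

definition ls_integral ::
    "(real \<Rightarrow> 'b::real_normed_vector) \<Rightarrow> (real \<Rightarrow> real) \<Rightarrow> real \<Rightarrow> real \<Rightarrow> 'b" where
  "ls_integral f u = oriented (\<lambda>a b. THE I. has_ls_integral f u I a b)"


section \<open>Total variation\<close>

definition total_variation :: "(real \<Rightarrow> real) \<Rightarrow> real \<Rightarrow> real \<Rightarrow> ennreal" where
  "total_variation u c d =
     (SUP D \<in> {D. D division_of {c..d}}. \<Sum>k\<in>D. ennreal \<bar>u (Sup k) - u (Inf k)\<bar>)"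


section \<open>Inverses of bounded operators and jumps\<close>

definition blinfun_invertible :: "('z::real_normed_vector \<Rightarrow>\<^sub>L 'z) \<Rightarrow> bool" where
  "blinfun_invertible T \<longleftrightarrow> (\<exists>V. V o\<^sub>L T = id_blinfun \<and> T o\<^sub>L V = id_blinfun)"

definition blinfun_inverse :: "('z::real_normed_vector \<Rightarrow>\<^sub>L 'z) \<Rightarrow> 'z \<Rightarrow>\<^sub>L 'z" where
  "blinfun_inverse T = (THE V. V o\<^sub>L T = id_blinfun \<and> T o\<^sub>L V = id_blinfun)"

definition jump_operator ::
    "(real \<Rightarrow> 'z::real_normed_vector \<Rightarrow>\<^sub>L 'z) \<Rightarrow> (real \<Rightarrow> real) \<Rightarrow> real \<Rightarrow> 'z \<Rightarrow>\<^sub>L 'z" where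
  "jump_operator C u t = id_blinfun + Lim (at_right t) (\<lambda>r. ps_integral C u t r)"


section \<open>Standing assumptions\<close>

text \<open>
  The measure \<open>du\<close> is expressed by \<^const>\<open>stieltjes_measure\<close>, so these assumptions
  have their intended meaning for nondecreasing \<open>u\<close> only.
\<close>

definition standing_assumptions ::
    "(real \<Rightarrow> 'z::banach \<Rightarrow>\<^sub>L 'z) \<Rightarrow> (real \<Rightarrow> 'z \<Rightarrow>\<^sub>L 'z) \<Rightarrow> (real \<Rightarrow> real) \<Rightarrow> bool" where
  "standing_assumptions A C u \<longleftrightarrow>
     (\<forall>c d. A integrable_on {c..d}) \<and>
     (\<forall>c d. total_variation u c d < \<infinity>) \<and>
     (\<forall>t. continuous (at_left t) u) \<and>
     (\<forall>c d. ps_integrable C u c d) \<and>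
     (\<exists>m1 :: real \<Rightarrow> real. m1 \<in> borel_measurable lebesgue \<and>
        (\<forall>c d. c < d \<longrightarrow> set_integrable lebesgue {c..d} m1 \<and>
           norm (perron_integral A c d) \<le> (LINT s:{c..d}|lebesgue. m1 s))) \<and>
     (\<exists>m2 :: real \<Rightarrow> real. m2 \<in> borel_measurable (stieltjes_measure u) \<and>
        (\<forall>c d. c < d \<longrightarrow> set_integrable (stieltjes_measure u) {c..<d} m2 \<and>
           norm (ps_integral C u c d) \<le> (LINT s:{c..<d}|stieltjes_measure u. m2 s))) \<and>
     (\<forall>t. \<not> isCont u t \<longrightarrow> blinfun_invertible (jump_operator C u t))"


section \<open>Measure differential equations\<close>

text \<open>Solutions on an interval \<open>J\<close> of \<open>Dz = A(t)z + C(t)z Du + H(t,z) Du\<close>.\<close>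

definition mde_solution ::
    "(real \<Rightarrow> 'z::banach \<Rightarrow>\<^sub>L 'z) \<Rightarrow> (real \<Rightarrow> 'z \<Rightarrow>\<^sub>L 'z) \<Rightarrow> (real \<Rightarrow> 'z \<Rightarrow> 'z) \<Rightarrow> (real \<Rightarrow> real) \<Rightarrow>
     real set \<Rightarrow> (real \<Rightarrow> 'z) \<Rightarrow> bool" where
  "mde_solution A C H u J z \<longleftrightarrow>
     (\<forall>c\<in>J. \<forall>d\<in>J. c \<le> d \<longrightarrow>
        (\<lambda>s. A s (z s)) integrable_on {c..d} \<and>
        ps_integrable (\<lambda>s. C s (z s)) u c d \<and>
        ls_integrable (\<lambda>s. H s (z s)) u c d) \<and>
     (\<forall>t0\<in>J. \<forall>t\<in>J.
        z t = z t0 + perron_integral (\<lambda>s. A s (z s)) t0 t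
                   + ps_integral (\<lambda>s. C s (z s)) u t0 t
                   + ls_integral (\<lambda>s. H s (z s)) u t0 t)"

definition fundamental_operator ::
    "(real \<Rightarrow> 'z::banach \<Rightarrow>\<^sub>L 'z) \<Rightarrow> (real \<Rightarrow> 'z \<Rightarrow>\<^sub>L 'z) \<Rightarrow> (real \<Rightarrow> real) \<Rightarrow>
     (real \<Rightarrow> real \<Rightarrow> 'z \<Rightarrow>\<^sub>L 'z) \<Rightarrow> bool" where
  "fundamental_operator A C u U \<longleftrightarrow>
     (\<forall>s c d. (\<lambda>r. A r o\<^sub>L U r s) integrable_on {c..d} \<and>
              ps_integrable (\<lambda>r. C r o\<^sub>L U r s) u c d) \<and>
     (\<forall>t s. U t s = id_blinfun + perron_integral (\<lambda>r. A r o\<^sub>L U r s) s t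
                               + ps_integral (\<lambda>r. C r o\<^sub>L U r s) u s t)"

text \<open>
  Under the standing assumptions the fundamental operator exists and is unique, so the quantifier
  over \<open>U\<close> only names it.
\<close>

definition exponential_dichotomy ::
    "(real \<Rightarrow> 'z::banach \<Rightarrow>\<^sub>L 'z) \<Rightarrow> (real \<Rightarrow> 'z \<Rightarrow>\<^sub>L 'z) \<Rightarrow> (real \<Rightarrow> real) \<Rightarrow>
     (real \<Rightarrow> 'z \<Rightarrow>\<^sub>L 'z) \<Rightarrow> real \<Rightarrow> real \<Rightarrow> bool" where
  "exponential_dichotomy A C u P K \<alpha> \<longleftrightarrow>
     (\<exists>U. fundamental_operator A C u U \<and> K > 0 \<and> \<alpha> > 0 \<and>
        (\<forall>t. P t o\<^sub>L P t = P t) \<and>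
        (\<forall>t s. P t o\<^sub>L U t s = U t s o\<^sub>L P s) \<and>
        (\<forall>t s. s \<le> t \<longrightarrow> norm (U t s o\<^sub>L P s) \<le> K * exp (- \<alpha> * (t - s))) \<and>
        (\<forall>t s. t < s \<longrightarrow> norm (U t s o\<^sub>L (id_blinfun - P s)) \<le> K * exp (\<alpha> * (t - s))))"


section \<open>Invariant graphs\<close>

definition stable_space :: "(real \<Rightarrow> 'z::real_normed_vector \<Rightarrow>\<^sub>L 'z) \<Rightarrow> real \<Rightarrow> 'z set" where
  "stable_space P s = range (blinfun_apply (P s))"

definition unstable_space :: "(real \<Rightarrow> 'z::real_normed_vector \<Rightarrow>\<^sub>L 'z) \<Rightarrow> real \<Rightarrow> 'z set" where
  "unstable_space P s = range (blinfun_apply (id_blinfun - P s))"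

text \<open>
  The maps \<open>m\<close> have domain \<open>{(s, \<zeta>). \<zeta> \<in> stable_space P s}\<close>; their values elsewhere are unconstrained
  and never used.
\<close>

definition graph_class ::
    "(real \<Rightarrow> 'z::real_normed_vector \<Rightarrow>\<^sub>L 'z) \<Rightarrow> real \<Rightarrow> (real \<Rightarrow> 'z \<Rightarrow> 'z) set" where
  "graph_class P C =
     {m. \<forall>s. m s 0 = 0 \<and>
        (\<forall>\<zeta>\<in>stable_space P s. m s \<zeta> \<in> unstable_space P s) \<and>
        (\<forall>\<zeta>\<in>stable_space P s. \<forall>\<zeta>'\<in>stable_space P s.
           norm (m s \<zeta> - m s \<zeta>') \<le> C * norm (\<zeta> - \<zeta>'))}"

definition graph_manifold ::
    "(real \<Rightarrow> 'z::real_normed_vector \<Rightarrow>\<^sub>L 'z) \<Rightarrow> (real \<Rightarrow> 'z \<Rightarrow> 'z) \<Rightarrow> (real \<times> 'z) set" where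
  "graph_manifold P m = {(s, \<zeta> + m s \<zeta>) | s \<zeta>. \<zeta> \<in> stable_space P s}"

definition invariant_set ::
    "(real \<Rightarrow> 'z::banach \<Rightarrow>\<^sub>L 'z) \<Rightarrow> (real \<Rightarrow> 'z \<Rightarrow>\<^sub>L 'z) \<Rightarrow> (real \<Rightarrow> 'z \<Rightarrow> 'z) \<Rightarrow> (real \<Rightarrow> real) \<Rightarrow>
     (real \<times> 'z) set \<Rightarrow> bool" where
  "invariant_set A C H u S \<longleftrightarrow>
     (\<forall>z. mde_solution A C H u UNIV z \<and> (\<exists>s. (s, z s) \<in> S) \<longrightarrow> (\<forall>t. (t, z t) \<in> S))"

end

theory Submission
  imports Defs
begin

text \<open>
  The manifold is found by the Lyapunov--Perron method. Let \<open>U\<close> be the fundamental operator, let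
  \<open>\<Phi> s\<close> be the limit of \<open>U 0 r\<close> as \<open>r\<close> decreases to \<open>s\<close>, and let \<open>H\<close> be the nonlinearity.
  Solutions of the nonlinear equation satisfy the variation of constants formula:
  \<open>U 0 b (z b) - U 0 a (z a)\<close> is the integral of \<open>\<Phi> s (H s (z s))\<close> over \<open>{a..<b}\<close> with respect
  to \<open>du\<close>. The right limit enters because the forcing at a discontinuity \<open>s\<close> of \<open>u\<close> adds to the
  state after the linear equation has made its own jump at \<open>s\<close>.

  Consider the functions that satisfy this identity on \<open>{s..}\<close> and are bounded there. Applying the
  dichotomy to the identity and letting the end point tend to infinity, where the unstable part of
  the homogeneous solution must vanish, shows that such a function with stable component \<open>\<zeta>\<close>
  at \<open>s\<close> is
  \<open>U t s \<zeta> + U t 0 (P 0 (\<integral> \<Phi> H over {s..<t}) - \<integral> (Id - P 0) \<Phi> H over {t..})\<close>.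
  Being right limits of \<open>U t r P r\<close> and of \<open>U t r (Id - P r)\<close>, the two kernels are bounded by \<open>K\<close>.
  Since \<open>du\<close> has total mass at most \<open>V\<close>, this expression is a contraction with factor \<open>K L V\<close> of the
  space of bounded functions, where \<open>L\<close> is the Lipschitz constant of \<open>H\<close>. If \<open>K L V \<le> 1/2\<close>, then
  there is exactly one such function for each \<open>\<zeta>\<close>, and it depends on \<open>\<zeta>\<close> in a Lipschitz
  way. The graph consists of the values at \<open>s\<close> of these functions. It is invariant: to go back in
  time a solution is pasted in front of the bounded function, and forward in time the two agree by
  uniqueness (\<open>graph_manifold_invariant\<close>).

  Three points need care. First, only the indefinite integrals of the coefficients are controlled,
  by a nondecreasing left-continuous function \<open>h\<close>, whereas the norms of the coefficients need not be
  integrable. Solutions are left-continuous and therefore have separable range, and for such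
  functions \<open>norm_ps_primitive_apply_le\<close> recovers the estimate that absolute integrability would
  give. Together with the jump relation \<open>ps_primitive_jump\<close> it carries the linear theory: uniqueness
  in both directions of time, and the estimate of the variation of \<open>U\<close> by that of \<open>h\<close>.

  Second, the state space may be non-separable, so the Bochner integral of the forcing is developed
  from approximation by simple functions in the sense of \<open>L1_close\<close>.

  Third, \<open>variation_of_constants\<close> is proved without exchanging the order of two integrals. Both
  sides are additive in the interval \<open>{a..<b}\<close>, and on an interval where \<open>h\<close> varies by at most
  \<open>\<epsilon>\<close> after its initial jump they differ by at most a multiple of \<open>\<epsilon> (u b - u a)\<close>.
  As every point has a neighbourhood whose left and right halves are such intervals, bisection
  (\<open>Bolzano\<close>) yields the same bound on every interval. The local uniqueness statements are
  globalized in the same way.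
\<close>

section \<open>Kurzweil--Stieltjes primitives\<close>

abbreviation stieltjes_sum :: "(real \<Rightarrow> 'b::real_normed_vector) \<Rightarrow> (real \<Rightarrow> real) \<Rightarrow> (real \<times> real set) set \<Rightarrow> 'b" where
  "stieltjes_sum f u p \<equiv> \<Sum>(x, k)\<in>p. (u (Sup k) - u (Inf k)) *\<^sub>R f x"

lemma has_ps_integralE:
  assumes "has_ps_integral f u I a b" "e > 0"
  obtains \<gamma> where "gauge \<gamma>" "\<forall>p. p tagged_division_of {a..b} \<longrightarrow> \<gamma> fine p \<longrightarrow>
    norm (stieltjes_sum f u p - I) < e"
  using assms(1)[unfolded has_ps_integral_def imp_conjL, rule_format, OF assms(2)] by (elim exE conjE)

lemma has_ps_integralI:
  assumes "\<And>e. e > 0 \<Longrightarrow> \<exists>\<gamma>. gauge \<gamma> \<and> (\<forall>p. p tagged_division_of {a..b} \<longrightarrow> \<gamma> fine p \<longrightarrow>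
    norm (stieltjes_sum f u p - I) < e)"
  shows "has_ps_integral f u I a b"
  unfolding has_ps_integral_def imp_conjL by (intro allI impI assms)

lemma has_ps_integral_unique:
  assumes "has_ps_integral f u I a b" "has_ps_integral f u J a b"
  shows "I = J"
proof (rule ccontr)
  assume "I \<noteq> J"
  then have e: "norm (I - J) / 2 > 0" by simp
  obtain g1 where g1: "gauge g1" "\<And>p. p tagged_division_of {a..b} \<Longrightarrow> g1 fine p \<Longrightarrow>
      norm (stieltjes_sum f u p - I) < norm (I - J) / 2"
    by (rule has_ps_integralE[OF assms(1) e], rule that; iprover)
  obtain g2 where g2: "gauge g2" "\<And>p. p tagged_division_of {a..b} \<Longrightarrow> g2 fine p \<Longrightarrow>
      norm (stieltjes_sum f u p - J) < norm (I - J) / 2"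
    by (rule has_ps_integralE[OF assms(2) e], rule that; iprover)
  obtain p where p: "p tagged_division_of {a..b}" "(\<lambda>x. g1 x \<inter> g2 x) fine p"
    using fine_division_exists_real[OF gauge_Int[OF g1(1) g2(1)]] by blast
  let ?S = "stieltjes_sum f u p"
  have "norm (I - J) = norm ((?S - J) - (?S - I))" by simp
  also have "\<dots> \<le> norm (?S - J) + norm (?S - I)" by (rule norm_triangle_ineq4)
  also have "\<dots> < norm (I - J) / 2 + norm (I - J) / 2"
    using g1(2)[OF p(1)] g2(2)[OF p(1)] p(2) by (intro add_strict_mono) (auto simp: fine_Int)
  finally show False by simp
qed

lemma has_ps_integral_linear:
  assumes "bounded_linear T" "has_ps_integral f u I a b"
  shows "has_ps_integral (\<lambda>x. T (f x)) u (T I) a b"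
proof (rule has_ps_integralI)
  fix e :: real assume "e > 0"
  interpret bounded_linear T by fact
  obtain B where B: "B > 0" "\<And>x. norm (T x) \<le> norm x * B"
    using pos_bounded by blast
  from \<open>e > 0\<close> B have "e / B > 0" by simp
  obtain g where g: "gauge g" "\<And>p. p tagged_division_of {a..b} \<Longrightarrow> g fine p \<Longrightarrow>
      norm (stieltjes_sum f u p - I) < e / B"
    by (rule has_ps_integralE[OF assms(2) \<open>e / B > 0\<close>], rule that; iprover)
  have "norm ((\<Sum>(x, k)\<in>p. (u (Sup k) - u (Inf k)) *\<^sub>R T (f x)) - T I) < e"
    if p: "p tagged_division_of {a..b}" "g fine p" for p
  proof -
    have "(\<Sum>(x, k)\<in>p. (u (Sup k) - u (Inf k)) *\<^sub>R T (f x)) - T I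
      = T (stieltjes_sum f u p - I)"
      by (simp add: diff sum scaleR split_def)
    also have "norm \<dots> \<le> norm (stieltjes_sum f u p - I) * B"
      by (rule B)
    also have "\<dots> < e / B * B" using g(2)[OF p] B(1) by (intro mult_strict_right_mono) auto
    finally show ?thesis using B(1) by simp
  qed
  with g(1) show "\<exists>\<gamma>. gauge \<gamma> \<and> (\<forall>p. p tagged_division_of {a..b} \<longrightarrow> \<gamma> fine p \<longrightarrow>
      norm ((\<Sum>(x, k)\<in>p. (u (Sup k) - u (Inf k)) *\<^sub>R T (f x)) - T I) < e)"
    by (intro exI[of _ g]) simp
qed

lemma has_ps_integral_add:
  assumes "has_ps_integral f u I a b" "has_ps_integral g u J a b"
  shows "has_ps_integral (\<lambda>x. f x + g x) u (I + J) a b"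
proof (rule has_ps_integralI)
  fix e :: real assume "e > 0"
  then have e: "e / 2 > 0" by simp
  obtain g1 where g1: "gauge g1" "\<And>p. p tagged_division_of {a..b} \<Longrightarrow> g1 fine p \<Longrightarrow>
      norm (stieltjes_sum f u p - I) < e / 2"
    by (rule has_ps_integralE[OF assms(1) e], rule that; iprover)
  obtain g2 where g2: "gauge g2" "\<And>p. p tagged_division_of {a..b} \<Longrightarrow> g2 fine p \<Longrightarrow>
      norm (stieltjes_sum g u p - J) < e / 2"
    by (rule has_ps_integralE[OF assms(2) e], rule that; iprover)
  have "norm ((\<Sum>(x, k)\<in>p. (u (Sup k) - u (Inf k)) *\<^sub>R (f x + g x)) - (I + J)) < e"
    if p: "p tagged_division_of {a..b}" "(\<lambda>x. g1 x \<inter> g2 x) fine p" for p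
  proof -
    have "(\<Sum>(x, k)\<in>p. (u (Sup k) - u (Inf k)) *\<^sub>R (f x + g x)) - (I + J)
      = (stieltjes_sum f u p - I)
        + (stieltjes_sum g u p - J)"
      by (simp add: scaleR_add_right sum.distrib split_def)
    also have "norm \<dots> < e / 2 + e / 2"
      using g1(2)[OF p(1)] g2(2)[OF p(1)] p(2)
      by (intro norm_triangle_lt add_strict_mono) (auto simp: fine_Int)
    finally show ?thesis by simp
  qed
  with gauge_Int[OF g1(1) g2(1)] show "\<exists>\<gamma>. gauge \<gamma> \<and> (\<forall>p. p tagged_division_of {a..b} \<longrightarrow> \<gamma> fine p \<longrightarrow>
      norm ((\<Sum>(x, k)\<in>p. (u (Sup k) - u (Inf k)) *\<^sub>R (f x + g x)) - (I + J)) < e)"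
    by (intro exI[of _ "\<lambda>x. g1 x \<inter> g2 x"]) simp
qed

lemma tagged_division_real_intervalE:
  assumes "p tagged_division_of {a..b::real}" "(x, k) \<in> p"
  obtains c d where "k = {c..d}" "c \<le> x" "x \<le> d" "a \<le> c" "d \<le> b"
proof -
  obtain c d where k: "k = {c..d}" using tagged_division_ofD(4)[OF assms] by (auto simp: cbox_interval)
  have "x \<in> k" "k \<subseteq> {a..b}" using tagged_division_ofD(2,3)[OF assms] by auto
  with k show thesis by (intro that[of c d]) auto
qed

text \<open>
  Fine partitions of \<open>{a..c}\<close> and \<open>{c..b}\<close> unite to one of \<open>{a..b}\<close>. The only pairs they can share
  are degenerate intervals at \<open>c\<close>, which have weight zero.
\<close>

lemma has_ps_integral_combine:
  assumes "a \<le> c" "c \<le> b" "has_ps_integral f u I1 a c" "has_ps_integral f u I2 c b"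
    "has_ps_integral f u I a b"
  shows "I = I1 + I2"
proof (rule ccontr)
  assume "I \<noteq> I1 + I2"
  define e where "e = norm (I - (I1 + I2)) / 3"
  have e: "e > 0" using \<open>I \<noteq> I1 + I2\<close> by (simp add: e_def)
  let ?S = "stieltjes_sum f u"
  obtain g1 where g1: "gauge g1" "\<And>p. p tagged_division_of {a..c} \<Longrightarrow> g1 fine p \<Longrightarrow> norm (?S p - I1) < e"
    by (rule has_ps_integralE[OF assms(3) e], rule that; iprover)
  obtain g2 where g2: "gauge g2" "\<And>p. p tagged_division_of {c..b} \<Longrightarrow> g2 fine p \<Longrightarrow> norm (?S p - I2) < e"
    by (rule has_ps_integralE[OF assms(4) e], rule that; iprover)
  obtain g3 where g3: "gauge g3" "\<And>p. p tagged_division_of {a..b} \<Longrightarrow> g3 fine p \<Longrightarrow> norm (?S p - I) < e"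
    by (rule has_ps_integralE[OF assms(5) e], rule that; iprover)
  let ?g = "\<lambda>x. g1 x \<inter> g2 x \<inter> g3 x"
  have g: "gauge ?g" using g1 g2 g3 by (intro gauge_Int)
  obtain p1 where p1: "p1 tagged_division_of {a..c}" "?g fine p1"
    using fine_division_exists_real[OF g] by blast
  obtain p2 where p2: "p2 tagged_division_of {c..b}" "?g fine p2"
    using fine_division_exists_real[OF g] by blast
  have "interior {a..c} \<inter> interior {c..b} = {}" by (auto simp: interior_atLeastAtMost_real)
  from tagged_division_Un[OF p1(1) p2(1) this]
  have p: "(p1 \<union> p2) tagged_division_of {a..b}" using assms(1,2) by (simp add: ivl_disj_un_two_touch(4))
  have "?S (p1 \<union> p2) + ?S (p1 \<inter> p2) = ?S p1 + ?S p2"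
    by (rule sum.union_inter) (use p1 p2 in blast)+
  moreover have "?S (p1 \<inter> p2) = 0"
  proof (rule sum.neutral, safe)
    fix x k assume xk: "(x, k) \<in> p1" "(x, k) \<in> p2"
    from tagged_division_real_intervalE[OF p1(1) xk(1)]
    obtain d d' where d: "k = {d..d'}" "d \<le> x" "x \<le> d'" "d' \<le> c" by metis
    from tagged_division_real_intervalE[OF p2(1) xk(2)]
    obtain l l' where l: "k = {l..l'}" "l \<le> x" "x \<le> l'" "c \<le> l" by metis
    have "d = d'" using d l by simp
    then show "(u (Sup k) - u (Inf k)) *\<^sub>R f x = 0" using d(1) by simp
  qed
  ultimately have S: "?S (p1 \<union> p2) = ?S p1 + ?S p2" by simp
  have "3 * e = norm (I - (I1 + I2))" by (simp add: e_def)
  also have "\<dots> = norm ((?S p1 - I1) + (?S p2 - I2) - (?S (p1 \<union> p2) - I))" unfolding S by (simp add: algebra_simps)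
  also have "\<dots> \<le> norm (?S p1 - I1) + norm (?S p2 - I2) + norm (?S (p1 \<union> p2) - I)"
    by (intro order_trans[OF norm_triangle_ineq4] add_right_mono norm_triangle_ineq)
  also have "\<dots> < e + e + e"
    using p1 p2 by (intro add_strict_mono g1(2) g2(2) g3(2) p fine_Un) (auto simp: fine_Int)
  finally show False by simp
qed

text \<open>
  A primitive packages the integrability on all compact intervals together with the additivity of
  the integral, so that \<open>W\<close> can be used without case distinctions on the order of the end points.
\<close>

definition ps_primitive ::
    "(real \<Rightarrow> 'b::real_normed_vector) \<Rightarrow> (real \<Rightarrow> real) \<Rightarrow> (real \<Rightarrow> 'b) \<Rightarrow> bool" where
  "ps_primitive f u W \<longleftrightarrow> (\<forall>c d. c \<le> d \<longrightarrow> has_ps_integral f u (W d - W c) c d)"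

lemma ps_primitiveD: "ps_primitive f u W \<Longrightarrow> c \<le> d \<Longrightarrow> has_ps_integral f u (W d - W c) c d"
  by (simp add: ps_primitive_def)

lemma ps_primitive_linear:
  "bounded_linear T \<Longrightarrow> ps_primitive f u W \<Longrightarrow> ps_primitive (\<lambda>x. T (f x)) u (\<lambda>t. T (W t))"
  unfolding ps_primitive_def
  by (metis bounded_linear.linear has_ps_integral_linear linear_diff)

lemma ps_primitive_add:
  "ps_primitive f u W \<Longrightarrow> ps_primitive g u X \<Longrightarrow> ps_primitive (\<lambda>x. f x + g x) u (\<lambda>t. W t + X t)"
  unfolding ps_primitive_def by (auto dest!: has_ps_integral_add simp: add_diff_add)

lemma ps_primitive_minus: "ps_primitive f u W \<Longrightarrow> ps_primitive (\<lambda>x. - f x) u (\<lambda>t. - W t)"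
  by (rule ps_primitive_linear[OF bounded_linear_minus[OF bounded_linear_ident]])

lemma ps_primitive_diff:
  "ps_primitive f u W \<Longrightarrow> ps_primitive g u X \<Longrightarrow> ps_primitive (\<lambda>x. f x - g x) u (\<lambda>t. W t - X t)"
  using ps_primitive_add[OF _ ps_primitive_minus] by fastforce

lemma ps_integral_eqI:
  assumes "has_ps_integral f u I a b" "a \<le> b"
  shows "ps_integral f u a b = I"
proof -
  have "(THE I. has_ps_integral f u I a b) = I"
    by (rule the_equality, rule assms(1), rule has_ps_integral_unique[OF _ assms(1)])
  then show ?thesis using assms(2) by (simp add: ps_integral_def oriented_def)
qed

lemma ps_integral_primitive:
  assumes "ps_primitive f u W"
  shows "ps_integral f u s t = W t - W s"
proof (cases "s \<le> t")
  case True
  then show ?thesis using assms by (intro ps_integral_eqI) (auto simp: ps_primitive_def)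
next
  case False
  then have "ps_integral f u t s = W s - W t"
    using assms by (intro ps_integral_eqI) (auto simp: ps_primitive_def)
  with False show ?thesis by (auto simp: ps_integral_def oriented_def)
qed

lemma ps_primitive_ps_integral:
  assumes "\<And>c d. c \<le> d \<Longrightarrow> ps_integrable f u c d"
  shows "ps_primitive f u (ps_integral f u 0)"
proof -
  let ?I = "ps_integral f u"
  have has: "has_ps_integral f u (?I c d) c d" if "c \<le> d" for c d
    using assms[OF that] ps_integral_eqI[OF _ that] unfolding ps_integrable_def by metis
  have comb: "?I a b = ?I a c + ?I c b" if "a \<le> c" "c \<le> b" for a b c
    using that has_ps_integral_combine[of a c b f u] has by (meson order_trans)
  have neg: "?I c d = - ?I d c" if "d < c" for c d
    using that by (simp add: ps_integral_def oriented_def)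
  have "?I 0 d - ?I 0 c = ?I c d" if "c \<le> d" for c d
  proof -
    consider "0 \<le> c" | "c < 0" "0 \<le> d" | "c < 0" "d < 0" by linarith
    then show ?thesis
    proof cases
      case 1 then show ?thesis using comb[of 0 c d] that by simp
    next
      case 2 then show ?thesis using comb[of c 0 d] neg[of c 0] that by simp
    next
      case 3 then show ?thesis using comb[of c d 0] neg[of c 0] neg[of d 0] that by simp
    qed
  qed
  with has show ?thesis unfolding ps_primitive_def by metis
qed

lemma has_ps_integral_ident_iff:
  "has_ps_integral f (\<lambda>x. x) I a b \<longleftrightarrow> (f has_integral I) {a..b}"
proof -
  have "(\<Sum>(x, k)\<in>p. (Sup k - Inf k) *\<^sub>R f x) = (\<Sum>(x, k)\<in>p. measure lborel k *\<^sub>R f x)"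
    if "p tagged_division_of {a..b}" for p
  proof (rule sum.cong[OF refl], safe)
    fix x k assume "(x, k) \<in> p"
    with that obtain c d where "k = {c..d}" "c \<le> d"
      by (meson order_trans tagged_division_real_intervalE)
    then show "(Sup k - Inf k) *\<^sub>R f x = measure lborel k *\<^sub>R f x" by (simp add: cSup_atLeastAtMost)
  qed
  then show ?thesis
    unfolding has_ps_integral_def has_integral[of f I a b, unfolded cbox_interval] by (metis (no_types, lifting))
qed

lemma ps_primitive_perron_integral:
  assumes "\<And>c d. c \<le> d \<Longrightarrow> f integrable_on {c..d}"
  shows "ps_primitive f (\<lambda>x. x) (perron_integral f 0)"
    and "perron_integral f = ps_integral f (\<lambda>x. x)"
proof -
  have "(THE I. (f has_integral I) {a..b}) = integral {a..b} f" if "a \<le> b" for a b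
    using assms[OF that] by (metis has_integral_integral has_integral_unique the_equality)
  then show *: "perron_integral f = ps_integral f (\<lambda>x. x)"
    by (auto simp: perron_integral_def ps_integral_def oriented_def has_ps_integral_ident_iff fun_eq_iff)
  show "ps_primitive f (\<lambda>x. x) (perron_integral f 0)"
    unfolding * by (rule ps_primitive_ps_integral)
      (use assms in \<open>auto simp: ps_integrable_def has_ps_integral_ident_iff integrable_on_def\<close>)
qed

text \<open>
  The Saks--Henstock lemma for norms of sums (for vector values there is no version with sums of
  norms). Only the selected part \<open>q\<close> has to be fine: the other intervals of \<open>p\<close> are subdivided so
  finely that their Riemann sums are as close to the integrals as desired. That \<open>q\<close> may be fine for
  a gauge for which \<open>p\<close> is not is what the proof of \<open>norm_ps_primitive_apply_le\<close> uses.
\<close>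

lemma saks_henstock:
  fixes f :: "real \<Rightarrow> 'b::real_normed_vector"
  assumes W: "ps_primitive f u W" and "a \<le> b" "e > 0"
  obtains \<gamma> where "gauge \<gamma>" "\<And>p q. p tagged_division_of {a..b} \<Longrightarrow> q \<subseteq> p \<Longrightarrow> \<gamma> fine q \<Longrightarrow>
    norm (\<Sum>(x, k)\<in>q. (u (Sup k) - u (Inf k)) *\<^sub>R f x - (W (Sup k) - W (Inf k))) \<le> e"
proof -
  let ?S = "stieltjes_sum f u"
  have e2: "e / 2 > 0" using \<open>e > 0\<close> by simp
  obtain \<gamma> where g: "gauge \<gamma>" "\<And>p. p tagged_division_of {a..b} \<Longrightarrow> \<gamma> fine p \<Longrightarrow> norm (?S p - (W b - W a)) < e / 2"
    by (rule has_ps_integralE[OF ps_primitiveD[OF W \<open>a \<le> b\<close>] e2], rule that; iprover)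
  have "norm (\<Sum>(x, k)\<in>q. (u (Sup k) - u (Inf k)) *\<^sub>R f x - (W (Sup k) - W (Inf k))) \<le> e"
    if p: "p tagged_division_of {a..b}" and q: "q \<subseteq> p" and fine: "\<gamma> fine q" for p q
  proof -
    have finp: "finite p" using p by blast
    have finq: "finite q" using finp q by (rule rev_finite_subset)
    \<comment> \<open>The allowance for each of the intervals outside \<open>q\<close>, so that together they
      cost at most \<open>e / 2\<close>.\<close>
    define \<delta> where "\<delta> = e / 2 / (card p + 1)"
    have \<delta>: "\<delta> > 0" using \<open>e > 0\<close> by (simp add: \<delta>_def)
    have inj: "inj_on snd p"
    proof (rule inj_onI, clarsimp)
      fix x y k assume xy: "(x, k) \<in> p" "(y, k) \<in> p"
      show "x = y"
      proof (rule ccontr)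
        assume "x \<noteq> y"
        with tagged_division_ofD(5)[OF p xy] have int: "interior k = {}" by auto
        obtain c d where "k = {c..d}" using tagged_division_real_intervalE[OF p xy(1)] by metis
        moreover have "x \<in> k" "y \<in> k" using tagged_division_ofD(2)[OF p] xy by auto
        ultimately show False using int \<open>x \<noteq> y\<close> by (auto simp: interior_atLeastAtMost_real)
      qed
    qed
    have ex: "\<exists>r. r tagged_division_of k \<and> \<gamma> fine r \<and> (\<forall>x. (x, k) \<in> q \<longrightarrow> r = {(x, k)}) \<and>
        ((\<forall>x. (x, k) \<notin> q) \<longrightarrow> norm (?S r - (W (Sup k) - W (Inf k))) < \<delta>)" if "k \<in> snd ` p" for k
    proof (cases "\<exists>x. (x, k) \<in> q")
      case True
      then obtain x where x: "(x, k) \<in> q" by blast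
      then have xp: "(x, k) \<in> p" using q by blast
      obtain c d where k: "k = {c..d}" "c \<le> x" "x \<le> d"
        using tagged_division_real_intervalE[OF p xp] by metis
      have "{(x, k)} tagged_division_of k" using k by (simp add: tagged_division_of_self_real)
      moreover have "\<gamma> fine {(x, k)}" using fine x by (auto simp: fine_def)
      moreover have "y = x" if "(y, k) \<in> q" for y
        using inj_onD[OF inj, of "(y, k)" "(x, k)"] that xp q by auto
      ultimately show ?thesis using x by blast
    next
      case False
      from that obtain x where "(x, k) \<in> p" by auto
      then obtain c d where k: "k = {c..d}" "c \<le> x" "x \<le> d"
        using tagged_division_real_intervalE[OF p] by metis
      then have hp: "has_ps_integral f u (W (Sup k) - W (Inf k)) c d"
        using W by (auto simp: ps_primitive_def)
      obtain g' where g': "gauge g'" "\<And>r. r tagged_division_of {c..d} \<Longrightarrow> g' fine r \<Longrightarrow> norm (?S r - (W (Sup k) - W (Inf k))) < \<delta>"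
        by (rule has_ps_integralE[OF hp \<delta>], rule that; iprover)
      obtain r where "r tagged_division_of k" "(\<lambda>x. \<gamma> x \<inter> g' x) fine r"
        using fine_division_exists_real[OF gauge_Int[OF g(1) g'(1)]] k(1) by metis
      then show ?thesis using False g'(2)[of r] k(1) by (intro exI[of _ r] conjI impI allI) (simp_all add: fine_Int)
    qed
    have "\<forall>k\<in>snd ` p. \<exists>r. r tagged_division_of k \<and> \<gamma> fine r \<and> (\<forall>x. (x, k) \<in> q \<longrightarrow> r = {(x, k)}) \<and>
        ((\<forall>x. (x, k) \<notin> q) \<longrightarrow> norm (?S r - (W (Sup k) - W (Inf k))) < \<delta>)"
      by (rule ballI) (rule ex)
    from bchoice[OF this] obtain r where r0: "\<forall>k\<in>snd ` p. r k tagged_division_of k \<and> \<gamma> fine r k \<and>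
        (\<forall>x. (x, k) \<in> q \<longrightarrow> r k = {(x, k)}) \<and>
        ((\<forall>x. (x, k) \<notin> q) \<longrightarrow> norm (?S (r k) - (W (Sup k) - W (Inf k))) < \<delta>)" ..
    have r: "k \<in> snd ` p \<Longrightarrow> r k tagged_division_of k" "k \<in> snd ` p \<Longrightarrow> \<gamma> fine r k"
        "k \<in> snd ` p \<Longrightarrow> (x, k) \<in> q \<Longrightarrow> r k = {(x, k)}"
        "k \<in> snd ` p \<Longrightarrow> (\<And>x. (x, k) \<notin> q) \<Longrightarrow> norm (?S (r k) - (W (Sup k) - W (Inf k))) < \<delta>" for k x
      using bspec[OF r0, of k] by iprover+
    have disj: "interior k \<inter> interior l = {}" if "k \<in> snd ` p" "l \<in> snd ` p" "k \<noteq> l" for k l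
      using that tagged_division_ofD(5)[OF p] by fastforce
    have R: "\<Union>(r ` snd ` p) tagged_division_of {a..b}"
    proof -
      have "\<Union>(r ` snd ` p) tagged_division_of \<Union>(snd ` p)"
        by (rule tagged_division_Union) (use finp r disj in auto)
      also have "\<Union>(snd ` p) = {a..b}" using tagged_division_ofD(6)[OF p] by force
      finally show ?thesis .
    qed
    have Rfine: "\<gamma> fine \<Union>(r ` snd ` p)" using r(2) by (intro fine_Union) auto
    have injr: "inj_on r (snd ` p)"
    proof (rule inj_onI)
      fix k l assume kl: "k \<in> snd ` p" "l \<in> snd ` p" "r k = r l"
      have "k = \<Union>{K. \<exists>x. (x, K) \<in> r k}" by (rule tagged_division_ofD(6)[OF r(1)[OF kl(1)], symmetric])
      also have "\<dots> = \<Union>{K. \<exists>x. (x, K) \<in> r l}" unfolding kl(3) by (rule refl)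
      also have "\<dots> = l" by (rule tagged_division_ofD(6)[OF r(1)[OF kl(2)]])
      finally show "k = l" .
    qed
    have "?S (\<Union>(r ` snd ` p)) = (sum (sum (\<lambda>(x, k). (u (Sup k) - u (Inf k)) *\<^sub>R f x)) (r ` snd ` p))"
    proof (subst sum.Union_comp)
      show "\<forall>A\<in>r ` snd ` p. finite A"
      proof
        fix A assume "A \<in> r ` snd ` p"
        then obtain k where "k \<in> snd ` p" "A = r k" by (rule imageE)
        then show "finite A" using tagged_division_of_finite[OF r(1)[of k]] by simp
      qed
      fix A1 A2 x assume A: "A1 \<in> r ` snd ` p" "A2 \<in> r ` snd ` p" "A1 \<noteq> A2" "x \<in> A1" "x \<in> A2"
      obtain k where k: "k \<in> snd ` p" "A1 = r k" using A(1) by (rule imageE)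
      obtain l where l: "l \<in> snd ` p" "A2 = r l" using A(2) by (rule imageE)
      have kl: "k \<in> snd ` p" "l \<in> snd ` p" "k \<noteq> l" "x \<in> r k" "x \<in> r l" using k l A by metis+
      obtain y m where x: "x = (y, m)" by (cases x)
      have m: "m \<subseteq> k" "m \<subseteq> l" using tagged_division_ofD(3)[OF r(1)] kl x by auto
      have "interior m \<subseteq> interior k \<inter> interior l" using m by (simp add: interior_mono)
      then have int: "interior m = {}" using disj kl by blast
      obtain c d where cd: "m = {c..d}" using tagged_division_ofD(4)[OF r(1)[OF kl(1)], of y m] kl(4) unfolding x cbox_interval by blast
      have "y \<in> m" using tagged_division_ofD(2)[OF r(1)[OF kl(1)]] kl(4) unfolding x by blast
      with int cd have "c = d" by (auto simp: interior_atLeastAtMost_real)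
      then show "(case x of (x, k) \<Rightarrow> (u (Sup k) - u (Inf k)) *\<^sub>R f x) = 0" using x cd by simp
    qed simp
    also have "\<dots> = (\<Sum>k\<in>snd ` p. ?S (r k))" by (subst sum.reindex[OF injr]) simp
    also have "\<dots> = (\<Sum>(x, k)\<in>p. ?S (r k))" by (subst sum.reindex[OF inj]) (simp add: split_def)
    also have "\<dots> = (\<Sum>(x, k)\<in>q. ?S (r k)) + (\<Sum>(x, k)\<in>p - q. ?S (r k))"
      using sum.subset_diff[OF q finp, of "\<lambda>(x, k). ?S (r k)"] by simp
    also have "(\<Sum>(x, k)\<in>q. ?S (r k)) = ?S q"
    proof (rule sum.cong[OF refl], safe)
      fix x k assume "(x, k) \<in> q"
      moreover from this have "k \<in> snd ` p" using q by force
      ultimately show "?S (r k) = (u (Sup k) - u (Inf k)) *\<^sub>R f x" using r(3)[of k x] by simp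
    qed
    finally have SR: "?S (\<Union>(r ` snd ` p)) = ?S q + (\<Sum>(x, k)\<in>p - q. ?S (r k))" .
    have WW: "W b - W a = (\<Sum>(x, k)\<in>q. W (Sup k) - W (Inf k)) + (\<Sum>(x, k)\<in>p - q. W (Sup k) - W (Inf k))"
      using additive_tagged_division_1[OF \<open>a \<le> b\<close> p, of W]
        sum.subset_diff[OF q finp, of "\<lambda>(x, k). W (Sup k) - W (Inf k)"] by (simp add: add.commute)
    have "(\<Sum>(x, k)\<in>q. (u (Sup k) - u (Inf k)) *\<^sub>R f x - (W (Sup k) - W (Inf k)))
      = (?S (\<Union>(r ` snd ` p)) - (W b - W a)) - (\<Sum>(x, k)\<in>p - q. ?S (r k) - (W (Sup k) - W (Inf k)))"
      unfolding SR WW by (simp add: sum_subtractf split_def)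
    moreover have "norm (\<Sum>(x, k)\<in>p - q. ?S (r k) - (W (Sup k) - W (Inf k))) \<le> card (p - q) * \<delta>"
    proof (rule sum_norm_bound, safe)
      fix x k assume xk: "(x, k) \<in> p" "(x, k) \<notin> q"
      have "(y, k) \<notin> q" for y using inj_onD[OF inj, of "(y, k)" "(x, k)"] xk q by auto
      moreover have "k \<in> snd ` p" using xk by force
      ultimately show "norm (?S (r k) - (W (Sup k) - W (Inf k))) \<le> \<delta>" using r(4)[of k] by simp
    qed
    moreover have "card (p - q) * \<delta> \<le> e / 2"
    proof -
      have "real (card (p - q)) \<le> card p + 1" using card_mono[OF finp, of "p - q"] by simp
      then have "real (card (p - q)) * \<delta> \<le> (card p + 1) * \<delta>" using \<delta> by (intro mult_right_mono) auto
      also have "(card p + 1) * \<delta> = e / 2" unfolding \<delta>_def by (simp add: field_split_simps)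
      finally show ?thesis .
    qed
    moreover have "norm (?S (\<Union>(r ` snd ` p)) - (W b - W a)) \<le> e / 2"
      by (rule less_imp_le[OF g(2)[OF R Rfine]])
    moreover have "norm x \<le> e" if "x = y - z" "norm z \<le> c" "c \<le> e / 2" "norm y \<le> e / 2" for x y z :: 'b and c
      using that norm_triangle_ineq4[of y z] by simp
    ultimately show ?thesis by iprover
  qed
  with g(1) show thesis by (rule that)
qed

text \<open>
  A single tagged interval \<open>(a, {x..y})\<close> is a part of a partition, so the Saks--Henstock lemma
  compares its Riemann sum with the integral. For continuous \<open>u\<close> this is continuity of the
  primitive; at a discontinuity it identifies the jump.
\<close>

lemma ps_primitive_jump:
  assumes W: "ps_primitive f u W"
  shows "((\<lambda>r. W r - W a - (u r - u a) *\<^sub>R f a) \<longlongrightarrow> 0) (at a)"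
proof (rule tendstoI)
  fix e :: real assume "e > 0"
  then have e: "e / 2 > 0" by simp
  have le: "a - 1 \<le> a + 1" by simp
  obtain \<gamma> where g: "gauge \<gamma>" "\<And>p q. p tagged_division_of {a - 1..a + 1} \<Longrightarrow> q \<subseteq> p \<Longrightarrow> \<gamma> fine q \<Longrightarrow>
    norm (\<Sum>(x, k)\<in>q. (u (Sup k) - u (Inf k)) *\<^sub>R f x - (W (Sup k) - W (Inf k))) \<le> e / 2"
    by (rule saks_henstock[OF W le e], rule that; iprover)
  have "open (\<gamma> a)" "a \<in> \<gamma> a" using g(1) by (auto simp: gauge_def)
  then obtain d where d: "d > 0" "ball a d \<subseteq> \<gamma> a" by (meson open_contains_ball)
  have *: "norm ((u y - u x) *\<^sub>R f a - (W y - W x)) \<le> e / 2"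
    if "x \<le> a" "a \<le> y" "a - x < min d 1" "y - a < min d 1" for x y
  proof -
    obtain p1 where p1: "p1 tagged_division_of {a - 1..x}"
      by (rule fine_division_exists_real[OF g(1)])
    obtain p2 where p2: "p2 tagged_division_of {y..a + 1}"
      by (rule fine_division_exists_real[OF g(1)])
    have p0: "{(a, {x..y})} tagged_division_of {x..y}" using that by (intro tagged_division_of_self_real) auto
    have "interior {a - 1..x} \<inter> interior {x..y} = {}" by (auto simp: interior_atLeastAtMost_real)
    from tagged_division_Un[OF p1 p0 this]
    have p01: "(p1 \<union> {(a, {x..y})}) tagged_division_of {a - 1..y}"
      using that by (simp add: ivl_disj_un_two_touch(4))
    have "interior {a - 1..y} \<inter> interior {y..a + 1} = {}" by (auto simp: interior_atLeastAtMost_real)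
    from tagged_division_Un[OF p01 p2 this]
    have p: "(p1 \<union> {(a, {x..y})} \<union> p2) tagged_division_of {a - 1..a + 1}"
      using that by (simp add: ivl_disj_un_two_touch(4))
    have "{x..y} \<subseteq> ball a d" using that by (auto simp: dist_real_def)
    then have "\<gamma> fine {(a, {x..y})}" using d by (auto simp: fine_def)
    from g(2)[OF p _ this] that show ?thesis by simp
  qed
  show "\<forall>\<^sub>F r in at a. dist (W r - W a - (u r - u a) *\<^sub>R f a) 0 < e"
    unfolding eventually_at
  proof (intro exI[of _ "min d 1"] conjI ballI impI)
    fix r assume r: "r \<noteq> a \<and> dist r a < min d 1"
    have "norm (W r - W a - (u r - u a) *\<^sub>R f a) \<le> e / 2"
    proof (cases "r \<ge> a")
      case True
      then have "norm ((u r - u a) *\<^sub>R f a - (W r - W a)) \<le> e / 2" using r d by (intro *) (auto simp: dist_real_def)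
      then show ?thesis by (simp add: norm_minus_commute)
    next
      case False
      then have "norm ((u a - u r) *\<^sub>R f a - (W a - W r)) \<le> e / 2" using r d by (intro *) (auto simp: dist_real_def)
      moreover have "(u a - u r) *\<^sub>R f a - (W a - W r) = W r - W a - (u r - u a) *\<^sub>R f a"
        by (simp add: scaleR_diff_left)
      ultimately show ?thesis by simp
    qed
    then show "dist (W r - W a - (u r - u a) *\<^sub>R f a) 0 < e" using \<open>e > 0\<close> by simp
  qed (use d in auto)
qed

text \<open>
  The estimate of the integral of \<open>C s (z s)\<close> that would be trivial if \<open>norm (C s)\<close> had an integral
  bounded by the variation of \<open>h\<close>. Here only the primitive \<open>F\<close> of \<open>C\<close> is controlled, and the result
  depends on the range of \<open>z\<close> being separable. The value \<open>z t\<close> at a tag is replaced by a member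
  \<open>xs (J t)\<close> of the dense sequence, chosen so close that the factor \<open>norm (C t)\<close> does no harm. For
  each index \<open>j\<close> the tags with \<open>J t = j\<close> form a part of the partition on which the vector is
  constant, so there the Saks--Henstock lemma replaces \<open>C\<close> by increments of \<open>F\<close>, with an error that
  is summable over \<open>j\<close>.
\<close>

lemma norm_ps_primitive_apply_le:
  fixes C :: "real \<Rightarrow> 'a::real_normed_vector \<Rightarrow>\<^sub>L 'b::real_normed_vector" and xs :: "nat \<Rightarrow> 'a"
  assumes F: "ps_primitive C u F" and W: "ps_primitive (\<lambda>s. C s (z s)) u W"
    and "mono u" and h: "\<And>c d. c \<le> d \<Longrightarrow> norm (F d - F c) \<le> h d - h c"
    and dense: "\<And>t e. t \<in> {a..b} \<Longrightarrow> e > 0 \<Longrightarrow> \<exists>j. norm (z t - xs j) < e"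
    and B: "\<And>t. t \<in> {a..b} \<Longrightarrow> norm (z t) \<le> B" and "a \<le> b"
  shows "norm (W b - W a) \<le> B * (h b - h a)"
proof -
  have main: "norm (W b - W a) \<le> e * (u b - u a) + e + e + (B + e) * (h b - h a)" if "e > 0" for e
  proof -
    let ?S = "\<lambda>p. \<Sum>(x, k)\<in>p. (u (Sup k) - u (Inf k)) *\<^sub>R C x (z x)"
    obtain \<gamma>0 where g0: "gauge \<gamma>0" "\<And>p. p tagged_division_of {a..b} \<Longrightarrow> \<gamma>0 fine p \<Longrightarrow> norm (?S p - (W b - W a)) < e"
      by (rule has_ps_integralE[OF ps_primitiveD[OF W \<open>a \<le> b\<close>] \<open>e > 0\<close>], rule that; iprover)
    \<comment> \<open>The weights make the errors sum to at most \<open>e\<close> after multiplication by the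
      norms of the vectors.\<close>
    define \<epsilon> where "\<epsilon> j = e * (1 / 2) ^ Suc j / (norm (xs j) + 1)" for j
    have \<epsilon>: "\<epsilon> j > 0" for j using \<open>e > 0\<close> by (simp add: \<epsilon>_def add_nonneg_pos)
    let ?\<Delta> = "\<lambda>x k. (u (Sup k) - u (Inf k)) *\<^sub>R C x - (F (Sup k) - F (Inf k))"
    have "\<forall>j. \<exists>\<gamma>. gauge \<gamma> \<and> (\<forall>p q. p tagged_division_of {a..b} \<longrightarrow> q \<subseteq> p \<longrightarrow> \<gamma> fine q \<longrightarrow>
       norm (\<Sum>(x, k)\<in>q. ?\<Delta> x k) \<le> \<epsilon> j)"
      by (rule allI, rule saks_henstock[OF F \<open>a \<le> b\<close> \<epsilon>]) (rule exI, rule conjI, assumption, iprover)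
    from choice[OF this] obtain \<gamma> where \<gamma>: "\<forall>j. gauge (\<gamma> j) \<and> (\<forall>p q. p tagged_division_of {a..b} \<longrightarrow> q \<subseteq> p \<longrightarrow>
       \<gamma> j fine q \<longrightarrow> norm (\<Sum>(x, k)\<in>q. ?\<Delta> x k) \<le> \<epsilon> j)" ..
    have g: "gauge (\<gamma> j)" "p tagged_division_of {a..b} \<Longrightarrow> q \<subseteq> p \<Longrightarrow> \<gamma> j fine q \<Longrightarrow>
       norm (\<Sum>(x, k)\<in>q. ?\<Delta> x k) \<le> \<epsilon> j" for j p q
      using \<gamma> by iprover+
    have "\<exists>j. t \<in> {a..b} \<longrightarrow> norm (z t - xs j) < e / (1 + norm (C t))" for t
      using dense[of t "e / (1 + norm (C t))"] \<open>e > 0\<close> by (auto simp: add_pos_nonneg)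
    then obtain J where J: "\<And>t. t \<in> {a..b} \<Longrightarrow> norm (z t - xs (J t)) < e / (1 + norm (C t))" by metis
    \<comment> \<open>Each tag obeys the gauge of its own index, so the tags with index \<open>j\<close> form a
      part that is fine for \<open>\<gamma> j\<close>.\<close>
    define \<gamma>' where "\<gamma>' x = \<gamma>0 x \<inter> \<gamma> (J x) x" for x
    have "gauge \<gamma>'" using g0(1) g(1) by (auto simp: gauge_def \<gamma>'_def)
    then obtain p where p: "p tagged_division_of {a..b}" "\<gamma>' fine p"
      using fine_division_exists_real by blast
    have fin: "finite p" using p(1) by blast
    have tag: "x \<in> {a..b}" "Inf k \<le> Sup k" if "(x, k) \<in> p" for x k
      using tagged_division_real_intervalE[OF p(1) that] by (fastforce)+
    have split: "?S p = (\<Sum>(x, k)\<in>p. (u (Sup k) - u (Inf k)) *\<^sub>R C x (z x - xs (J x)))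
        + (\<Sum>(x, k)\<in>p. ?\<Delta> x k (xs (J x))) + (\<Sum>(x, k)\<in>p. (F (Sup k) - F (Inf k)) (xs (J x)))"
      unfolding sum.distrib[symmetric]
      by (rule sum.cong) (auto simp: blinfun.bilinear_simps algebra_simps)
    have usum: "(\<Sum>(x, k)\<in>p. u (Sup k) - u (Inf k)) = u b - u a" for u :: "real \<Rightarrow> real"
      using additive_tagged_division_1[OF \<open>a \<le> b\<close> p(1), of u] .
    have 1: "norm (\<Sum>(x, k)\<in>p. (u (Sup k) - u (Inf k)) *\<^sub>R C x (z x - xs (J x))) \<le> e * (u b - u a)"
    proof -
      have "norm (\<Sum>(x, k)\<in>p. (u (Sup k) - u (Inf k)) *\<^sub>R C x (z x - xs (J x)))
        \<le> (\<Sum>(x, k)\<in>p. e * (u (Sup k) - u (Inf k)))"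
      proof (rule sum_norm_le, clarify)
        fix x k assume xk: "(x, k) \<in> p"
        have nn: "u (Sup k) - u (Inf k) \<ge> 0" using tag(2)[OF xk] \<open>mono u\<close> by (simp add: mono_def)
        have "norm (C x (z x - xs (J x))) \<le> norm (C x) * norm (z x - xs (J x))" by (rule norm_blinfun)
        also have "\<dots> \<le> (1 + norm (C x)) * (e / (1 + norm (C x)))"
          using J[OF tag(1)[OF xk]] by (intro mult_mono) auto
        also have "\<dots> = e" by (simp add: add_nonneg_eq_0_iff)
        finally have "(u (Sup k) - u (Inf k)) * norm (C x (z x - xs (J x))) \<le> (u (Sup k) - u (Inf k)) * e"
          using nn by (rule mult_left_mono)
        then show "norm ((u (Sup k) - u (Inf k)) *\<^sub>R C x (z x - xs (J x))) \<le> e * (u (Sup k) - u (Inf k))"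
          using nn by (simp add: mult.commute)
      qed
      also have "\<dots> = e * (u b - u a)" by (simp add: usum[symmetric] sum_distrib_left split_def)
      finally show ?thesis .
    qed
    have 2: "norm (\<Sum>(x, k)\<in>p. ?\<Delta> x k (xs (J x))) \<le> e"
    proof -
      let ?I = "(\<lambda>(x, k). J x) ` p"
      have "(\<Sum>(x, k)\<in>p. ?\<Delta> x k (xs (J x))) = (\<Sum>j\<in>?I. \<Sum>(x, k)\<in>{y\<in>p. (\<lambda>(x, k). J x) y = j}. ?\<Delta> x k (xs (J x)))"
        by (rule sum.image_gen[OF fin])
      also have "\<dots> = (\<Sum>j\<in>?I. (\<Sum>(x, k)\<in>{y\<in>p. (\<lambda>(x, k). J x) y = j}. ?\<Delta> x k) (xs j))"
        by (auto intro!: sum.cong simp: blinfun.sum_left split_def)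
      also have "norm \<dots> \<le> (\<Sum>j\<in>?I. e * (1 / 2) ^ Suc j)"
      proof (rule sum_norm_le)
        fix j assume "j \<in> ?I"
        let ?q = "{y\<in>p. (\<lambda>(x, k). J x) y = j}"
        have "\<gamma> j fine ?q" using p(2) by (auto simp: fine_def \<gamma>'_def)
        from g(2)[OF p(1) _ this] have "norm (\<Sum>(x, k)\<in>?q. ?\<Delta> x k) \<le> \<epsilon> j" by auto
        then have "norm (\<Sum>(x, k)\<in>?q. ?\<Delta> x k) * norm (xs j) \<le> \<epsilon> j * norm (xs j)" by (intro mult_right_mono) auto
        also have "\<dots> \<le> e * (1 / 2) ^ Suc j"
        proof -
          have "norm (xs j) / (norm (xs j) + 1) \<le> 1" by (subst divide_le_eq_1_pos) (auto simp: add_nonneg_pos)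
          then have "(e * (1 / 2) ^ Suc j) * (norm (xs j) / (norm (xs j) + 1)) \<le> (e * (1 / 2) ^ Suc j) * 1"
            using \<open>e > 0\<close> by (intro mult_left_mono) auto
          then show ?thesis by (simp add: \<epsilon>_def)
        qed
        finally show "norm ((\<Sum>(x, k)\<in>?q. ?\<Delta> x k) (xs j)) \<le> e * (1 / 2) ^ Suc j"
          using norm_blinfun order_trans by blast
      qed
      also have "\<dots> \<le> (\<Sum>j. e * (1 / 2) ^ Suc j)"
        using \<open>e > 0\<close> fin by (intro sum_le_suminf) auto
      also have "\<dots> = e"
        using sums_unique[OF sums_mult[OF power_half_series, of e]] by simp
      finally show ?thesis .
    qed
    have 3: "norm (\<Sum>(x, k)\<in>p. (F (Sup k) - F (Inf k)) (xs (J x))) \<le> (B + e) * (h b - h a)"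
    proof -
      have "norm (\<Sum>(x, k)\<in>p. (F (Sup k) - F (Inf k)) (xs (J x))) \<le> (\<Sum>(x, k)\<in>p. (B + e) * (h (Sup k) - h (Inf k)))"
      proof (rule sum_norm_le, clarify)
        fix x k assume xk: "(x, k) \<in> p"
        have "norm (xs (J x)) \<le> norm (z x) + norm (z x - xs (J x))" by (metis norm_minus_commute norm_triangle_sub)
        moreover have "e / (1 + norm (C x)) \<le> e" using \<open>e > 0\<close> by (simp add: field_simps add_pos_nonneg)
        ultimately have xs: "norm (xs (J x)) \<le> B + e" using B[OF tag(1)[OF xk]] J[OF tag(1)[OF xk]] by linarith
        have "norm ((F (Sup k) - F (Inf k)) (xs (J x))) \<le> norm (F (Sup k) - F (Inf k)) * norm (xs (J x))"
          by (rule norm_blinfun)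
        also have "\<dots> \<le> (h (Sup k) - h (Inf k)) * (B + e)"
          using order_trans[OF norm_ge_zero h[OF tag(2)[OF xk]]] h[OF tag(2)[OF xk]] xs by (intro mult_mono) simp_all
        finally show "norm ((F (Sup k) - F (Inf k)) (xs (J x))) \<le> (B + e) * (h (Sup k) - h (Inf k))"
          by (simp add: mult.commute)
      qed
      also have "\<dots> = (B + e) * (h b - h a)" by (simp add: usum[of h, symmetric] sum_distrib_left split_def)
      finally show ?thesis .
    qed
    have "\<gamma>0 fine p" using p(2) by (auto simp: fine_def \<gamma>'_def)
    from g0(2)[OF p(1) this] have 0: "norm (W b - W a - ?S p) < e" by (simp add: norm_minus_commute)
    have "norm (W b - W a) \<le> norm (?S p) + norm (W b - W a - ?S p)" by (rule norm_triangle_sub)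
    moreover have "norm (?S p) \<le> e * (u b - u a) + e + (B + e) * (h b - h a)"
      unfolding split
      by (rule order_trans[OF norm_triangle_ineq add_mono[OF order_trans[OF norm_triangle_ineq add_mono[OF 1 2]] 3]])
    ultimately show ?thesis using 0 by linarith
  qed
  have "norm (W b - W a) \<le> B * (h b - h a) + e * (u b - u a + 2 + (h b - h a))" if "e > 0" for e
    using main[OF that] by (simp add: algebra_simps)
  moreover have "((\<lambda>e. B * (h b - h a) + e * (u b - u a + 2 + (h b - h a))) \<longlongrightarrow> B * (h b - h a) + 0 * (u b - u a + 2 + (h b - h a))) (at_right 0)"
    by (intro tendsto_intros)
  ultimately show ?thesis
    by (intro tendsto_lowerbound[of _ "B * (h b - h a)" "at_right (0::real)"])
      (auto simp: eventually_at_right_less intro: eventually_mono[OF eventually_at_right_less])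
qed

section \<open>Bochner integrals in non-separable Banach spaces\<close>

abbreviation sbi :: "'a measure \<Rightarrow> ('a \<Rightarrow> 'b::real_vector) \<Rightarrow> 'b" where
  "sbi \<equiv> Bochner_Integration.simple_bochner_integral"

abbreviation simple_integrable :: "'a measure \<Rightarrow> ('a \<Rightarrow> 'b::real_vector) \<Rightarrow> bool" where
  "simple_integrable \<equiv> Bochner_Integration.simple_bochner_integrable"

text \<open>
  In a non-separable space the distance of two measurable functions need not be measurable, so
  distance at most \<open>e\<close> in the mean is expressed by a measurable function that dominates the
  pointwise distance.
\<close>

definition L1_close :: "'a measure \<Rightarrow> ('a \<Rightarrow> 'b::real_normed_vector) \<Rightarrow> ('a \<Rightarrow> 'b) \<Rightarrow> real \<Rightarrow> bool" where
  "L1_close M f g e \<longleftrightarrow> (\<exists>r\<in>borel_measurable M.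
     (\<forall>x\<in>space M. ennreal (norm (f x - g x)) \<le> r x) \<and> (\<integral>\<^sup>+x. r x \<partial>M) \<le> ennreal e)"

definition strongly_integrable :: "'a measure \<Rightarrow> ('a \<Rightarrow> 'b::real_normed_vector) \<Rightarrow> bool" where
  "strongly_integrable M f \<longleftrightarrow> (\<forall>e>0. \<exists>s. simple_integrable M s \<and> L1_close M f s e)"

definition has_strong_integral ::
    "'a measure \<Rightarrow> ('a \<Rightarrow> 'b::real_normed_vector) \<Rightarrow> 'b \<Rightarrow> bool" where
  "has_strong_integral M f I \<longleftrightarrow>
     (\<forall>e>0. \<exists>s. simple_integrable M s \<and> L1_close M f s e \<and> norm (sbi M s - I) \<le> e)"

definition strong_integral :: "'a measure \<Rightarrow> ('a \<Rightarrow> 'b::real_normed_vector) \<Rightarrow> 'b" where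
  "strong_integral M f = (THE I. has_strong_integral M f I)"

lemma L1_closeI:
  assumes "r \<in> borel_measurable M" "\<And>x. x \<in> space M \<Longrightarrow> ennreal (norm (f x - g x)) \<le> r x"
    "(\<integral>\<^sup>+x. r x \<partial>M) \<le> ennreal e"
  shows "L1_close M f g e"
  unfolding L1_close_def using assms by (intro bexI[of _ r]) auto

lemma L1_closeE:
  assumes "L1_close M f g e"
  obtains r where "r \<in> borel_measurable M" "\<forall>x\<in>space M. ennreal (norm (f x - g x)) \<le> r x"
    "(\<integral>\<^sup>+x. r x \<partial>M) \<le> ennreal e"
  using assms unfolding L1_close_def by blast

lemma L1_close_refl: "L1_close M f f e"
  by (rule L1_closeI[of "\<lambda>_. 0"]) auto

text \<open>
  The one place where dominating functions are added. It yields transitivity, sums, and the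
  comparison of two approximations of the same function.
\<close>

lemma L1_close_triangle:
  assumes "L1_close M f f' d" "L1_close M g g' e" "d \<ge> 0" "e \<ge> 0"
    and le: "\<And>x. x \<in> space M \<Longrightarrow> norm (F x - G x) \<le> norm (f x - f' x) + norm (g x - g' x)"
  shows "L1_close M F G (d + e)"
proof -
  obtain r where r: "r \<in> borel_measurable M" "\<forall>x\<in>space M. ennreal (norm (f x - f' x)) \<le> r x"
    "(\<integral>\<^sup>+x. r x \<partial>M) \<le> ennreal d" using assms(1) by (rule L1_closeE)
  obtain q where q: "q \<in> borel_measurable M" "\<forall>x\<in>space M. ennreal (norm (g x - g' x)) \<le> q x"
    "(\<integral>\<^sup>+x. q x \<partial>M) \<le> ennreal e" using assms(2) by (rule L1_closeE)
  show ?thesis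
  proof (rule L1_closeI)
    show "(\<lambda>x. r x + q x) \<in> borel_measurable M" using r(1) q(1) by simp
    show "ennreal (norm (F x - G x)) \<le> r x + q x" if x: "x \<in> space M" for x
    proof -
      have "ennreal (norm (F x - G x)) \<le> ennreal (norm (f x - f' x)) + ennreal (norm (g x - g' x))"
        using le[OF x] by (simp flip: ennreal_plus)
      also have "\<dots> \<le> r x + q x" using bspec[OF r(2) x] bspec[OF q(2) x] by (rule add_mono)
      finally show ?thesis .
    qed
    have "(\<integral>\<^sup>+x. r x + q x \<partial>M) = (\<integral>\<^sup>+x. r x \<partial>M) + (\<integral>\<^sup>+x. q x \<partial>M)" using r(1) q(1) by (rule nn_integral_add)
    also have "\<dots> \<le> ennreal d + ennreal e" using r(3) q(3) by (rule add_mono)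
    also have "\<dots> = ennreal (d + e)" using assms(3,4) by simp
    finally show "(\<integral>\<^sup>+x. r x + q x \<partial>M) \<le> ennreal (d + e)" .
  qed
qed

lemma L1_close_trans:
  assumes "L1_close M f g d" "L1_close M g k e" "d \<ge> 0" "e \<ge> 0"
  shows "L1_close M f k (d + e)"
  by (rule L1_close_triangle[OF assms]) (metis norm_diff_triangle_le order_refl)

lemma L1_close_scale:
  assumes "L1_close M f g e" "e \<ge> 0" "B \<ge> 0"
    and le: "\<And>x. x \<in> space M \<Longrightarrow> norm (F x - G x) \<le> B * norm (f x - g x)"
  shows "L1_close M F G (B * e)"
proof -
  obtain r where r: "r \<in> borel_measurable M" "\<forall>x\<in>space M. ennreal (norm (f x - g x)) \<le> r x"
    "(\<integral>\<^sup>+x. r x \<partial>M) \<le> ennreal e" using assms(1) by (rule L1_closeE)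
  show ?thesis
  proof (rule L1_closeI)
    show "(\<lambda>x. ennreal B * r x) \<in> borel_measurable M" using r(1) by simp
    show "ennreal (norm (F x - G x)) \<le> ennreal B * r x" if x: "x \<in> space M" for x
    proof -
      have "ennreal (norm (F x - G x)) \<le> ennreal B * ennreal (norm (f x - g x))"
        using le[OF x] assms(3) by (simp add: ennreal_leI flip: ennreal_mult)
      also have "\<dots> \<le> ennreal B * r x" using bspec[OF r(2) x] by (intro mult_left_mono) auto
      finally show ?thesis .
    qed
    have "(\<integral>\<^sup>+x. ennreal B * r x \<partial>M) = ennreal B * (\<integral>\<^sup>+x. r x \<partial>M)" using r(1) by (rule nn_integral_cmult)
    also have "\<dots> \<le> ennreal B * ennreal e" using r(3) by (intro mult_left_mono) auto
    also have "\<dots> = ennreal (B * e)" using assms(2,3) by (simp flip: ennreal_mult)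
    finally show "(\<integral>\<^sup>+x. ennreal B * r x \<partial>M) \<le> ennreal (B * e)" .
  qed
qed

lemma L1_close_uniform:
  assumes "finite_measure M" and d: "d \<ge> 0" "d * measure M (space M) \<le> e"
    and le: "\<And>x. x \<in> space M \<Longrightarrow> norm (f x - g x) \<le> d"
  shows "L1_close M f g e"
proof (rule L1_closeI)
  interpret finite_measure M by fact
  have "(\<integral>\<^sup>+x. ennreal d \<partial>M) = ennreal (d * measure M (space M))"
    using d by (simp add: emeasure_eq_measure ennreal_mult)
  with d(2) show "(\<integral>\<^sup>+x. ennreal d \<partial>M) \<le> ennreal e" by (simp add: ennreal_leI)
qed (use le in \<open>simp_all add: ennreal_leI\<close>)

lemma norm_sbi_diff_le:
  assumes st: "simple_integrable M s" "simple_integrable M t" and close: "L1_close M s t e" and "e \<ge> 0"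
  shows "norm (sbi M s - sbi M t) \<le> e"
proof -
  obtain r where r: "r \<in> borel_measurable M" "\<forall>x\<in>space M. ennreal (norm (s x - t x)) \<le> r x"
    "(\<integral>\<^sup>+x. r x \<partial>M) \<le> ennreal e" using close by (rule L1_closeE)
  have n: "simple_integrable M (\<lambda>x. norm (s x - t x))"
    by (rule simple_bochner_integrable_compose2[OF _ st, of "\<lambda>x y. norm (x - y)"]) simp
  have "ennreal (norm (sbi M s - sbi M t)) = ennreal (norm (sbi M (\<lambda>x. s x - t x)))"
    using st by (simp add: simple_bochner_integral_diff)
  also have "\<dots> \<le> ennreal (sbi M (\<lambda>x. norm (s x - t x)))"
    by (intro ennreal_leI simple_bochner_integral_norm_bound simple_bochner_integrable_compose2[OF _ st]) simp
  also have "\<dots> = (\<integral>\<^sup>+x. ennreal (norm (s x - t x)) \<partial>M)"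
    by (rule simple_bochner_integral_eq_nn_integral[OF n]) simp
  also have "\<dots> \<le> (\<integral>\<^sup>+x. r x \<partial>M)" using bspec[OF r(2)] by (rule nn_integral_mono)
  also have "\<dots> \<le> ennreal e" by (rule r(3))
  finally show ?thesis using \<open>e \<ge> 0\<close> by (subst (asm) ennreal_le_iff) auto
qed

lemma norm_sbi_diff_le':
  assumes "simple_integrable M s" "L1_close M f s d" "simple_integrable M t" "L1_close M f t e" "d \<ge> 0" "e \<ge> 0"
  shows "norm (sbi M s - sbi M t) \<le> d + e"
proof (rule norm_sbi_diff_le[OF assms(1,3)])
  show "L1_close M s t (d + e)"
  proof (rule L1_close_triangle[OF assms(2,4,5,6)])
    show "norm (s x - t x) \<le> norm (f x - s x) + norm (f x - t x)" for x
      using norm_triangle_ineq4[of "f x - t x" "f x - s x"] by (simp add: add.commute)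
  qed
qed (use assms in simp)

lemma has_strong_integral_unique:
  assumes "has_strong_integral M f I" "has_strong_integral M f J"
  shows "I = J"
proof -
  have "norm (I - J) \<le> 0 + e" if "e > 0" for e
  proof -
    have e: "e / 4 > 0" using that by simp
    obtain s where s: "simple_integrable M s" "L1_close M f s (e / 4)" "norm (sbi M s - I) \<le> e / 4"
      using assms(1) e unfolding has_strong_integral_def by blast
    obtain t where t: "simple_integrable M t" "L1_close M f t (e / 4)" "norm (sbi M t - J) \<le> e / 4"
      using assms(2) e unfolding has_strong_integral_def by blast
    have "I - J = (sbi M s - sbi M t) - (sbi M s - I) + (sbi M t - J)" by simp
    then have "norm (I - J) \<le> norm (sbi M s - sbi M t) + norm (sbi M s - I) + norm (sbi M t - J)"
      by (metis norm_triangle_ineq norm_triangle_ineq4 add_mono_thms_linordered_semiring(3) order_trans)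
    with s t norm_sbi_diff_le'[OF s(1,2) t(1,2)] e show ?thesis by simp
  qed
  then have "norm (I - J) \<le> 0" by (rule field_le_epsilon)
  then show ?thesis by simp
qed

lemma strong_integral_eqI: "has_strong_integral M f I \<Longrightarrow> strong_integral M f = I"
  unfolding strong_integral_def by (rule the_equality, assumption, rule has_strong_integral_unique)

text \<open>
  The integrals of approximating simple functions form a Cauchy sequence, since the integral of
  simple functions is Lipschitz in the mean distance.
\<close>

lemma has_strong_integral_strong_integral:
  fixes f :: "'a \<Rightarrow> 'b::banach"
  assumes "strongly_integrable M f"
  shows "has_strong_integral M f (strong_integral M f)"
proof -
  define \<epsilon> where "\<epsilon> n = (1 / 2 :: real) ^ n" for n :: nat
  have \<epsilon>: "\<epsilon> n > 0" for n by (simp add: \<epsilon>_def)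
  have \<epsilon>0: "\<epsilon> \<longlonglongrightarrow> 0" unfolding \<epsilon>_def by (intro LIMSEQ_power_zero) simp
  have "\<forall>n. \<exists>s. simple_integrable M s \<and> L1_close M f s (\<epsilon> n)"
    using assms \<epsilon> unfolding strongly_integrable_def by simp
  from choice[OF this] obtain s where s: "\<And>n. simple_integrable M (s n)" "\<And>n. L1_close M f (s n) (\<epsilon> n)" by blast
  have bound: "norm (sbi M (s m) - sbi M (s n)) \<le> \<epsilon> m + \<epsilon> n" for m n
    using norm_sbi_diff_le'[OF s s] \<epsilon> by (simp add: less_imp_le)
  have "Cauchy (\<lambda>n. sbi M (s n))"
  proof (rule CauchyI)
    fix e :: real assume "e > 0"
    then obtain N where N: "\<And>n. n \<ge> N \<Longrightarrow> \<epsilon> n < e / 2"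
      using order_tendstoD(2)[OF \<epsilon>0, of "e / 2"] by (auto simp: eventually_sequentially)
    show "\<exists>M'. \<forall>m\<ge>M'. \<forall>n\<ge>M'. norm (sbi M (s m) - sbi M (s n)) < e"
      using bound N by (intro exI[of _ N]) (smt (verit, ccfv_SIG) field_sum_of_halves)
  qed
  then obtain I where I: "(\<lambda>n. sbi M (s n)) \<longlonglongrightarrow> I" using Cauchy_convergent convergentD by blast
  have "has_strong_integral M f I"
    unfolding has_strong_integral_def
  proof (intro allI impI)
    fix e :: real assume "e > 0"
    have "\<forall>\<^sub>F n in sequentially. \<epsilon> n < e \<and> dist (sbi M (s n)) I < e"
      using order_tendstoD(2)[OF \<epsilon>0 \<open>e > 0\<close>] tendstoD[OF I \<open>e > 0\<close>] by (rule eventually_conj)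
    then obtain n where n: "\<epsilon> n < e" "dist (sbi M (s n)) I < e"
      using eventually_happens by force
    have "L1_close M f (s n) (\<epsilon> n + (e - \<epsilon> n))"
      by (rule L1_close_trans[OF s(2) L1_close_refl]) (use n(1) \<epsilon>[of n] in auto)
    with n(2) s(1) show "\<exists>s. simple_integrable M s \<and> L1_close M f s e \<and> norm (sbi M s - I) \<le> e"
      by (auto simp: dist_norm intro!: exI[of _ "s n"])
  qed
  then show ?thesis using strong_integral_eqI by metis
qed

lemma has_strong_integral_imp_strongly_integrable: "has_strong_integral M f I \<Longrightarrow> strongly_integrable M f"
  unfolding has_strong_integral_def strongly_integrable_def by blast

lemma has_strong_integral_add:
  assumes "has_strong_integral M f I" "has_strong_integral M g J"
  shows "has_strong_integral M (\<lambda>x. f x + g x) (I + J)"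
  unfolding has_strong_integral_def
proof (intro allI impI)
  fix e :: real assume "e > 0"
  then have e: "e / 2 > 0" by simp
  obtain s where s: "simple_integrable M s" "L1_close M f s (e / 2)" "norm (sbi M s - I) \<le> e / 2"
    using assms(1) e unfolding has_strong_integral_def by blast
  obtain t where t: "simple_integrable M t" "L1_close M g t (e / 2)" "norm (sbi M t - J) \<le> e / 2"
    using assms(2) e unfolding has_strong_integral_def by blast
  have "L1_close M (\<lambda>x. f x + g x) (\<lambda>x. s x + t x) (e / 2 + e / 2)"
    by (rule L1_close_triangle[OF s(2) t(2)]) (use e norm_diff_triangle_ineq in auto)
  moreover have "simple_integrable M (\<lambda>x. s x + t x)"
    by (rule simple_bochner_integrable_compose2[OF _ s(1) t(1)]) simp
  moreover have "norm (sbi M (\<lambda>x. s x + t x) - (I + J)) \<le> norm (sbi M s - I) + norm (sbi M t - J)"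
    using s t by (simp add: simple_bochner_integral_add norm_diff_triangle_ineq)
  ultimately show "\<exists>s. simple_integrable M s \<and> L1_close M (\<lambda>x. f x + g x) s e \<and> norm (sbi M s - (I + J)) \<le> e"
    using s(3) t(3) by (intro exI[of _ "\<lambda>x. s x + t x"]) auto
qed

lemma has_strong_integral_linear:
  assumes "bounded_linear T" "has_strong_integral M f I"
  shows "has_strong_integral M (\<lambda>x. T (f x)) (T I)"
  unfolding has_strong_integral_def
proof (intro allI impI)
  fix e :: real assume "e > 0"
  interpret bounded_linear T by fact
  obtain B where B: "B > 0" "\<And>x. norm (T x) \<le> norm x * B" using pos_bounded by blast
  have e: "e / B > 0" using \<open>e > 0\<close> B by simp
  obtain s where s: "simple_integrable M s" "L1_close M f s (e / B)" "norm (sbi M s - I) \<le> e / B"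
    using assms(2) e unfolding has_strong_integral_def by blast
  have "L1_close M (\<lambda>x. T (f x)) (\<lambda>x. T (s x)) (B * (e / B))"
    by (rule L1_close_scale[OF s(2)]) (use e B in \<open>auto simp: mult.commute simp flip: diff\<close>)
  moreover have "simple_integrable M (\<lambda>x. T (s x))"
    by (rule simple_bochner_integrable_compose2[OF _ s(1) s(1), of "\<lambda>x y. T x"]) (simp add: zero)
  moreover have "norm (sbi M (\<lambda>x. T (s x)) - T I) \<le> e"
  proof -
    have "sbi M (\<lambda>x. T (s x)) - T I = T (sbi M s - I)"
      using simple_bochner_integral_linear[OF linear_axioms s(1)] by (simp add: diff)
    then have "norm (sbi M (\<lambda>x. T (s x)) - T I) \<le> norm (sbi M s - I) * B" using B(2) by simp
    also have "\<dots> \<le> e / B * B" using s(3) B(1) by (intro mult_right_mono) auto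
    finally show ?thesis using B(1) by simp
  qed
  ultimately show "\<exists>s. simple_integrable M s \<and> L1_close M (\<lambda>x. T (f x)) s e \<and> norm (sbi M s - T I) \<le> e"
    using B(1) by (intro exI[of _ "\<lambda>x. T (s x)"]) auto
qed

lemma norm_has_strong_integral_le:
  fixes f :: "'a \<Rightarrow> 'b::real_normed_vector"
  assumes I: "has_strong_integral M f I" and close: "L1_close M f (\<lambda>_. 0) c" and "c \<ge> 0"
  shows "norm I \<le> c"
proof (rule field_le_epsilon)
  fix e :: real assume "e > 0"
  then have e: "e / 2 > 0" by simp
  obtain s where s: "simple_integrable M s" "L1_close M f s (e / 2)" "norm (sbi M s - I) \<le> e / 2"
    using I e unfolding has_strong_integral_def by blast
  have zero: "simple_integrable M (\<lambda>_. 0)" by (simp add: simple_bochner_integrable.simps)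
  have "norm (sbi M s - sbi M (\<lambda>_. 0)) \<le> e / 2 + c"
    by (rule norm_sbi_diff_le'[OF s(1,2) zero close]) (use e assms in auto)
  moreover have "sbi M (\<lambda>_. 0 :: 'b) = 0"
    unfolding simple_bochner_integral_def by (intro sum.neutral) auto
  ultimately have "norm (sbi M s) \<le> e / 2 + c" by simp
  with s(3) show "norm I \<le> c + e" using norm_triangle_ineq4[of "sbi M s" "sbi M s - I"] by simp
qed

lemma strongly_integrable_add:
  fixes f :: "'a \<Rightarrow> 'b::banach"
  shows "strongly_integrable M f \<Longrightarrow> strongly_integrable M g \<Longrightarrow> strongly_integrable M (\<lambda>x. f x + g x)"
  by (rule has_strong_integral_imp_strongly_integrable[OF has_strong_integral_add])
    (rule has_strong_integral_strong_integral, assumption)+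

lemma strongly_integrable_linear:
  fixes f :: "'a \<Rightarrow> 'b::banach"
  shows "bounded_linear T \<Longrightarrow> strongly_integrable M f \<Longrightarrow> strongly_integrable M (\<lambda>x. T (f x))"
  by (rule has_strong_integral_imp_strongly_integrable[OF has_strong_integral_linear
      [OF _ has_strong_integral_strong_integral]])

lemma strongly_integrable_simple: "simple_integrable M s \<Longrightarrow> strongly_integrable M s"
  unfolding strongly_integrable_def using L1_close_refl by blast

lemma strongly_integrable_zero: "strongly_integrable M (\<lambda>x. 0)"
  by (rule strongly_integrable_simple) (simp add: simple_bochner_integrable.simps)

lemma strongly_integrable_sum:
  fixes f :: "'i \<Rightarrow> 'a \<Rightarrow> 'b::banach"
  assumes "finite A" "\<And>i. i \<in> A \<Longrightarrow> strongly_integrable M (f i)"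
  shows "strongly_integrable M (\<lambda>x. \<Sum>i\<in>A. f i x)"
  using assms by (induction A) (auto intro: strongly_integrable_zero strongly_integrable_add)

lemma strongly_integrable_closed:
  assumes "\<And>e. e > 0 \<Longrightarrow> \<exists>g. strongly_integrable M g \<and> L1_close M f g e"
  shows "strongly_integrable M f"
  unfolding strongly_integrable_def
proof (intro allI impI)
  fix e :: real assume "e > 0"
  then have e: "e / 2 > 0" by simp
  obtain g where g: "strongly_integrable M g" "L1_close M f g (e / 2)" using assms[OF e] by blast
  obtain s where s: "simple_integrable M s" "L1_close M g s (e / 2)"
    using g(1) e unfolding strongly_integrable_def by blast
  have "L1_close M f s (e / 2 + e / 2)" by (rule L1_close_trans[OF g(2) s(2)]) (use e in simp_all)
  with s(1) show "\<exists>s. simple_integrable M s \<and> L1_close M f s e" by auto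
qed

lemma strongly_integrable_indicator:
  assumes "strongly_integrable M f" and E: "E \<in> sets M"
  shows "strongly_integrable M (\<lambda>x. indicat_real E x *\<^sub>R f x)"
proof (rule strongly_integrable_closed)
  fix e :: real assume e: "e > 0"
  obtain s where s: "simple_integrable M s" and close: "L1_close M f s e"
    using assms(1) e unfolding strongly_integrable_def by blast
  have "simple_integrable M (\<lambda>x. indicat_real E x *\<^sub>R s x)"
  proof
    show "simple_function M (\<lambda>x. indicat_real E x *\<^sub>R s x)"
      using s E by (intro simple_function_compose2[where h="scaleR"]) (auto elim: simple_bochner_integrable.cases)
    have "simple_function M s" using s by (auto elim: simple_bochner_integrable.cases)
    then have [measurable]: "s \<in> measurable M (count_space UNIV)" by (rule measurable_simple_function)
    have "{y \<in> space M. s y \<noteq> 0} \<in> sets M" by measurable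
    then have "emeasure M {y \<in> space M. indicat_real E y *\<^sub>R s y \<noteq> 0} \<le> emeasure M {y \<in> space M. s y \<noteq> 0}"
      by (intro emeasure_mono) auto
    moreover have "emeasure M {y \<in> space M. s y \<noteq> 0} \<noteq> \<infinity>" using s by (auto elim: simple_bochner_integrable.cases)
    ultimately show "emeasure M {y \<in> space M. indicat_real E y *\<^sub>R s y \<noteq> 0} \<noteq> \<infinity>"
      by (auto simp: top_unique)
  qed
  then have "strongly_integrable M (\<lambda>x. indicat_real E x *\<^sub>R s x)" by (rule strongly_integrable_simple)
  moreover have "L1_close M (\<lambda>x. indicat_real E x *\<^sub>R f x) (\<lambda>x. indicat_real E x *\<^sub>R s x) (1 * e)"
    by (rule L1_close_scale[OF close]) (use e in \<open>auto simp: indicator_def\<close>)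
  ultimately show "\<exists>g. strongly_integrable M g \<and> L1_close M (\<lambda>x. indicat_real E x *\<^sub>R f x) g e"
    by auto
qed

text \<open>
  A function that switches between finitely many integrable functions along a measurable partition
  is a finite sum of restrictions. This replaces measurability of compositions.
\<close>

lemma strongly_integrable_select:
  fixes K :: "'c \<Rightarrow> 'a \<Rightarrow> 'b::banach"
  assumes s: "simple_function M s" and K: "\<And>v. strongly_integrable M (K v)"
  shows "strongly_integrable M (\<lambda>x. K (s x) x)"
proof -
  have [measurable]: "s \<in> measurable M (count_space UNIV)" using s by (rule measurable_simple_function)
  have fin: "finite (s ` space M)" using s by (simp add: simple_function_def)
  have "strongly_integrable M (\<lambda>x. \<Sum>v\<in>s ` space M. indicat_real {x\<in>space M. s x = v} x *\<^sub>R K v x)"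
    by (intro strongly_integrable_sum fin strongly_integrable_indicator K) measurable
  moreover have "(\<Sum>v\<in>s ` space M. indicat_real {x\<in>space M. s x = v} x *\<^sub>R K v x) = K (s x) x" if "x \<in> space M" for x
  proof -
    have "(\<Sum>v\<in>s ` space M. indicat_real {x\<in>space M. s x = v} x *\<^sub>R K v x)
      = (\<Sum>v\<in>s ` space M. if v = s x then K v x else 0)"
      using that by (intro sum.cong) (auto simp: indicator_def)
    then show ?thesis using that fin by simp
  qed
  ultimately show ?thesis unfolding strongly_integrable_def L1_close_def by (simp cong: ball_cong)
qed

text \<open>
  Replacing \<open>z\<close> by a simple function reduces the claim to a selection among the functions \<open>H t x\<close>
  with finitely many \<open>x\<close>. With \<open>x\<close> ranging over bounded operators it also gives integrability of
  operator-valued functions applied to vector-valued ones.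
\<close>

lemma strongly_integrable_Lipschitz_compose:
  fixes H :: "'a \<Rightarrow> 'b::real_normed_vector \<Rightarrow> 'c::banach"
  assumes z: "strongly_integrable M z" and H: "\<And>x. strongly_integrable M (\<lambda>t. H t x)"
    and lip: "\<And>t x y. t \<in> space M \<Longrightarrow> norm (H t x - H t y) \<le> L * norm (x - y)"
  shows "strongly_integrable M (\<lambda>t. H t (z t))"
proof (rule strongly_integrable_closed)
  fix e :: real assume e: "e > 0"
  define L' where "L' = max L 1"
  have L': "L' > 0" by (simp add: L'_def)
  then have e': "e / L' > 0" using e by simp
  obtain s where s: "simple_integrable M s" "L1_close M z s (e / L')"
    using z e' unfolding strongly_integrable_def by blast
  have "simple_function M s" using s by (auto elim: simple_bochner_integrable.cases)
  from strongly_integrable_select[OF this, of "\<lambda>v t. H t v", OF H]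
  have "strongly_integrable M (\<lambda>t. H t (s t))" .
  moreover have "L1_close M (\<lambda>t. H t (z t)) (\<lambda>t. H t (s t)) (L' * (e / L'))"
  proof (rule L1_close_scale[OF s(2)])
    show "norm (H t (z t) - H t (s t)) \<le> L' * norm (z t - s t)" if "t \<in> space M" for t
      by (rule order_trans[OF lip[OF that] mult_right_mono]) (auto simp: L'_def)
  qed (use e' L' in auto)
  ultimately show "\<exists>g. strongly_integrable M g \<and> L1_close M (\<lambda>t. H t (z t)) g e" using L' by auto
qed

text \<open>
  Rounding the scalar function \<open>v\<close> to multiples of a small number cuts \<open>E\<close> into finitely many sets
  on which \<open>f\<close> is nearly constant. With a nondecreasing \<open>v\<close> this covers functions of bounded
  variation.
\<close>

lemma strongly_integrable_dominated_increments:
  fixes f :: "'a \<Rightarrow> 'b::real_normed_vector" and v :: "'a \<Rightarrow> real"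
  assumes "finite_measure M" and E: "E \<in> sets M" and v: "v \<in> borel_measurable M"
    and bdd: "\<And>t. t \<in> E \<Longrightarrow> \<bar>v t\<bar> \<le> b"
    and f: "\<And>s t. s \<in> E \<Longrightarrow> t \<in> E \<Longrightarrow> norm (f s - f t) \<le> \<bar>v s - v t\<bar>"
  shows "strongly_integrable M (\<lambda>x. indicat_real E x *\<^sub>R f x)"
proof (rule strongly_integrable_closed)
  interpret finite_measure M by fact
  fix e :: real assume e: "e > 0"
  define d where "d = e / (measure M (space M) + 1)"
  have d: "d > 0" using e by (simp add: d_def add_nonneg_pos)
  define c where "c t = real_of_int \<lfloor>v t * indicat_real E t / d\<rfloor>" for t
  have cmeas: "c \<in> borel_measurable M" unfolding c_def using E v by measurable
  have "c ` space M \<subseteq> real_of_int ` {\<lfloor>- \<bar>b\<bar> / d\<rfloor>..\<lfloor>\<bar>b\<bar> / d\<rfloor>}"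
  proof (clarify)
    fix t
    have "\<bar>v t * indicat_real E t\<bar> \<le> \<bar>b\<bar>" using bdd[of t] by (auto simp: indicator_def)
    then have "- \<bar>b\<bar> / d \<le> v t * indicat_real E t / d" "v t * indicat_real E t / d \<le> \<bar>b\<bar> / d"
      using d by (intro divide_right_mono; linarith)+
    then show "c t \<in> real_of_int ` {\<lfloor>- \<bar>b\<bar> / d\<rfloor>..\<lfloor>\<bar>b\<bar> / d\<rfloor>}"
      by (auto simp: c_def intro!: imageI floor_mono)
  qed
  then have "finite (c ` space M)" by (rule finite_subset) simp
  with cmeas have sc: "simple_function M c" by (rule simple_function_borel_measurable)
  \<comment> \<open>A representative value of \<open>f\<close> on each level set of the rounded function.\<close>
  define g where "g y = f (SOME s. s \<in> E \<and> c s = y)" for y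
  let ?s = "\<lambda>t. indicat_real E t *\<^sub>R g (c t)"
  have "simple_function M ?s"
    using sc E by (intro simple_function_compose2[where h="scaleR"] simple_function_compose1[where g=g]) auto
  then have "simple_integrable M ?s"
    by (rule simple_bochner_integrable.intros) (simp add: emeasure_eq_measure)
  then have 1: "strongly_integrable M ?s" by (rule strongly_integrable_simple)
  have 2: "norm (indicat_real E t *\<^sub>R f t - ?s t) \<le> d" for t
  proof (cases "t \<in> E")
    case True
    define s where "s = (SOME s. s \<in> E \<and> c s = c t)"
    have "s \<in> E \<and> c s = c t" unfolding s_def by (rule someI[of _ t]) (simp add: True)
    then have s: "s \<in> E" "c s = c t" by auto
    then have "\<lfloor>v s / d\<rfloor> = \<lfloor>v t / d\<rfloor>" using True by (simp add: c_def)
    then have "\<bar>v t / d - v s / d\<bar> \<le> 1" by linarith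
    then have "\<bar>v t - v s\<bar> \<le> d" using d by (simp add: field_simps abs_le_iff)
    then have "norm (f t - f s) \<le> d" using f[OF True s(1)] by linarith
    then show ?thesis using True by (simp add: g_def s_def)
  qed (use d in simp)
  have "d * measure M (space M) \<le> d * (measure M (space M) + 1)" using d by (intro mult_left_mono) auto
  also have "\<dots> = e" using measure_nonneg[of M "space M"] by (simp add: d_def add_nonneg_eq_0_iff)
  finally have "L1_close M (\<lambda>x. indicat_real E x *\<^sub>R f x) ?s e"
    using d 2 by (intro L1_close_uniform[OF finite_measure_axioms]) auto
  with 1 show "\<exists>g. strongly_integrable M g \<and> L1_close M (\<lambda>x. indicat_real E x *\<^sub>R f x) g e" by blast
qed

lemma bochner_integral_is_restrict_space:
  assumes "bochner_integral_is (restrict_space M \<Omega>) f I" and \<Omega>: "\<Omega> \<inter> space M \<in> sets M"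
  shows "has_strong_integral M (\<lambda>x. indicat_real \<Omega> x *\<^sub>R f x) I"
  unfolding has_strong_integral_def
proof (intro allI impI)
  let ?N = "restrict_space M \<Omega>"
  fix e :: real assume e: "e > 0"
  from assms(1) obtain s where f: "f \<in> borel_measurable ?N"
    and s: "\<And>i. simple_integrable ?N (s i)"
    and lim: "(\<lambda>i. \<integral>\<^sup>+x. ennreal (norm (f x - s i x)) \<partial>?N) \<longlonglongrightarrow> 0" "(\<lambda>i. sbi ?N (s i)) \<longlonglongrightarrow> I"
    unfolding bochner_integral_is_def by blast
  have "\<forall>\<^sub>F i in sequentially. (\<integral>\<^sup>+x. ennreal (norm (f x - s i x)) \<partial>?N) < ennreal e \<and> dist (sbi ?N (s i)) I < e"
    using order_tendstoD(2)[OF lim(1), of "ennreal e"] tendstoD[OF lim(2) e] e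
    by (intro eventually_conj) auto
  then obtain i where i: "(\<integral>\<^sup>+x. ennreal (norm (f x - s i x)) \<partial>?N) < ennreal e" "dist (sbi ?N (s i)) I < e"
    using eventually_happens by force
  let ?s = "\<lambda>x. indicat_real \<Omega> x *\<^sub>R s i x"
  have si: "simple_function ?N (s i)" using s[of i] by (auto elim: simple_bochner_integrable.cases)
  \<comment> \<open>The simple function takes finitely many values, so the error is measurable without separability.\<close>
  have meas: "(\<lambda>x. ennreal (norm (f x - s i x))) \<in> borel_measurable ?N"
  proof -
    have [measurable]: "s i \<in> measurable ?N (count_space UNIV)" using si by (rule measurable_simple_function)
    have fin: "finite (s i ` space ?N)" using si by (simp add: simple_function_def)
    have nm: "(\<lambda>x. norm (f x - v)) \<in> borel_measurable ?N" for v
      using measurable_compose[OF f, of "\<lambda>x. norm (x - v)" borel]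
      by (simp add: borel_measurable_continuous_onI continuous_intros)
    have "(\<lambda>x. \<Sum>v\<in>s i ` space ?N. indicat_real {x\<in>space ?N. s i x = v} x * norm (f x - v)) \<in> borel_measurable ?N"
      using nm by measurable
    moreover have "(\<Sum>v\<in>s i ` space ?N. indicat_real {x\<in>space ?N. s i x = v} x * norm (f x - v)) = norm (f x - s i x)"
      if "x \<in> space ?N" for x
    proof -
      have "(\<Sum>v\<in>s i ` space ?N. indicat_real {x\<in>space ?N. s i x = v} x * norm (f x - v))
        = (\<Sum>v\<in>s i ` space ?N. if v = s i x then norm (f x - v) else 0)"
        using that by (intro sum.cong) (auto simp: indicator_def)
      then show ?thesis using that fin by simp
    qed
    ultimately have "(\<lambda>x. norm (f x - s i x)) \<in> borel_measurable ?N"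
      by (simp cong: measurable_cong)
    then show ?thesis by simp
  qed
  define r where "r x = ennreal (norm (f x - s i x)) * indicator \<Omega> x" for x
  have "simple_integrable M ?s"
    using s[of i] \<Omega> simple_bochner_integrable_restrict_space[of \<Omega> M "s i"] by blast
  moreover have "L1_close M (\<lambda>x. indicat_real \<Omega> x *\<^sub>R f x) ?s e"
  proof (rule L1_closeI)
    show "r \<in> borel_measurable M"
      using meas \<Omega> unfolding r_def by (subst (asm) borel_measurable_restrict_space_iff_ennreal) auto
    show "ennreal (norm (indicat_real \<Omega> x *\<^sub>R f x - indicat_real \<Omega> x *\<^sub>R s i x)) \<le> r x" for x
      by (auto simp: r_def indicator_def)
    have "(\<integral>\<^sup>+x. r x \<partial>M) = (\<integral>\<^sup>+x. ennreal (norm (f x - s i x)) \<partial>?N)"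
      unfolding r_def using \<Omega> by (subst nn_integral_restrict_space) auto
    with i(1) show "(\<integral>\<^sup>+x. r x \<partial>M) \<le> ennreal e" by simp
  qed
  moreover have "sbi M ?s = sbi ?N (s i)"
    by (rule simple_bochner_integral_restrict_space[OF \<Omega> s[of i], symmetric])
  ultimately show "\<exists>s. simple_integrable M s \<and> L1_close M (\<lambda>x. indicat_real \<Omega> x *\<^sub>R f x) s e \<and> norm (sbi M s - I) \<le> e"
    using i(2) by (intro exI[of _ ?s]) (simp add: dist_norm)
qed

section \<open>Right limits and nondecreasing functions\<close>

definition right_lim :: "(real \<Rightarrow> 'b::t2_space) \<Rightarrow> real \<Rightarrow> 'b" where
  "right_lim f t = Lim (at_right t) f"

lemma right_limI: "(f \<longlongrightarrow> l) (at_right t) \<Longrightarrow> right_lim f t = l"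
  unfolding right_lim_def by (rule tendsto_Lim) simp_all

lemma mono_tendsto_right_lim:
  fixes h :: "real \<Rightarrow> real"
  assumes "mono h"
  shows "(h \<longlongrightarrow> right_lim h t) (at_right t)"
proof -
  let ?I = "Inf (h ` {t<..})"
  have bdd: "bdd_below (h ` {t<..})"
    using assms by (intro bdd_belowI[of _ "h t"]) (auto simp: mono_def)
  have "(h \<longlongrightarrow> ?I) (at_right t)"
  proof (rule order_tendstoI)
    fix l assume "l < ?I"
    have "l < h r" if "r > t" for r
      using \<open>l < ?I\<close> cInf_lower[OF _ bdd, of "h r"] that by auto
    then show "\<forall>\<^sub>F r in at_right t. l < h r"
      by (auto simp: eventually_at_right_field intro!: exI[of _ "t + 1"])
  next
    fix l assume "?I < l"
    then obtain r0 where r0: "r0 > t" "h r0 < l"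
      using cInf_lessD[of "h ` {t<..}" l] by auto
    have "h r < l" if "r > t" "r < r0" for r
      using assms that r0 by (meson le_less_trans less_imp_le monoD)
    then show "\<forall>\<^sub>F r in at_right t. h r < l"
      using r0 by (auto simp: eventually_at_right_field)
  qed
  then show ?thesis using right_limI by metis
qed

lemma mono_right_lim:
  fixes h :: "real \<Rightarrow> real"
  assumes "mono h"
  shows "h t \<le> right_lim h t" and "t < r \<Longrightarrow> right_lim h t \<le> h r"
    and "s \<le> t \<Longrightarrow> right_lim h s \<le> right_lim h t"
proof -
  show 1: "h t \<le> right_lim h t" for t
    by (rule tendsto_lowerbound[OF mono_tendsto_right_lim[OF assms]])
      (use assms in \<open>auto simp: eventually_at_right_field mono_def intro!: exI[of _ "t + 1"]\<close>)
  show 2: "right_lim h t \<le> h r" if "t < r" for t r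
    by (rule tendsto_upperbound[OF mono_tendsto_right_lim[OF assms]])
      (use assms that in \<open>auto simp: eventually_at_right_field mono_def intro!: exI[of _ r]\<close>)
  show "right_lim h s \<le> right_lim h t" if "s \<le> t"
    using 1[of t] 2[of s t] that by (cases "s = t") auto
qed

text \<open>
  The local input of all bisection arguments: to the left of a point, and to the right of it up to
  the jump at the point itself, the function varies little.
\<close>

lemma mono_left_continuous_small_oscillation:
  fixes h :: "real \<Rightarrow> real"
  assumes "mono h" "(h \<longlongrightarrow> h x) (at_left x)" "e > 0"
  obtains \<delta> where "\<delta> > 0" "\<And>r. x - \<delta> < r \<Longrightarrow> r \<le> x \<Longrightarrow> h x - h r \<le> e"
    "\<And>r. r < x + \<delta> \<Longrightarrow> x < r \<Longrightarrow> h r - right_lim h x \<le> e"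
proof -
  have "\<forall>\<^sub>F r in at_left x. h x - e < h r"
    using order_tendstoD(1)[OF assms(2), of "h x - e"] assms(3) by simp
  then obtain l where l: "l < x" "\<And>r. l < r \<Longrightarrow> r < x \<Longrightarrow> h x - e < h r"
    by (auto simp: eventually_at_left_field)
  have "\<forall>\<^sub>F r in at_right x. h r < right_lim h x + e"
    using order_tendstoD(2)[OF mono_tendsto_right_lim[OF assms(1)], of x "right_lim h x + e"] assms(3) by simp
  then obtain m where m: "m > x" "\<And>r. x < r \<Longrightarrow> r < m \<Longrightarrow> h r < right_lim h x + e"
    by (auto simp: eventually_at_right_field)
  show thesis
  proof
    show "min (x - l) (m - x) > 0" using l m by simp
    show "h x - h r \<le> e" if "x - min (x - l) (m - x) < r" "r \<le> x" for r
      using l(2)[of r] that assms(3) by (cases "r = x") (auto simp: min_def split: if_splits)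
    show "h r - right_lim h x \<le> e" if "r < x + min (x - l) (m - x)" "x < r" for r
      using m(2)[of r] that by (auto simp: min_def split: if_splits)
  qed
qed

lemma tendsto_at_right_if_small_oscillation:
  fixes f :: "real \<Rightarrow> 'b::banach"
  assumes "\<And>e. e > 0 \<Longrightarrow> \<exists>b>t. \<forall>r s. t < r \<longrightarrow> r \<le> s \<longrightarrow> s < b \<longrightarrow> norm (f s - f r) < e"
  shows "(f \<longlongrightarrow> right_lim f t) (at_right t)"
proof -
  define x where "x n = t + 1 / real (Suc n)" for n
  have xt: "x n > t" for n by (simp add: x_def)
  have xlim: "x \<longlonglongrightarrow> t"
    using tendsto_add[OF tendsto_const[of t] LIMSEQ_inverse_real_of_nat] unfolding x_def by (simp add: inverse_eq_divide)
  have osc: "\<exists>b>t. \<forall>r s. t < r \<longrightarrow> r < b \<longrightarrow> t < s \<longrightarrow> s < b \<longrightarrow> norm (f s - f r) < e" if e: "e > 0" for e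
  proof -
    obtain b where b: "b > t" "\<And>r s. t < r \<Longrightarrow> r \<le> s \<Longrightarrow> s < b \<Longrightarrow> norm (f s - f r) < e"
      using assms[OF e] by blast
    have "norm (f s - f r) < e" if "t < r" "r < b" "t < s" "s < b" for r s
      using b(2)[of r s] b(2)[of s r] that by (cases "r \<le> s") (auto simp: norm_minus_commute)
    with b(1) show ?thesis by blast
  qed
  have "Cauchy (\<lambda>n. f (x n))"
  proof (rule CauchyI)
    fix e :: real assume "e > 0"
    then obtain b where b: "b > t" "\<And>r s. t < r \<Longrightarrow> r < b \<Longrightarrow> t < s \<Longrightarrow> s < b \<Longrightarrow> norm (f s - f r) < e"
      using osc by blast
    obtain N where "\<And>n. n \<ge> N \<Longrightarrow> x n < b"
      using order_tendstoD(2)[OF xlim b(1)] by (auto simp: eventually_sequentially)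
    then show "\<exists>M. \<forall>m\<ge>M. \<forall>n\<ge>M. norm (f (x m) - f (x n)) < e" using b(2) xt by blast
  qed
  then obtain l where l: "(\<lambda>n. f (x n)) \<longlonglongrightarrow> l" using Cauchy_convergent convergentD by blast
  have "(f \<longlongrightarrow> l) (at_right t)"
  proof (rule tendstoI)
    fix e :: real assume "e > 0"
    then have e: "e / 2 > 0" by simp
    obtain b where b: "b > t" "\<And>r s. t < r \<Longrightarrow> r < b \<Longrightarrow> t < s \<Longrightarrow> s < b \<Longrightarrow> norm (f s - f r) < e / 2"
      using osc[OF e] by blast
    have "\<forall>\<^sub>F n in sequentially. x n < b \<and> dist (f (x n)) l < e / 2"
      using order_tendstoD(2)[OF xlim b(1)] tendstoD[OF l e] by (rule eventually_conj)
    then obtain n where n: "x n < b" "dist (f (x n)) l < e / 2" using eventually_happens by force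
    have "dist (f r) l < e" if "t < r" "r < b" for r
    proof -
      have "dist (f r) l \<le> dist (f r) (f (x n)) + dist (f (x n)) l" by (rule dist_triangle)
      moreover have "dist (f r) (f (x n)) < e / 2" using b(2)[of "x n" r] that n(1) xt[of n] by (simp add: dist_norm)
      ultimately show ?thesis using n(2) by simp
    qed
    with b(1) show "\<forall>\<^sub>F r in at_right t. dist (f r) l < e" by (auto simp: eventually_at_right_field)
  qed
  then show ?thesis using right_limI by metis
qed

text \<open>
  The substitute for Gronwall estimates on short intervals: an a priori finite supremum that
  satisfies \<open>B \<le> B / 2 + g\<close> is at most \<open>2 * g\<close>.
\<close>

lemma norm_le_twice_if_halving:
  fixes f :: "'a \<Rightarrow> 'b::real_normed_vector"
  assumes bdd: "\<And>r. r \<in> S \<Longrightarrow> norm (f r) \<le> B0"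
    and half: "\<And>B r. B \<ge> 0 \<Longrightarrow> (\<And>s. s \<in> S \<Longrightarrow> norm (f s) \<le> B) \<Longrightarrow> r \<in> S \<Longrightarrow> norm (f r) \<le> B / 2 + g"
    and r: "r \<in> S"
  shows "norm (f r) \<le> 2 * g"
proof -
  let ?B = "SUP s\<in>S. norm (f s)"
  have bd: "bdd_above ((\<lambda>s. norm (f s)) ` S)" using bdd by (intro bdd_aboveI2[of S _ B0])
  have le: "norm (f s) \<le> ?B" if "s \<in> S" for s using that bd by (rule cSUP_upper)
  have "?B \<ge> 0" using le[OF r] norm_ge_zero order_trans by blast
  then have "?B \<le> ?B / 2 + g"
    using half[of ?B] le r by (intro cSUP_least) auto
  then show ?thesis using le[OF r] by simp
qed

lemma bounded_if_locally_bounded: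
  fixes z :: "real \<Rightarrow> 'b::real_normed_vector"
  assumes "a \<le> b" and "\<And>x. \<exists>d>0. \<exists>B. \<forall>r. \<bar>r - x\<bar> < d \<longrightarrow> norm (z r) \<le> B"
  obtains B where "\<And>r. r \<in> {a..b} \<Longrightarrow> norm (z r) \<le> B"
proof -
  have "\<exists>B. \<forall>r\<in>{a..b}. norm (z r) \<le> B"
    using \<open>a \<le> b\<close>
  proof (induction rule: Bolzano)
    case (trans a b c)
    then obtain B1 B2 where "\<forall>r\<in>{a..b}. norm (z r) \<le> B1" "\<forall>r\<in>{b..c}. norm (z r) \<le> B2" by blast
    then have "\<forall>r\<in>{a..c}. norm (z r) \<le> max B1 B2"
      by (metis atLeastAtMost_iff le_max_iff_disj linear)
    then show ?case by blast
  next
    case (local x)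
    obtain d B where d: "d > 0" "\<And>r. \<bar>r - x\<bar> < d \<Longrightarrow> norm (z r) \<le> B" using assms(2)[of x] by blast
    have "\<forall>r\<in>{a..b}. norm (z r) \<le> B" if "a \<le> x" "x \<le> b" "b - a < d" for a b
      using d(2) that by force
    with d(1) show ?case by blast
  qed
  then show thesis using that by blast
qed

section \<open>Linear measure differential equations\<close>

text \<open>
  The linear equation as seen by the proof: \<open>FA\<close> and \<open>FC\<close> are primitives of the coefficients, and
  \<open>hA\<close>, \<open>hC\<close> control their increments. By the jump relation the operator inverted in \<open>jump_inverse\<close>
  is the one that the solution undergoes at a discontinuity.
\<close>

locale linear_mde =
  fixes A C :: "real \<Rightarrow> 'z::banach \<Rightarrow>\<^sub>L 'z" and u hA hC :: "real \<Rightarrow> real" and FA FC :: "real \<Rightarrow> 'z \<Rightarrow>\<^sub>L 'z"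
  assumes FA: "ps_primitive A (\<lambda>x. x) FA" and FC: "ps_primitive C u FC"
    and mono_u: "mono u" and left_u: "\<And>t. (u \<longlongrightarrow> u t) (at_left t)"
    and FA_le: "\<And>c d. c \<le> d \<Longrightarrow> norm (FA d - FA c) \<le> hA d - hA c"
    and FC_le: "\<And>c d. c \<le> d \<Longrightarrow> norm (FC d - FC c) \<le> hC d - hC c"
    and left_hA: "\<And>t. (hA \<longlongrightarrow> hA t) (at_left t)" and left_hC: "\<And>t. (hC \<longlongrightarrow> hC t) (at_left t)"
    and jump_inverse: "\<And>t. \<not> isCont u t \<Longrightarrow>
      \<exists>V. V o\<^sub>L (id_blinfun + (right_lim u t - u t) *\<^sub>R C t) = id_blinfun"
begin

definition h :: "real \<Rightarrow> real" where "h t = hA t + hC t"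

lemma mono_h: "mono h"
proof (rule monoI)
  fix x y :: real assume "x \<le> y"
  then show "h x \<le> h y"
    using order_trans[OF norm_ge_zero FA_le[of x y]] order_trans[OF norm_ge_zero FC_le[of x y]] by (simp add: h_def)
qed

lemma left_h: "(h \<longlongrightarrow> h t) (at_left t)"
  unfolding h_def by (intro tendsto_add left_hA left_hC)

text \<open>
  Solutions of the linear equation with an additional forcing \<open>dG\<close>, which is dominated by \<open>du\<close>. For
  the nonlinear equation \<open>G\<close> is the integral of \<open>H s (z s)\<close>. The integral terms occur through
  primitives, so that the equation holds for both orders of the end points.
\<close>

definition forced_solution :: "(real \<Rightarrow> 'z) \<Rightarrow> (real \<Rightarrow> 'z) \<Rightarrow> bool" where
  "forced_solution G z \<longleftrightarrow> (\<exists>M. \<forall>c d. c \<le> d \<longrightarrow> norm (G d - G c) \<le> M * (u d - u c)) \<and>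
    (\<exists>W1 W2. ps_primitive (\<lambda>s. A s (z s)) (\<lambda>x. x) W1 \<and> ps_primitive (\<lambda>s. C s (z s)) u W2 \<and>
       (\<forall>s t. z t - z s = (W1 t - W1 s) + (W2 t - W2 s) + (G t - G s)))"

abbreviation "linear_solution \<equiv> forced_solution (\<lambda>_. 0)"

lemma forced_solution_diff:
  assumes "forced_solution G z" "linear_solution w"
  shows "forced_solution G (\<lambda>t. z t - w t)"
proof -
  obtain M W1 W2 where M: "\<And>c d. c \<le> d \<Longrightarrow> norm (G d - G c) \<le> M * (u d - u c)"
    and W: "ps_primitive (\<lambda>s. A s (z s)) (\<lambda>x. x) W1" "ps_primitive (\<lambda>s. C s (z s)) u W2"
      "\<And>s t. z t - z s = (W1 t - W1 s) + (W2 t - W2 s) + (G t - G s)"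
    using assms(1) unfolding forced_solution_def by blast
  obtain V1 V2 where V: "ps_primitive (\<lambda>s. A s (w s)) (\<lambda>x. x) V1" "ps_primitive (\<lambda>s. C s (w s)) u V2"
      "\<And>s t. w t - w s = (V1 t - V1 s) + (V2 t - V2 s) + (0 - 0)"
    using assms(2) unfolding forced_solution_def by blast
  show ?thesis
    unfolding forced_solution_def
  proof (rule conjI, goal_cases)
    case 2
    show ?case
    proof (rule exI[of _ "\<lambda>t. W1 t - V1 t"], rule exI[of _ "\<lambda>t. W2 t - V2 t"], intro conjI allI)
      show "ps_primitive (\<lambda>s. A s (z s - w s)) (\<lambda>x. x) (\<lambda>t. W1 t - V1 t)"
        using ps_primitive_diff[OF W(1) V(1)] by (simp add: blinfun.diff_right)
      show "ps_primitive (\<lambda>s. C s (z s - w s)) u (\<lambda>t. W2 t - V2 t)"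
        using ps_primitive_diff[OF W(2) V(2)] by (simp add: blinfun.diff_right)
      fix s t
      have "z t - w t - (z s - w s) = (z t - z s) - (w t - w s)" by simp
      also have "\<dots> = W1 t - V1 t - (W1 s - V1 s) + (W2 t - V2 t - (W2 s - V2 s)) + (G t - G s)"
        unfolding W(3)[of t s] V(3)[of t s] by simp
      finally show "z t - w t - (z s - w s) = W1 t - V1 t - (W1 s - V1 s) + (W2 t - V2 t - (W2 s - V2 s)) + (G t - G s)" .
    qed
  qed (intro exI[of _ M] allI impI M)
qed

text \<open>
  The first-order expansion of a solution at a point. It yields left-continuity, the jump relation,
  and local boundedness.
\<close>

lemma forced_solution_expand:
  assumes "forced_solution G z"
  shows "((\<lambda>r. z r - z x - (r - x) *\<^sub>R A x (z x) - (u r - u x) *\<^sub>R C x (z x) - (G r - G x)) \<longlongrightarrow> 0) (at x)"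
proof -
  obtain W1 W2 where W: "ps_primitive (\<lambda>s. A s (z s)) (\<lambda>x. x) W1" "ps_primitive (\<lambda>s. C s (z s)) u W2"
      "\<And>s t. z t - z s = (W1 t - W1 s) + (W2 t - W2 s) + (G t - G s)"
    using assms unfolding forced_solution_def by blast
  from tendsto_add[OF ps_primitive_jump[OF W(1), of x] ps_primitive_jump[OF W(2), of x]]
  show ?thesis unfolding W(3) by (simp add: algebra_simps)
qed

lemma forced_solution_left_continuous:
  assumes "forced_solution G z"
  shows "(z \<longlongrightarrow> z x) (at_left x)"
proof -
  obtain M where M: "\<And>c d. c \<le> d \<Longrightarrow> norm (G d - G c) \<le> M * (u d - u c)"
    using assms unfolding forced_solution_def by blast
  have G: "((\<lambda>r. G r - G x) \<longlongrightarrow> 0) (at_left x)"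
  proof (rule Lim_null_comparison)
    show "\<forall>\<^sub>F r in at_left x. norm (G r - G x) \<le> M * (u x - u r)"
      using M by (auto simp: eventually_at_left_field norm_minus_commute intro!: exI[of _ "x - 1"])
    show "((\<lambda>r. M * (u x - u r)) \<longlongrightarrow> 0) (at_left x)"
      using tendsto_mult[OF tendsto_const[of M] tendsto_diff[OF tendsto_const[of "u x"] left_u[of x]]] by simp
  qed
  have A: "((\<lambda>r. (r - x) *\<^sub>R A x (z x)) \<longlongrightarrow> (x - x) *\<^sub>R A x (z x)) (at_left x)" by (intro tendsto_intros)
  have C: "((\<lambda>r. (u r - u x) *\<^sub>R C x (z x)) \<longlongrightarrow> (u x - u x) *\<^sub>R C x (z x)) (at_left x)" by (intro tendsto_intros left_u)
  have E: "((\<lambda>r. z r - z x - (r - x) *\<^sub>R A x (z x) - (u r - u x) *\<^sub>R C x (z x) - (G r - G x)) \<longlongrightarrow> 0) (at_left x)"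
    using forced_solution_expand[OF assms] by (rule filterlim_mono) (auto simp: at_le)
  from tendsto_add[OF tendsto_add[OF tendsto_add[OF tendsto_add[OF E G] A] C] tendsto_const[of "z x"]]
  show ?thesis by simp
qed

lemma linear_solution_right_lim:
  assumes "linear_solution z"
  shows "(z \<longlongrightarrow> (id_blinfun + (right_lim u x - u x) *\<^sub>R C x) (z x)) (at_right x)"
proof -
  have A: "((\<lambda>r. (r - x) *\<^sub>R A x (z x)) \<longlongrightarrow> (x - x) *\<^sub>R A x (z x)) (at_right x)" by (intro tendsto_intros)
  have C: "((\<lambda>r. (u r - u x) *\<^sub>R C x (z x)) \<longlongrightarrow> (right_lim u x - u x) *\<^sub>R C x (z x)) (at_right x)"
    by (intro tendsto_intros mono_tendsto_right_lim mono_u)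
  have E: "((\<lambda>r. z r - z x - (r - x) *\<^sub>R A x (z x) - (u r - u x) *\<^sub>R C x (z x) - (0 - 0)) \<longlongrightarrow> 0) (at_right x)"
    using forced_solution_expand[OF assms] by (rule filterlim_mono) (auto simp: at_le)
  from tendsto_add[OF tendsto_add[OF tendsto_add[OF E A] C] tendsto_const[of "z x"]]
  show ?thesis by (simp add: blinfun.bilinear_simps add.commute)
qed

lemma forced_solution_bounded:
  assumes "forced_solution G z" "a \<le> b"
  obtains B where "\<And>r. r \<in> {a..b} \<Longrightarrow> norm (z r) \<le> B"
proof (rule bounded_if_locally_bounded[OF assms(2), of z])
  fix x
  obtain M where M: "\<And>c d. c \<le> d \<Longrightarrow> norm (G d - G c) \<le> M * (u d - u c)"
    using assms unfolding forced_solution_def by blast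
  let ?E = "\<lambda>r. z r - z x - (r - x) *\<^sub>R A x (z x) - (u r - u x) *\<^sub>R C x (z x) - (G r - G x)"
  obtain d where d: "d > 0" "\<And>r. r \<noteq> x \<Longrightarrow> dist r x < d \<Longrightarrow> dist (?E r) 0 < 1"
    using tendstoD[OF forced_solution_expand[OF assms(1), of x], of 1] by (auto simp: eventually_at)
  let ?v = "u (x + 1) - u (x - 1)"
  let ?B = "norm (z x) + 1 + norm (A x (z x)) + ?v * norm (C x (z x)) + \<bar>M\<bar> * ?v"
  have "norm (z r) \<le> ?B" if r: "\<bar>r - x\<bar> < min d 1" for r
  proof (cases "r = x")
    case True
    have "?v \<ge> 0" using mono_u by (simp add: mono_def)
    then show ?thesis using True by (simp add: add_increasing2)
  next
    case False
    have "u (x - 1) \<le> u r" "u r \<le> u (x + 1)" "u (x - 1) \<le> u x" "u x \<le> u (x + 1)"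
      using r by (auto intro!: monoD[OF mono_u])
    then have uv: "\<bar>u r - u x\<bar> \<le> ?v" by linarith
    have "norm (G r - G x) \<le> M * \<bar>u r - u x\<bar>"
    proof (cases "r \<le> x")
      case True
      then show ?thesis using M[OF True] monoD[OF mono_u True] by (simp add: norm_minus_commute)
    next
      case False
      then show ?thesis using M[of x r] monoD[OF mono_u, of x r] by simp
    qed
    also have "\<dots> \<le> \<bar>M\<bar> * ?v" using uv by (intro mult_mono) auto
    finally have G: "norm (G r - G x) \<le> \<bar>M\<bar> * ?v" .
    have 1: "norm (?E r) \<le> 1" using d(2)[OF False] r by (simp add: dist_real_def less_imp_le)
    have 2: "norm ((r - x) *\<^sub>R A x (z x)) \<le> 1 * norm (A x (z x))"
      unfolding norm_scaleR using r by (intro mult_right_mono) auto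
    have 3: "norm ((u r - u x) *\<^sub>R C x (z x)) \<le> ?v * norm (C x (z x))"
      unfolding norm_scaleR using uv by (intro mult_right_mono) auto
    have "z r = z x + ?E r + (r - x) *\<^sub>R A x (z x) + (u r - u x) *\<^sub>R C x (z x) + (G r - G x)" by simp
    then have "norm (z r) \<le> norm (z x) + norm (?E r) + norm ((r - x) *\<^sub>R A x (z x))
      + norm ((u r - u x) *\<^sub>R C x (z x)) + norm (G r - G x)"
      by (smt (verit) norm_triangle_ineq)
    with 1 2 3 G show ?thesis by simp
  qed
  then show "\<exists>d>0. \<exists>B. \<forall>r. \<bar>r - x\<bar> < d \<longrightarrow> norm (z r) \<le> B"
    using d(1) by (intro exI[of _ "min d 1"] conjI exI[of _ ?B]) auto
qed (use that in blast)

text \<open>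
  Left-continuity makes the values at rational times dense in the range of the solution, which is
  the separability that \<open>norm_ps_primitive_apply_le\<close> requires.
\<close>

lemma forced_solution_increment_le:
  assumes z: "forced_solution G z" and "a \<le> b" and B: "\<And>t. t \<in> {a..b} \<Longrightarrow> norm (z t) \<le> B"
  shows "norm (z b - z a - (G b - G a)) \<le> B * (h b - h a)"
proof -
  obtain W1 W2 where W: "ps_primitive (\<lambda>s. A s (z s)) (\<lambda>x. x) W1" "ps_primitive (\<lambda>s. C s (z s)) u W2"
      "\<And>s t. z t - z s = (W1 t - W1 s) + (W2 t - W2 s) + (G t - G s)"
    using z unfolding forced_solution_def by blast
  define xs where "xs j = z (from_nat_into \<rat> j)" for j :: nat
  have dense: "\<exists>j. norm (z t - xs j) < e" if e: "e > 0" for t e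
  proof -
    obtain l where l: "l < t" "\<And>r. l < r \<Longrightarrow> r < t \<Longrightarrow> dist (z r) (z t) < e"
      using tendstoD[OF forced_solution_left_continuous[OF z, of t] e] by (auto simp: eventually_at_left_field)
    obtain q where q: "q \<in> \<rat>" "l < q" "q < t" using Rats_dense_in_real[OF l(1)] by blast
    have "q \<in> range (from_nat_into \<rat>)"
      using q(1) by (subst range_from_nat_into) (auto simp: countable_rat)
    then obtain j where "q = from_nat_into \<rat> j" by auto
    then show ?thesis using l(2)[OF q(2,3)] by (auto simp: xs_def dist_norm norm_minus_commute)
  qed
  have "norm (W1 b - W1 a) \<le> B * (hA b - hA a)"
    using FA W(1) _ FA_le dense B \<open>a \<le> b\<close> by (rule norm_ps_primitive_apply_le) (auto simp: mono_def)
  moreover have "norm (W2 b - W2 a) \<le> B * (hC b - hC a)"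
    using FC W(2) mono_u FC_le dense B \<open>a \<le> b\<close> by (rule norm_ps_primitive_apply_le)
  ultimately have "norm ((W1 b - W1 a) + (W2 b - W2 a)) \<le> B * (hA b - hA a) + B * (hC b - hC a)"
    by (rule order_trans[OF norm_triangle_ineq add_mono])
  moreover have "z b - z a - (G b - G a) = (W1 b - W1 a) + (W2 b - W2 a)" by (simp add: W(3)[of b a])
  ultimately have "norm (z b - z a - (G b - G a)) \<le> B * (hA b - hA a) + B * (hC b - hC a)" by simp
  then show ?thesis by (simp add: h_def algebra_simps)
qed

text \<open>
  A solution that vanishes at \<open>a\<close> does not feel the jump of the coefficients at \<open>a\<close>, so only the
  variation of \<open>h\<close> after that jump counts. Intervals on which \<open>h\<close> varies little after the initial
  jump cover every compact interval, whereas a large jump of \<open>h\<close> could not be removed by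
  subdivision.
\<close>

lemma forced_solution_from_zero_le:
  assumes z: "forced_solution G z" and "a < b" "z a = 0" and B: "\<And>t. t \<in> {a<..b} \<Longrightarrow> norm (z t) \<le> B"
  shows "norm (z b - (G b - G a)) \<le> B * (h b - right_lim h a)"
proof -
  have E: "((\<lambda>r. z r - z a - (r - a) *\<^sub>R A a (z a) - (u r - u a) *\<^sub>R C a (z a) - (G r - G a)) \<longlongrightarrow> 0) (at_right a)"
    using forced_solution_expand[OF z] by (rule filterlim_mono) (auto simp: at_le)
  then have "((\<lambda>r. z r - (G r - G a)) \<longlongrightarrow> 0) (at_right a)" using \<open>z a = 0\<close> by (simp add: blinfun.zero_right)
  then have "((\<lambda>r. norm (z b - (G b - G a) - (z r - (G r - G a)))) \<longlongrightarrow> norm (z b - (G b - G a) - 0)) (at_right a)"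
    by (intro tendsto_intros)
  moreover have "((\<lambda>r. B * (h b - h r)) \<longlongrightarrow> B * (h b - right_lim h a)) (at_right a)"
    by (intro tendsto_intros mono_tendsto_right_lim mono_h)
  moreover have "norm (z b - (G b - G a) - (z r - (G r - G a))) \<le> B * (h b - h r)" if "a < r" "r < b" for r
  proof -
    have "norm (z b - z r - (G b - G r)) \<le> B * (h b - h r)"
      using that B by (intro forced_solution_increment_le[OF z]) auto
    moreover have "z b - z r - (G b - G r) = z b - (G b - G a) - (z r - (G r - G a))" by simp
    ultimately show ?thesis by simp
  qed
  then have "\<forall>\<^sub>F r in at_right a. norm (z b - (G b - G a) - (z r - (G r - G a))) \<le> B * (h b - h r)"
    using \<open>a < b\<close> by (auto simp: eventually_at_right_field)
  ultimately have "norm (z b - (G b - G a) - 0) \<le> B * (h b - right_lim h a)"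
    by (intro tendsto_le[of "at_right a"]) auto
  then show ?thesis by simp
qed

lemma forced_solution_growth:
  assumes z: "forced_solution G z" and "z a = 0" and small: "h b - right_lim h a \<le> 1 / 2"
    and g: "\<And>r. r \<in> {a<..b} \<Longrightarrow> norm (G r - G a) \<le> g" and r: "a < r" "r \<le> b"
  shows "norm (z r) \<le> 2 * g" and "norm (z r - (G r - G a)) \<le> 2 * g * (h r - right_lim h a)"
proof -
  obtain B0 where B0: "\<And>r. r \<in> {a..b} \<Longrightarrow> norm (z r) \<le> B0"
    using forced_solution_bounded[OF z, of a b] r by auto
  have hr: "h s - right_lim h a \<le> 1 / 2" if "s \<le> b" for s
    using monoD[OF mono_h that] small by simp
  have bound: "norm (z s) \<le> 2 * g" if "s \<in> {a<..b}" for s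
  proof (rule norm_le_twice_if_halving[of "{a<..b}" z B0, OF _ _ that])
    show "norm (z s) \<le> B0" if "s \<in> {a<..b}" for s using B0 that by simp
    fix B s assume B: "B \<ge> 0" "\<And>s. s \<in> {a<..b} \<Longrightarrow> norm (z s) \<le> B" and s: "s \<in> {a<..b}"
    have "norm (z s - (G s - G a)) \<le> B * (h s - right_lim h a)"
      using s B \<open>z a = 0\<close> by (intro forced_solution_from_zero_le[OF z]) auto
    also have "\<dots> \<le> B * (1 / 2)" using hr s B by (intro mult_left_mono) auto
    finally show "norm (z s) \<le> B / 2 + g"
      using g[OF s] norm_triangle_sub[of "z s" "G s - G a"] by simp
  qed
  show "norm (z r) \<le> 2 * g" using bound r by simp
  show "norm (z r - (G r - G a)) \<le> 2 * g * (h r - right_lim h a)"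
    using bound r \<open>z a = 0\<close> by (intro forced_solution_from_zero_le[OF z]) auto
qed

lemma linear_solution_unique_forward:
  assumes z: "linear_solution z" and "a \<le> b" "z a = 0"
  shows "z b = 0"
proof -
  have "z a = 0 \<longrightarrow> (\<forall>r\<in>{a..b}. z r = 0)"
    using \<open>a \<le> b\<close>
  proof (induction rule: Bolzano)
    case (trans a b c)
    then show ?case by (metis atLeastAtMost_iff linear order_refl)
  next
    case (local x)
    obtain d where d: "d > 0" "\<And>r. x - d < r \<Longrightarrow> r \<le> x \<Longrightarrow> h x - h r \<le> 1 / 2"
      "\<And>r. r < x + d \<Longrightarrow> x < r \<Longrightarrow> h r - right_lim h x \<le> 1 / 2"
      using mono_left_continuous_small_oscillation[OF mono_h left_h, of "1 / 2" x] by auto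
    have "\<forall>r\<in>{a..b}. z r = 0" if ab: "a \<le> x" "x \<le> b" "b - a < d" and za: "z a = 0" for a b
    proof
      fix r assume r: "r \<in> {a..b}"
      have step: "z s = 0" if "z c = 0" "h s - right_lim h c \<le> 1 / 2" "c \<le> s" for c s
      proof (cases "c = s")
        case False
        have "norm (z s) \<le> 2 * 0"
          by (rule forced_solution_growth(1)[OF z that(1,2)]) (use that False in auto)
        then show ?thesis by simp
      qed (use that in simp)
      have left: "z s = 0" if "a \<le> s" "s \<le> x" for s
        using that ab monoD[OF mono_h, of s x] d(2)[of a] mono_right_lim(1)[OF mono_h, of a]
        by (intro step[OF za]) auto
      show "z r = 0"
      proof (cases "r \<le> x")
        case False
        have "z x = 0" using left[of x] ab by simp
        then show ?thesis by (rule step) (use False d(3)[of r] ab r in simp_all)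
      qed (use left r in simp)
    qed
    with d(1) show ?case by blast
  qed
  with assms show ?thesis by simp
qed

text \<open>
  To the right of a point \<open>x\<close> the argument of the forward case yields zero only on \<open>{x<..}\<close>. At \<open>x\<close>
  itself the right limit of the solution is zero, and the invertibility of the jump gives \<open>z x = 0\<close>.
\<close>

lemma linear_solution_unique_backward:
  assumes z: "linear_solution z" and "a \<le> b" "z b = 0"
  shows "z a = 0"
proof -
  have "z b = 0 \<longrightarrow> (\<forall>r\<in>{a..b}. z r = 0)"
    using \<open>a \<le> b\<close>
  proof (induction rule: Bolzano)
    case (trans a b c)
    then show ?case by (metis atLeastAtMost_iff linear order_refl)
  next
    case (local x)
    obtain d where d: "d > 0" "\<And>r. x - d < r \<Longrightarrow> r \<le> x \<Longrightarrow> h x - h r \<le> 1 / 2"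
      "\<And>r. r < x + d \<Longrightarrow> x < r \<Longrightarrow> h r - right_lim h x \<le> 1 / 2"
      using mono_left_continuous_small_oscillation[OF mono_h left_h, of "1 / 2" x] by auto
    have step: "z r = 0" if zs: "z s = 0" and hS: "\<And>r. r \<in> S \<Longrightarrow> h s - h r \<le> 1 / 2"
      and S: "S \<subseteq> {..s}" "bdd_below S" "\<And>r. r \<in> S \<Longrightarrow> {r..s} \<subseteq> S" and r: "r \<in> S" for s S r
    proof -
      obtain m where m: "\<And>r. r \<in> S \<Longrightarrow> m \<le> r" using S(2) by (auto simp: bdd_below_def)
      have ms: "m \<le> s" using m[OF r] S(1) r by (meson atMost_iff order_trans subsetD)
      obtain B0 where B0: "\<And>r. r \<in> {m..s} \<Longrightarrow> norm (z r) \<le> B0"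
        by (rule forced_solution_bounded[OF z ms], rule that; iprover)
      have "norm (z r) \<le> 2 * 0"
      proof (rule norm_le_twice_if_halving[of S z B0, OF _ _ r])
        show "norm (z r) \<le> B0" if "r \<in> S" for r using that m S(1) by (intro B0) auto
        fix B r assume B: "B \<ge> 0" "\<And>r. r \<in> S \<Longrightarrow> norm (z r) \<le> B" and r: "r \<in> S"
        have "norm (z s - z r - (0 - 0)) \<le> B * (h s - h r)"
          using r B(2) S(1,3) by (intro forced_solution_increment_le[OF z]) blast+
        also have "\<dots> \<le> B * (1 / 2)" using hS[OF r] B(1) by (intro mult_left_mono)
        finally show "norm (z r) \<le> B / 2 + 0" using zs by simp
      qed
      then show ?thesis by simp
    qed
    have "\<forall>r\<in>{a..b}. z r = 0" if ab: "a \<le> x" "x \<le> b" "b - a < d" and zb: "z b = 0" for a b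
    proof
      fix r assume r: "r \<in> {a..b}"
      have right: "z s = 0" if "x < s" "s \<le> b" for s
      proof (rule step[OF zb, of "{x<..b}"])
        show "h b - h r \<le> 1 / 2" if "r \<in> {x<..b}" for r
          using that ab d(3)[of b] mono_right_lim(2)[OF mono_h, of x r] by simp
      qed (use that in auto)
      have zx: "z x = 0"
      proof (cases "x = b")
        case False
        then have "x < b" using ab by simp
        then have "\<forall>\<^sub>F r in at_right x. z r = 0" using right by (auto simp: eventually_at_right_field)
        then have "(z \<longlongrightarrow> 0) (at_right x)" by (rule tendsto_eventually)
        with linear_solution_right_lim[OF z, of x]
        have J: "(id_blinfun + (right_lim u x - u x) *\<^sub>R C x) (z x) = 0"
          by (rule tendsto_unique[rotated]) simp
        show ?thesis
        proof (cases "isCont u x")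
          case True
          then have "(u \<longlongrightarrow> u x) (at_right x)" by (simp add: isCont_def filterlim_at_split)
          then have "right_lim u x = u x" by (rule right_limI)
          with J show ?thesis by simp
        next
          case False
          then obtain V where V: "V o\<^sub>L (id_blinfun + (right_lim u x - u x) *\<^sub>R C x) = id_blinfun"
            using jump_inverse by blast
          have "z x = (V o\<^sub>L (id_blinfun + (right_lim u x - u x) *\<^sub>R C x)) (z x)" by (simp add: V)
          also have "\<dots> = 0" by (simp add: J blinfun.zero_right)
          finally show ?thesis .
        qed
      qed (use zb in simp)
      show "z r = 0"
      proof (cases "r \<le> x")
        case True
        show ?thesis
        proof (rule step[OF zx, of "{a..x}"])
          show "h x - h r \<le> 1 / 2" if "r \<in> {a..x}" for r using that ab d(2)[of r] by simp
        qed (use True r in auto)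
      qed (use right r in simp)
    qed
    with d(1) show ?case by blast
  qed
  with assms show ?thesis by simp
qed

lemma linear_solution_unique:
  assumes "linear_solution z" "linear_solution w" "z s = w s"
  shows "z t = w t"
proof -
  have d: "linear_solution (\<lambda>t. z t - w t)" by (rule forced_solution_diff[OF assms(1,2)])
  show ?thesis
    using linear_solution_unique_forward[OF d, of s t] linear_solution_unique_backward[OF d, of t s] assms(3)
    by (cases "s \<le> t") auto
qed

end

section \<open>Strong integrals over sets\<close>

definition set_strongly_integrable :: "'a measure \<Rightarrow> 'a set \<Rightarrow> ('a \<Rightarrow> 'b::real_normed_vector) \<Rightarrow> bool" where
  "set_strongly_integrable M E f \<longleftrightarrow> strongly_integrable M (\<lambda>x. indicat_real E x *\<^sub>R f x)"

definition set_strong_integral :: "'a measure \<Rightarrow> 'a set \<Rightarrow> ('a \<Rightarrow> 'b::real_normed_vector) \<Rightarrow> 'b" where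
  "set_strong_integral M E f = strong_integral M (\<lambda>x. indicat_real E x *\<^sub>R f x)"

lemma set_strong_integral_cong:
  assumes "\<And>x. indicat_real E x *\<^sub>R f x = indicat_real F x *\<^sub>R g x"
  shows "set_strongly_integrable M E f \<longleftrightarrow> set_strongly_integrable M F g"
    and "set_strong_integral M E f = set_strong_integral M F g"
  using assms by (simp_all add: set_strongly_integrable_def set_strong_integral_def)

lemma set_strong_integral_linear:
  fixes f :: "'a \<Rightarrow> 'b::banach"
  assumes "bounded_linear T" "set_strongly_integrable M E f"
  shows "set_strongly_integrable M E (\<lambda>x. T (f x))"
    and "set_strong_integral M E (\<lambda>x. T (f x)) = T (set_strong_integral M E f)"
proof -
  interpret bounded_linear T by fact
  have "has_strong_integral M (\<lambda>x. T (indicat_real E x *\<^sub>R f x)) (T (set_strong_integral M E f))"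
    unfolding set_strong_integral_def
    by (rule has_strong_integral_linear[OF assms(1) has_strong_integral_strong_integral
        [OF assms(2)[unfolded set_strongly_integrable_def]]])
  then have "has_strong_integral M (\<lambda>x. indicat_real E x *\<^sub>R T (f x)) (T (set_strong_integral M E f))"
    by (simp add: scaleR)
  then show "set_strongly_integrable M E (\<lambda>x. T (f x))"
    and "set_strong_integral M E (\<lambda>x. T (f x)) = T (set_strong_integral M E f)"
    unfolding set_strongly_integrable_def set_strong_integral_def
    by (auto dest: has_strong_integral_imp_strongly_integrable strong_integral_eqI)
qed

lemma set_strong_integral_diff:
  fixes f g :: "'a \<Rightarrow> 'b::banach"
  assumes "set_strongly_integrable M E f" "set_strongly_integrable M E g"
  shows "set_strongly_integrable M E (\<lambda>x. f x - g x)"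
    and "set_strong_integral M E (\<lambda>x. f x - g x) = set_strong_integral M E f - set_strong_integral M E g"
proof -
  have g: "set_strongly_integrable M E (\<lambda>x. - g x)"
    "set_strong_integral M E (\<lambda>x. - g x) = - set_strong_integral M E g"
    by (rule set_strong_integral_linear[OF bounded_linear_minus[OF bounded_linear_ident] assms(2)])+
  have "has_strong_integral M (\<lambda>x. indicat_real E x *\<^sub>R f x + indicat_real E x *\<^sub>R (- g x))
    (set_strong_integral M E f + set_strong_integral M E (\<lambda>x. - g x))"
    unfolding set_strong_integral_def
    by (rule has_strong_integral_add[OF has_strong_integral_strong_integral[OF assms(1)[unfolded set_strongly_integrable_def]]
          has_strong_integral_strong_integral[OF g(1)[unfolded set_strongly_integrable_def]]])
  then have "has_strong_integral M (\<lambda>x. indicat_real E x *\<^sub>R (f x - g x))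
    (set_strong_integral M E f - set_strong_integral M E g)"
    by (simp add: scaleR_diff_right g(2))
  then show "set_strongly_integrable M E (\<lambda>x. f x - g x)"
    and "set_strong_integral M E (\<lambda>x. f x - g x) = set_strong_integral M E f - set_strong_integral M E g"
    unfolding set_strongly_integrable_def set_strong_integral_def
    by (auto dest: has_strong_integral_imp_strongly_integrable strong_integral_eqI)
qed

lemma set_strong_integral_Un:
  fixes f :: "'a \<Rightarrow> 'b::banach"
  assumes "set_strongly_integrable M E f" "set_strongly_integrable M F f" "E \<inter> F = {}"
  shows "set_strongly_integrable M (E \<union> F) f"
    and "set_strong_integral M (E \<union> F) f = set_strong_integral M E f + set_strong_integral M F f"
proof -
  have "has_strong_integral M (\<lambda>x. indicat_real E x *\<^sub>R f x + indicat_real F x *\<^sub>R f x)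
    (set_strong_integral M E f + set_strong_integral M F f)"
    unfolding set_strong_integral_def
    by (rule has_strong_integral_add[OF has_strong_integral_strong_integral[OF assms(1)[unfolded set_strongly_integrable_def]]
          has_strong_integral_strong_integral[OF assms(2)[unfolded set_strongly_integrable_def]]])
  moreover have "(\<lambda>x. indicat_real E x *\<^sub>R f x + indicat_real F x *\<^sub>R f x) = (\<lambda>x. indicat_real (E \<union> F) x *\<^sub>R f x)"
    using assms(3) by (auto simp: indicator_def fun_eq_iff)
  ultimately show "set_strongly_integrable M (E \<union> F) f"
    and "set_strong_integral M (E \<union> F) f = set_strong_integral M E f + set_strong_integral M F f"
    unfolding set_strongly_integrable_def set_strong_integral_def
    by (auto dest: has_strong_integral_imp_strongly_integrable strong_integral_eqI)
qed

lemma set_strongly_integrable_subset: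
  assumes "set_strongly_integrable M E f" "F \<subseteq> E" "F \<in> sets M"
  shows "set_strongly_integrable M F f"
proof -
  have "(\<lambda>x. indicat_real F x *\<^sub>R indicat_real E x *\<^sub>R f x) = (\<lambda>x. indicat_real F x *\<^sub>R f x)"
    using assms(2) by (auto simp: indicator_def fun_eq_iff)
  then show ?thesis
    using strongly_integrable_indicator[OF assms(1)[unfolded set_strongly_integrable_def] assms(3)]
    by (simp add: set_strongly_integrable_def)
qed

lemma norm_set_strong_integral_le:
  fixes f :: "'a \<Rightarrow> 'b::banach"
  assumes "set_strongly_integrable M E f" and E: "E \<in> sets M" "emeasure M E \<noteq> \<infinity>"
    and B: "B \<ge> 0" "\<And>x. x \<in> E \<Longrightarrow> norm (f x) \<le> B"
  shows "norm (set_strong_integral M E f) \<le> B * measure M E"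
proof (rule norm_has_strong_integral_le)
  show "has_strong_integral M (\<lambda>x. indicat_real E x *\<^sub>R f x) (set_strong_integral M E f)"
    using assms(1) unfolding set_strongly_integrable_def set_strong_integral_def
    by (rule has_strong_integral_strong_integral)
  show "L1_close M (\<lambda>x. indicat_real E x *\<^sub>R f x) (\<lambda>_. 0) (B * measure M E)"
  proof (rule L1_closeI)
    show "(\<lambda>x. ennreal B * indicator E x) \<in> borel_measurable M" using E by simp
    show "ennreal (norm (indicat_real E x *\<^sub>R f x - 0)) \<le> ennreal B * indicator E x" for x
      using B by (auto simp: indicator_def intro!: ennreal_leI)
    show "(\<integral>\<^sup>+x. ennreal B * indicator E x \<partial>M) \<le> ennreal (B * measure M E)"
      using E B(1) by (simp add: nn_integral_cmult_indicator emeasure_eq_ennreal_measure ennreal_mult)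
  qed
qed (use B(1) in simp)

text \<open>
  Boundedness suffices for the passage to the union because the measure of the remainder tends to
  zero.
\<close>

lemma set_strongly_integrable_Union:
  fixes f :: "'a \<Rightarrow> 'b::banach"
  assumes "finite_measure M" and f: "\<And>n::nat. set_strongly_integrable M (E n) f"
    and E: "\<And>n. E n \<in> sets M" "incseq E" and B: "\<And>x. x \<in> (\<Union>n. E n) \<Longrightarrow> norm (f x) \<le> B"
  shows "set_strongly_integrable M (\<Union>n. E n) f"
proof -
  interpret finite_measure M by fact
  let ?E = "\<Union>n. E n"
  define B' where "B' = max B 0"
  have B': "B' \<ge> 0" "\<And>x. x \<in> ?E \<Longrightarrow> norm (f x) \<le> B'" using B by (auto simp: B'_def le_max_iff_disj)
  have Em: "?E \<in> sets M" using E by auto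
  have lim: "(\<lambda>n. measure M (?E - E n)) \<longlonglongrightarrow> 0"
  proof -
    have "(\<lambda>n. measure M ?E - measure M (E n)) \<longlonglongrightarrow> measure M ?E - measure M ?E"
      using E by (intro tendsto_intros finite_Lim_measure_incseq) auto
    moreover have "measure M (?E - E n) = measure M ?E - measure M (E n)" for n
      using E Em by (intro finite_measure_Diff) auto
    ultimately show ?thesis by simp
  qed
  have lim': "(\<lambda>n. B' * measure M (?E - E n)) \<longlonglongrightarrow> 0"
    using tendsto_mult[OF tendsto_const[of B'] lim] by simp
  show ?thesis
    unfolding set_strongly_integrable_def
  proof (rule strongly_integrable_closed)
    fix e :: real assume "e > 0"
    then obtain n where n: "B' * measure M (?E - E n) < e"
      using order_tendstoD(2)[OF lim'] eventually_happens[of _ sequentially] by force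
    have "L1_close M (\<lambda>x. indicat_real ?E x *\<^sub>R f x) (\<lambda>x. indicat_real (E n) x *\<^sub>R f x) e"
    proof (rule L1_closeI)
      show "(\<lambda>x. ennreal B' * indicator (?E - E n) x) \<in> borel_measurable M" using E Em by auto
      show "ennreal (norm (indicat_real ?E x *\<^sub>R f x - indicat_real (E n) x *\<^sub>R f x)) \<le> ennreal B' * indicator (?E - E n) x" for x
      proof (cases "x \<in> ?E - E n")
        case True
        then show ?thesis using B'(2)[of x] by (simp add: indicator_def ennreal_leI)
      next
        case False
        then have "indicat_real ?E x = indicat_real (E n) x" by (auto simp: indicator_def)
        then show ?thesis by simp
      qed
      have "(\<integral>\<^sup>+x. ennreal B' * indicator (?E - E n) x \<partial>M) = ennreal B' * emeasure M (?E - E n)"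
        using E Em by (intro nn_integral_cmult_indicator) auto
      also have "\<dots> = ennreal (B' * measure M (?E - E n))" using B'(1) by (simp add: emeasure_eq_measure ennreal_mult)
      also have "\<dots> \<le> ennreal e" using n by (intro ennreal_leI) simp
      finally show "(\<integral>\<^sup>+x. ennreal B' * indicator (?E - E n) x \<partial>M) \<le> ennreal e" .
    qed
    then show "\<exists>g. strongly_integrable M g \<and> L1_close M (\<lambda>x. indicat_real ?E x *\<^sub>R f x) g e"
      using f[of n] unfolding set_strongly_integrable_def by blast
  qed
qed

section \<open>The evolution family\<close>

locale linear_evolution = linear_mde A C u hA hC FA FC
  for A C :: "real \<Rightarrow> 'z::banach \<Rightarrow>\<^sub>L 'z" and u hA hC FA FC +
  fixes U :: "real \<Rightarrow> real \<Rightarrow> 'z \<Rightarrow>\<^sub>L 'z"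
  assumes U_solution: "\<And>s x. linear_solution (\<lambda>r. U r s x)" and U_ident: "\<And>s. U s s = id_blinfun"
begin

lemma U_compose: "U t s (U s r x) = U t r x"
  by (rule linear_solution_unique[OF U_solution[of s "U s r x"] U_solution[of r x], where s = s]) (simp add: U_ident)

text \<open>
  Over an interval on which \<open>h\<close> varies by at most \<open>1 / 2\<close>, a solution at most doubles its value at
  either end point. Hence its increment is at most twice the variation of \<open>h\<close>.
\<close>

lemma norm_U_minus_ident_le:
  assumes "r \<le> d" "h d - h r \<le> 1 / 2"
  shows "norm (U d r - id_blinfun) \<le> 2 * (h d - h r)" "norm (U r d - id_blinfun) \<le> 2 * (h d - h r)"
proof -
  have hh: "0 \<le> h t - h s" if "s \<le> t" for s t using monoD[OF mono_h that] by simp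
  have main: "norm (w d - w r) \<le> 2 * (h d - h r) * norm x"
    if w: "linear_solution w" and c: "c = r \<or> c = d" and x: "w c = x" for w c x
  proof -
    obtain B0 where B0: "\<And>s. s \<in> {r..d} \<Longrightarrow> norm (w s) \<le> B0"
      by (rule forced_solution_bounded[OF w assms(1)], rule that; iprover)
    have inc: "norm (w s - x) \<le> B * (h d - h r)"
      if B: "B \<ge> 0" "\<And>s. s \<in> {r..d} \<Longrightarrow> norm (w s) \<le> B" and s: "s \<in> {r..d}" for B s
    proof -
      have "norm (w s - w r - (0 - 0)) \<le> B * (h s - h r)" "norm (w d - w s - (0 - 0)) \<le> B * (h d - h s)"
        using s B(2) by (intro forced_solution_increment_le[OF w]; simp)+
      moreover have "B * (h s - h r) \<le> B * (h d - h r)" "B * (h d - h s) \<le> B * (h d - h r)"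
        using s B(1) mono_h by (auto intro!: mult_left_mono simp: mono_def)
      ultimately show ?thesis using c x by (auto simp: norm_minus_commute)
    qed
    have bound: "norm (w s) \<le> 2 * norm x" if "s \<in> {r..d}" for s
    proof (rule norm_le_twice_if_halving[of "{r..d}" w B0, OF B0 _ that])
      fix B s assume B: "B \<ge> 0" "\<And>s. s \<in> {r..d} \<Longrightarrow> norm (w s) \<le> B" and s: "s \<in> {r..d}"
      have "norm (w s - x) \<le> B * (h d - h r)" by (rule inc[OF B s])
      also have "\<dots> \<le> B * (1 / 2)" using assms(2) B(1) by (intro mult_left_mono)
      finally show "norm (w s) \<le> B / 2 + norm x" using norm_triangle_sub[of "w s" x] by simp
    qed
    have "norm (w d - w r - (0 - 0)) \<le> 2 * norm x * (h d - h r)"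
      by (rule forced_solution_increment_le[OF w assms(1) bound])
    then show ?thesis by (simp add: mult_ac)
  qed
  show "norm (U d r - id_blinfun) \<le> 2 * (h d - h r)"
  proof (rule norm_blinfun_bound)
    show "norm ((U d r - id_blinfun) x) \<le> 2 * (h d - h r) * norm x" for x
      using main[OF U_solution[of r x], of r x] by (simp add: U_ident blinfun.diff_left)
  qed (use hh[OF assms(1)] in simp)
  show "norm (U r d - id_blinfun) \<le> 2 * (h d - h r)"
  proof (rule norm_blinfun_bound)
    show "norm ((U r d - id_blinfun) x) \<le> 2 * (h d - h r) * norm x" for x
      using main[OF U_solution[of d x], of d x] by (simp add: U_ident blinfun.diff_left norm_minus_commute)
  qed (use hh[OF assms(1)] in simp)
qed

lemma norm_U_le_2:
  assumes "r \<le> d" "h d - h r \<le> 1 / 2"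
  shows "norm (U d r) \<le> 2" "norm (U r d) \<le> 2"
proof -
  have id: "norm (id_blinfun :: 'z \<Rightarrow>\<^sub>L 'z) \<le> 1" by (rule norm_blinfun_bound) auto
  have le: "norm T \<le> 2" if "norm (T - id_blinfun) \<le> 2 * (h d - h r)" for T :: "'z \<Rightarrow>\<^sub>L 'z"
  proof -
    have "norm T \<le> norm (id_blinfun :: 'z \<Rightarrow>\<^sub>L 'z) + norm (T - id_blinfun)" by (rule norm_triangle_sub)
    also have "\<dots> \<le> 1 + 1" using id that assms(2) by (intro add_mono) auto
    finally show ?thesis by simp
  qed
  show "norm (U d r) \<le> 2" "norm (U r d) \<le> 2" by (intro le norm_U_minus_ident_le assms)+
qed

lemma U_bounded_on_compact:
  assumes "a \<le> b"
  obtains M where "M > 0" "\<And>t. t \<in> {a..b} \<Longrightarrow> norm (U 0 t) \<le> M" "\<And>t. t \<in> {a..b} \<Longrightarrow> norm (U t 0) \<le> M"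
proof -
  have loc: "\<exists>d>0. \<exists>B. \<forall>r. \<bar>r - x\<bar> < d \<longrightarrow> norm (U 0 r) + norm (U r 0) \<le> B" for x
  proof -
    obtain d where d: "d > 0" "\<And>r. x - d < r \<Longrightarrow> r \<le> x \<Longrightarrow> h x - h r \<le> 1 / 2"
      "\<And>r. r < x + d \<Longrightarrow> x < r \<Longrightarrow> h r - right_lim h x \<le> 1 / 2"
      using mono_left_continuous_small_oscillation[OF mono_h left_h, of "1 / 2" x] by auto
    have comp: "norm (U 0 r) + norm (U r 0) \<le> 2 * (norm (U 0 y) + norm (U y 0))"
      if "norm (U r y) \<le> 2" "norm (U y r) \<le> 2" for r y
    proof -
      have "U 0 r = U 0 y o\<^sub>L U y r" "U r 0 = U r y o\<^sub>L U y 0" by (auto intro!: blinfun_eqI simp: U_compose)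
      then have "norm (U 0 r) \<le> norm (U 0 y) * norm (U y r)" "norm (U r 0) \<le> norm (U r y) * norm (U y 0)"
        by (metis norm_blinfun_compose)+
      moreover have "norm (U 0 y) * norm (U y r) \<le> norm (U 0 y) * 2" "norm (U r y) * norm (U y 0) \<le> 2 * norm (U y 0)"
        using that by (auto intro: mult_left_mono mult_right_mono)
      ultimately show ?thesis by simp
    qed
    \<comment> \<open>To the right of \<open>x\<close> the comparison point must lie to the right as well, since
      \<open>h\<close> may jump at \<open>x\<close>.\<close>
    let ?y = "x + d / 2"
    let ?B = "2 * (norm (U 0 x) + norm (U x 0)) + 2 * (norm (U 0 ?y) + norm (U ?y 0))"
    have "norm (U 0 r) + norm (U r 0) \<le> ?B" if "\<bar>r - x\<bar> < d / 2" for r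
    proof (cases "r \<le> x")
      case True
      then have "h x - h r \<le> 1 / 2" using that d(1) by (intro d(2)) auto
      with comp[OF norm_U_le_2(2,1)[OF True this]] show ?thesis by (simp add: add_increasing2)
    next
      case False
      have "h ?y - h r \<le> h ?y - right_lim h x" using mono_right_lim(2)[OF mono_h, of x r] False by simp
      also have "\<dots> \<le> 1 / 2" using d(1) by (intro d(3)) auto
      finally have "h ?y - h r \<le> 1 / 2" .
      moreover have "r \<le> ?y" using that by linarith
      ultimately show ?thesis using comp[OF norm_U_le_2(2,1)] by (simp add: add_increasing)
    qed
    then show ?thesis using d(1) by (intro exI[of _ "d / 2"] conjI exI[of _ ?B]) auto
  qed
  have "\<exists>d>0. \<exists>B. \<forall>r. \<bar>r - x\<bar> < d \<longrightarrow> norm (norm (U 0 r) + norm (U r 0)) \<le> B" for x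
    using loc[of x] by simp
  then obtain B where B: "\<And>r. r \<in> {a..b} \<Longrightarrow> norm (norm (U 0 r) + norm (U r 0)) \<le> B"
    using bounded_if_locally_bounded[OF assms, of "\<lambda>r. norm (U 0 r) + norm (U r 0)"] by metis
  show thesis
  proof (rule that[of "max B 1"])
    fix t assume "t \<in> {a..b}"
    from B[OF this] have *: "norm (U 0 t) + norm (U t 0) \<le> B" by simp
    show "norm (U 0 t) \<le> max B 1" "norm (U t 0) \<le> max B 1"
      using * norm_ge_zero[of "U 0 t"] norm_ge_zero[of "U t 0"] by linarith+
  qed simp
qed

text \<open>
  On compact sets the evolution operators based at zero have increments dominated by those of \<open>h\<close>:
  on short intervals by the cocycle property and the previous estimate, on the others because the
  increment is bounded and that of \<open>h\<close> exceeds \<open>1 / 2\<close>.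
\<close>

lemma U_increment_le:
  assumes M: "\<And>t. t \<in> {a..b} \<Longrightarrow> norm (U 0 t) \<le> M" "\<And>t. t \<in> {a..b} \<Longrightarrow> norm (U t 0) \<le> M"
    and rd: "a \<le> r" "r \<le> d" "d \<le> b"
  shows "norm (U 0 d - U 0 r) \<le> 4 * M * (h d - h r)" "norm (U d 0 - U r 0) \<le> 4 * M * (h d - h r)"
proof -
  have M0: "M \<ge> 0" using M(1)[of r] rd order_trans[OF norm_ge_zero] by auto
  have hh: "0 \<le> h d - h r" using monoD[OF mono_h rd(2)] by simp
  have Mr: "norm (U 0 d) \<le> M" "norm (U r 0) \<le> M" "norm (U 0 r) \<le> M" "norm (U d 0) \<le> M" using M rd by auto
  have le: "norm T \<le> 4 * M * (h d - h r)"
    if near: "h d - h r \<le> 1 / 2 \<Longrightarrow> norm T \<le> M * (2 * (h d - h r))" and far: "norm T \<le> M + M" for T :: "'z \<Rightarrow>\<^sub>L 'z"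
  proof (cases "h d - h r \<le> 1 / 2")
    case True
    from near[OF True] show ?thesis using mult_nonneg_nonneg[OF M0 hh] by (simp add: algebra_simps)
  next
    case False
    have "M + M = 4 * M * (1 / 2)" by simp
    also have "\<dots> \<le> 4 * M * (h d - h r)" using False M0 by (intro mult_left_mono) auto
    finally show ?thesis using far by simp
  qed
  show "norm (U 0 d - U 0 r) \<le> 4 * M * (h d - h r)"
  proof (rule le)
    assume small: "h d - h r \<le> 1 / 2"
    have "U 0 d - U 0 r = U 0 d o\<^sub>L (id_blinfun - U d r)"
      by (rule blinfun_eqI) (simp add: blinfun.bilinear_simps U_compose)
    then have "norm (U 0 d - U 0 r) \<le> norm (U 0 d) * norm (id_blinfun - U d r)" by (metis norm_blinfun_compose)
    also have "\<dots> \<le> M * (2 * (h d - h r))"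
      using Mr norm_U_minus_ident_le[OF rd(2) small] M0 by (intro mult_mono) (auto simp: norm_minus_commute)
    finally show "norm (U 0 d - U 0 r) \<le> M * (2 * (h d - h r))" .
  qed (rule order_trans[OF norm_triangle_ineq4], use Mr in simp)
  show "norm (U d 0 - U r 0) \<le> 4 * M * (h d - h r)"
  proof (rule le)
    assume small: "h d - h r \<le> 1 / 2"
    have "U d 0 - U r 0 = (U d r - id_blinfun) o\<^sub>L U r 0"
      by (rule blinfun_eqI) (simp add: blinfun.bilinear_simps U_compose)
    then have "norm (U d 0 - U r 0) \<le> norm (U d r - id_blinfun) * norm (U r 0)" by (metis norm_blinfun_compose)
    also have "\<dots> \<le> (2 * (h d - h r)) * M"
      using Mr norm_U_minus_ident_le[OF rd(2) small] M0 hh by (intro mult_mono) auto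
    finally show "norm (U d 0 - U r 0) \<le> M * (2 * (h d - h r))" by (simp add: mult.commute)
  qed (rule order_trans[OF norm_triangle_ineq4], use Mr in simp)
qed

text \<open>
  The evolution operator back to time zero, started just after a possible jump at \<open>t\<close>.
\<close>

definition \<Phi> :: "real \<Rightarrow> 'z \<Rightarrow>\<^sub>L 'z" where "\<Phi> t = right_lim (U 0) t"

lemma tendsto_\<Phi>: "(U 0 \<longlongrightarrow> \<Phi> t) (at_right t)"
  unfolding \<Phi>_def
proof (rule tendsto_at_right_if_small_oscillation)
  fix e :: real assume e: "e > 0"
  obtain M where M: "M > 0" "\<And>s. s \<in> {t..t + 1} \<Longrightarrow> norm (U 0 s) \<le> M" "\<And>s. s \<in> {t..t + 1} \<Longrightarrow> norm (U s 0) \<le> M"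
    using U_bounded_on_compact[of t "t + 1"] by auto
  have e': "e / (8 * M) > 0" using e M(1) by simp
  obtain d where d: "d > 0" "\<And>r. t - d < r \<Longrightarrow> r \<le> t \<Longrightarrow> h t - h r \<le> e / (8 * M)"
    "\<And>r. r < t + d \<Longrightarrow> t < r \<Longrightarrow> h r - right_lim h t \<le> e / (8 * M)"
    using mono_left_continuous_small_oscillation[OF mono_h left_h e', of t] by auto
  have "norm (U 0 s - U 0 r) < e" if rs: "t < r" "r \<le> s" "s < min (t + d) (t + 1)" for r s
  proof -
    have "norm (U 0 s - U 0 r) \<le> 4 * M * (h s - h r)" by (rule U_increment_le[OF M(2,3)]) (use rs in auto)
    also have "\<dots> \<le> 4 * M * (e / (8 * M))"
      using M(1) d(3)[of s] mono_right_lim(2)[OF mono_h rs(1)] rs by (intro mult_left_mono) auto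
    also have "\<dots> < e" using e M(1) by simp
    finally show ?thesis .
  qed
  then show "\<exists>b>t. \<forall>r s. t < r \<longrightarrow> r \<le> s \<longrightarrow> s < b \<longrightarrow> norm (U 0 s - U 0 r) < e"
    using d(1) by (intro exI[of _ "min (t + d) (t + 1)"]) auto
qed

lemma \<Phi>_increment_le:
  assumes M: "\<And>t. t \<in> {a..b} \<Longrightarrow> norm (U 0 t) \<le> M" "\<And>t. t \<in> {a..b} \<Longrightarrow> norm (U t 0) \<le> M"
    and rd: "a \<le> r" "r < b"
  shows "r < d \<Longrightarrow> d \<le> b \<Longrightarrow> norm (U 0 d - \<Phi> r) \<le> 4 * M * (h d - right_lim h r)"
    and "r \<le> d \<Longrightarrow> d < b \<Longrightarrow> norm (\<Phi> d - \<Phi> r) \<le> 4 * M * (right_lim h d - right_lim h r)"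
    and "norm (\<Phi> r) \<le> M"
proof -
  have 1: "norm (U 0 d - \<Phi> r) \<le> 4 * M * (h d - right_lim h r)" if d: "r < d" "d \<le> b" for d
  proof (rule tendsto_le[of "at_right r"])
    show "((\<lambda>s. norm (U 0 d - U 0 s)) \<longlongrightarrow> norm (U 0 d - \<Phi> r)) (at_right r)"
      by (intro tendsto_intros tendsto_\<Phi>)
    show "((\<lambda>s. 4 * M * (h d - h s)) \<longlongrightarrow> 4 * M * (h d - right_lim h r)) (at_right r)"
      by (intro tendsto_intros mono_tendsto_right_lim mono_h)
    have "norm (U 0 d - U 0 s) \<le> 4 * M * (h d - h s)" if "r < s" "s < d" for s
      by (rule U_increment_le(1)[OF M]) (use that d rd in auto)
    then show "\<forall>\<^sub>F s in at_right r. norm (U 0 d - U 0 s) \<le> 4 * M * (h d - h s)"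
      using d(1) by (auto simp: eventually_at_right_field)
  qed simp
  then show "r < d \<Longrightarrow> d \<le> b \<Longrightarrow> norm (U 0 d - \<Phi> r) \<le> 4 * M * (h d - right_lim h r)" .
  show "norm (\<Phi> d - \<Phi> r) \<le> 4 * M * (right_lim h d - right_lim h r)" if d: "r \<le> d" "d < b"
  proof (rule tendsto_le[of "at_right d"])
    show "((\<lambda>s. norm (U 0 s - \<Phi> r)) \<longlongrightarrow> norm (\<Phi> d - \<Phi> r)) (at_right d)"
      by (intro tendsto_intros tendsto_\<Phi>)
    show "((\<lambda>s. 4 * M * (h s - right_lim h r)) \<longlongrightarrow> 4 * M * (right_lim h d - right_lim h r)) (at_right d)"
      by (intro tendsto_intros mono_tendsto_right_lim mono_h)
    show "\<forall>\<^sub>F s in at_right d. norm (U 0 s - \<Phi> r) \<le> 4 * M * (h s - right_lim h r)"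
      using 1 d by (auto simp: eventually_at_right_field)
  qed simp
  show "norm (\<Phi> r) \<le> M"
  proof (rule tendsto_upperbound[of "\<lambda>s. norm (U 0 s)" _ "at_right r"])
    show "((\<lambda>s. norm (U 0 s)) \<longlongrightarrow> norm (\<Phi> r)) (at_right r)" by (intro tendsto_intros tendsto_\<Phi>)
    show "\<forall>\<^sub>F s in at_right r. norm (U 0 s) \<le> M"
      using M(1) rd by (auto simp: eventually_at_right_field)
  qed simp
qed

end

section \<open>The Stieltjes measure and variation of constants\<close>

lemma space_stieltjes_measure [simp]: "space (stieltjes_measure u) = UNIV"
  by (simp add: stieltjes_measure_def)

lemma sets_stieltjes_measure: "E \<in> sets borel \<Longrightarrow> E \<in> sets (stieltjes_measure u)"
  by (simp add: stieltjes_measure_def)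

lemma borel_measurable_stieltjes_measure:
  "f \<in> borel_measurable borel \<Longrightarrow> f \<in> borel_measurable (stieltjes_measure u)"
  unfolding stieltjes_measure_def by (rule measurable_completion) simp

text \<open>
  The constant \<open>V\<close> bounds the total mass of \<open>du\<close>.
\<close>

locale bounded_evolution = linear_evolution A C u hA hC FA FC U
  for A C :: "real \<Rightarrow> 'z::banach \<Rightarrow>\<^sub>L 'z" and u hA hC FA FC U +
  fixes V :: real
  assumes V: "\<And>c d. c \<le> d \<Longrightarrow> u d - u c \<le> V"
begin

abbreviation "\<mu> \<equiv> stieltjes_measure u"

lemma emeasure_Ico: "a \<le> b \<Longrightarrow> emeasure \<mu> {a..<b} = ennreal (u b - u a)"
  using left_u mono_u by (intro emeasure_stieltjes_measure) (auto simp: continuous_within)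

lemma emeasure_UNIV_le: "emeasure \<mu> UNIV \<le> ennreal V"
proof -
  have U: "(\<Union>n. {- real n..<real n}) = UNIV"
  proof -
    have "x \<in> (\<Union>n. {- real n..<real n})" for x
      using reals_Archimedean2[of "\<bar>x\<bar>"] by (auto simp: abs_less_iff) (smt (verit))
    then show ?thesis by auto
  qed
  have "(SUP n. emeasure \<mu> {- real n..<real n}) = emeasure \<mu> (\<Union>n. {- real n..<real n})"
    by (rule SUP_emeasure_incseq) (auto simp: incseq_def intro: sets_stieltjes_measure)
  moreover have "emeasure \<mu> {- real n..<real n} \<le> ennreal V" for n
    by (subst emeasure_Ico) (auto intro!: ennreal_leI V)
  then have "(SUP n. emeasure \<mu> {- real n..<real n}) \<le> ennreal V" by (rule SUP_least)
  ultimately show ?thesis unfolding U by simp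
qed

lemma finite_measure_\<mu>: "finite_measure \<mu>"
  using emeasure_UNIV_le by (intro finite_measureI) (auto simp: top_unique)

sublocale finite_measure \<mu> by (rule finite_measure_\<mu>)

lemma V_nonneg: "V \<ge> 0" using V[of 0 0] by simp

lemma measure_le_V: "measure \<mu> E \<le> V"
proof -
  have "measure \<mu> E \<le> measure \<mu> UNIV" using bounded_measure[of E] by simp
  also have "\<dots> \<le> V" using emeasure_UNIV_le V_nonneg by (simp add: emeasure_eq_measure)
  finally show ?thesis .
qed

lemma measure_Ico: "a \<le> b \<Longrightarrow> measure \<mu> {a..<b} = u b - u a"
  using emeasure_Ico[of a b] mono_u by (simp add: measure_def mono_def)

lemma measure_Ioo_le:
  assumes "a < b"
  shows "measure \<mu> {a<..<b} \<le> u b - right_lim u a"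
proof -
  have U: "(\<Union>n. {a + 1 / real (Suc n)..<b}) = {a<..<b}"
  proof (intro equalityI subsetI)
    fix x assume "x \<in> {a<..<b}"
    moreover from this obtain n where "1 / real (Suc n) < x - a"
      using reals_Archimedean[of "x - a"] by (auto simp: inverse_eq_divide)
    ultimately show "x \<in> (\<Union>n. {a + 1 / real (Suc n)..<b})" by (auto intro!: exI[of _ n])
  next
    fix x assume "x \<in> (\<Union>n. {a + 1 / real (Suc n)..<b})"
    then obtain n where "a + 1 / real (Suc n) \<le> x" "x < b" by auto
    moreover have "1 / real (Suc n) > 0" by simp
    ultimately show "x \<in> {a<..<b}" by (smt (verit) greaterThanLessThan_iff)
  qed
  have "incseq (\<lambda>n. {a + 1 / real (Suc n)..<b})"
    by (auto simp: incseq_def) (smt (verit) frac_le of_nat_0_le_iff of_nat_mono)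
  then have "(\<lambda>n. measure \<mu> {a + 1 / real (Suc n)..<b}) \<longlonglongrightarrow> measure \<mu> (\<Union>n. {a + 1 / real (Suc n)..<b})"
    by (intro finite_Lim_measure_incseq) (auto intro: sets_stieltjes_measure)
  moreover have "measure \<mu> {a + 1 / real (Suc n)..<b} \<le> u b - right_lim u a" for n
  proof (cases "a + 1 / real (Suc n) \<le> b")
    case True
    have "right_lim u a \<le> u (a + 1 / real (Suc n))" by (rule mono_right_lim(2)[OF mono_u]) simp
    with True show ?thesis by (simp add: measure_Ico)
  next
    case False
    then show ?thesis using mono_right_lim(2)[OF mono_u assms] by simp
  qed
  ultimately show ?thesis unfolding U by (intro LIMSEQ_le_const2) auto
qed

lemma set_strongly_integrable_dominated:
  fixes f :: "real \<Rightarrow> 'b::real_normed_vector"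
  assumes "mono v" and f: "\<And>s t. a \<le> s \<Longrightarrow> s \<le> t \<Longrightarrow> t < b \<Longrightarrow> norm (f t - f s) \<le> v t - v s"
  shows "set_strongly_integrable \<mu> {a..<b} f"
  unfolding set_strongly_integrable_def
proof (rule strongly_integrable_dominated_increments[OF finite_measure_\<mu>])
  show "{a..<b} \<in> sets \<mu>" by (rule sets_stieltjes_measure) simp
  show "v \<in> borel_measurable \<mu>"
    by (rule borel_measurable_stieltjes_measure) (rule borel_measurable_mono[OF assms(1)])
  show "\<bar>v t\<bar> \<le> \<bar>v a\<bar> + \<bar>v b\<bar>" if "t \<in> {a..<b}" for t
    using that monoD[OF assms(1), of a t] monoD[OF assms(1), of t b] by simp
  show "norm (f s - f t) \<le> \<bar>v s - v t\<bar>" if "s \<in> {a..<b}" "t \<in> {a..<b}" for s t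
    using f[of s t] f[of t s] that by (cases "s \<le> t") (auto simp: norm_minus_commute abs_if)
qed

text \<open>
  The right limits have increments dominated by those of the right limits of \<open>h\<close>, so they are
  integrable as an operator-valued function. Applying them to \<open>g\<close> is Lipschitz in the operator
  because \<open>g\<close> is bounded.
\<close>

lemma \<Phi>_integrable:
  assumes g: "set_strongly_integrable \<mu> {a..<b} g" "\<And>s. norm (g s) \<le> M"
  shows "set_strongly_integrable \<mu> {a..<b} (\<lambda>s. \<Phi> s (g s))"
proof (cases "a < b")
  case True
  obtain N where N: "N > 0" "\<And>t. t \<in> {a..b} \<Longrightarrow> norm (U 0 t) \<le> N" "\<And>t. t \<in> {a..b} \<Longrightarrow> norm (U t 0) \<le> N"
    using U_bounded_on_compact[of a b] True by auto
  have "set_strongly_integrable \<mu> {a..<b} \<Phi>"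
  proof (rule set_strongly_integrable_dominated)
    show "mono (\<lambda>t. 4 * N * right_lim h t)"
      using N(1) mono_right_lim(3)[OF mono_h] by (auto simp: mono_def)
    show "norm (\<Phi> t - \<Phi> s) \<le> 4 * N * right_lim h t - 4 * N * right_lim h s" if st: "a \<le> s" "s \<le> t" "t < b" for s t
      unfolding right_diff_distrib[symmetric] by (rule \<Phi>_increment_le(2)[OF N(2,3)]) (use st in auto)
  qed
  then have "strongly_integrable \<mu> (\<lambda>t. (indicat_real {a..<b} t *\<^sub>R \<Phi> t) (indicat_real {a..<b} t *\<^sub>R g t))"
    unfolding set_strongly_integrable_def
  proof (rule strongly_integrable_Lipschitz_compose[where H = "\<lambda>t T. blinfun_apply T (indicat_real {a..<b} t *\<^sub>R g t)"
        and L = M])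
    show "strongly_integrable \<mu> (\<lambda>t. blinfun_apply T (indicat_real {a..<b} t *\<^sub>R g t))" for T :: "'z \<Rightarrow>\<^sub>L 'z"
      by (rule strongly_integrable_linear[OF blinfun.bounded_linear_right g(1)[unfolded set_strongly_integrable_def]])
    fix t and T S :: "'z \<Rightarrow>\<^sub>L 'z"
    have M: "M \<ge> 0" using g(2)[of t] norm_ge_zero[of "g t"] by linarith
    have "norm (T (indicat_real {a..<b} t *\<^sub>R g t) - S (indicat_real {a..<b} t *\<^sub>R g t))
      \<le> norm (T - S) * norm (indicat_real {a..<b} t *\<^sub>R g t)"
      unfolding blinfun.diff_left[symmetric] by (rule norm_blinfun)
    also have "\<dots> \<le> norm (T - S) * M" using g(2)[of t] M by (intro mult_left_mono) (auto simp: indicator_def)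
    finally show "norm (T (indicat_real {a..<b} t *\<^sub>R g t) - S (indicat_real {a..<b} t *\<^sub>R g t)) \<le> M * norm (T - S)"
      by (simp add: mult.commute)
  qed
  moreover have "(\<lambda>t. (indicat_real {a..<b} t *\<^sub>R \<Phi> t) (indicat_real {a..<b} t *\<^sub>R g t))
    = (\<lambda>t. indicat_real {a..<b} t *\<^sub>R \<Phi> t (g t))"
    by (auto simp: indicator_def blinfun.bilinear_simps fun_eq_iff)
  ultimately show ?thesis by (simp add: set_strongly_integrable_def)
next
  case False
  then show ?thesis by (simp add: set_strongly_integrable_def strongly_integrable_zero)
qed

lemma set_strong_integral_Ico_split:
  fixes f :: "real \<Rightarrow> 'z"
  assumes "set_strongly_integrable \<mu> {a..<b} f" "set_strongly_integrable \<mu> {b..<c} f" "a \<le> b" "b \<le> c"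
  shows "set_strong_integral \<mu> {a..<c} f = set_strong_integral \<mu> {a..<b} f + set_strong_integral \<mu> {b..<c} f"
proof -
  have "{a..<b} \<union> {b..<c} = {a..<c}" "{a..<b} \<inter> {b..<c} = {}" using assms(3,4) by auto
  then show ?thesis using set_strong_integral_Un(2)[OF assms(1,2)] by simp
qed

lemma norm_set_strong_integral_Ico_le:
  fixes f :: "real \<Rightarrow> 'z"
  assumes "set_strongly_integrable \<mu> {a..<b} f" "\<And>x. x \<in> {a..<b} \<Longrightarrow> norm (f x) \<le> B" "B \<ge> 0" "a \<le> b"
  shows "norm (set_strong_integral \<mu> {a..<b} f) \<le> B * (u b - u a)"
  unfolding measure_Ico[OF assms(4), symmetric]
  by (rule norm_set_strong_integral_le[OF assms(1) _ _ assms(3,2)])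
    (auto intro: sets_stieltjes_measure simp: emeasure_eq_measure)

text \<open>
  With \<open>y\<close> the difference of \<open>z\<close> and the linear solution through \<open>(c, z c)\<close>, the left-hand side over
  \<open>{c..<d}\<close> is \<open>U 0 d (y d)\<close>. If \<open>h\<close> varies by at most \<open>\<epsilon>\<close> after its jump at \<open>c\<close>, then
  \<open>y d\<close> is \<open>G d - G c\<close> up to a multiple of \<open>\<epsilon> (u d - u c)\<close>, and \<open>\<Phi> s\<close> is \<open>U 0 d\<close> up to
  a multiple of \<open>\<epsilon>\<close> for all \<open>s\<close> in \<open>{c..<d}\<close>. So the two sides differ by a multiple of
  \<open>\<epsilon> (u d - u c)\<close>, and such a bound is additive in the interval.
\<close>

theorem variation_of_constants:
  assumes z: "forced_solution G z" and g: "\<And>a b. a \<le> b \<Longrightarrow> set_strongly_integrable \<mu> {a..<b} g"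
    and M: "\<And>s. norm (g s) \<le> M"
    and G: "\<And>a b. a \<le> b \<Longrightarrow> G b - G a = set_strong_integral \<mu> {a..<b} g" and ab: "a \<le> b"
  shows "U 0 b (z b) - U 0 a (z a) = set_strong_integral \<mu> {a..<b} (\<lambda>s. \<Phi> s (g s))"
proof -
  have M0: "M \<ge> 0" using M[of 0] norm_ge_zero[of "g 0"] by linarith
  obtain N where N: "N > 0" "\<And>t. t \<in> {a..b} \<Longrightarrow> norm (U 0 t) \<le> N" "\<And>t. t \<in> {a..b} \<Longrightarrow> norm (U t 0) \<le> N"
    using U_bounded_on_compact[OF ab] by auto
  let ?J = "\<lambda>c d. set_strong_integral \<mu> {c..<d} (\<lambda>s. \<Phi> s (g s))"
  define D where "D c d = U 0 d (z d) - U 0 c (z c) - ?J c d" for c d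
  have J: "set_strongly_integrable \<mu> {c..<d} (\<lambda>s. \<Phi> s (g s))" if "c \<le> d" for c d
    by (rule \<Phi>_integrable[OF g[OF that] M])
  have Gle: "norm (G d - G c) \<le> M * (u d - u c)" if "c \<le> d" for c d
    unfolding G[OF that] by (rule norm_set_strong_integral_Ico_le[OF g[OF that] M M0 that])
  have add: "D c e = D c d + D d e" if "c \<le> d" "d \<le> e" for c d e
    unfolding D_def using set_strong_integral_Ico_split[OF J[OF that(1)] J[OF that(2)] that] by simp
  have uu: "0 \<le> u d - u c" if "c \<le> d" for c d using monoD[OF mono_u that] by simp
  have small: "norm (D c d) \<le> 6 * N * M * \<epsilon> * (u d - u c)"
    if cd: "a \<le> c" "c < d" "d \<le> b" and eps: "h d - right_lim h c \<le> \<epsilon>" "\<epsilon> \<le> 1 / 2" "0 < \<epsilon>" for c d \<epsilon>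
  proof -
    have cd': "c \<le> d" using cd(2) by simp
    define y where "y t = z t - U t c (z c)" for t
    have y: "forced_solution G y" unfolding y_def by (rule forced_solution_diff[OF z U_solution])
    have yc: "y c = 0" by (simp add: y_def U_ident)
    have "norm (y d - (G d - G c)) \<le> 2 * (M * (u d - u c)) * (h d - right_lim h c)"
    proof (rule forced_solution_growth(2)[OF y yc])
      show "h d - right_lim h c \<le> 1 / 2" using eps by simp
      fix r assume "r \<in> {c<..d}"
      then have "norm (G r - G c) \<le> M * (u r - u c)" "M * (u r - u c) \<le> M * (u d - u c)"
        using Gle[of c r] M0 monoD[OF mono_u, of r d] by (auto intro: mult_left_mono)
      then show "norm (G r - G c) \<le> M * (u d - u c)" by simp
    qed (use cd in auto)
    also have "\<dots> \<le> 2 * (M * (u d - u c)) * \<epsilon>" using eps M0 uu[OF cd'] by (intro mult_left_mono) auto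
    finally have yd: "norm (y d - (G d - G c)) \<le> 2 * (M * (u d - u c)) * \<epsilon>" .
    have "norm (U 0 d (y d - (G d - G c))) \<le> norm (U 0 d) * norm (y d - (G d - G c))" by (rule norm_blinfun)
    also have "\<dots> \<le> N * (2 * (M * (u d - u c)) * \<epsilon>)" using N(1) N(2)[of d] cd yd by (intro mult_mono) auto
    finally have 1: "norm (U 0 d (y d - (G d - G c))) \<le> N * (2 * (M * (u d - u c)) * \<epsilon>)" .
    have Ug: "set_strongly_integrable \<mu> {c..<d} (\<lambda>s. U 0 d (g s))"
      "set_strong_integral \<mu> {c..<d} (\<lambda>s. U 0 d (g s)) = U 0 d (G d - G c)"
      using set_strong_integral_linear[OF blinfun.bounded_linear_right g[OF cd'], of "U 0 d"] G[OF cd'] by simp_all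
    have "norm (set_strong_integral \<mu> {c..<d} (\<lambda>s. U 0 d (g s) - \<Phi> s (g s))) \<le> (4 * N * \<epsilon> * M) * (u d - u c)"
    proof (rule norm_set_strong_integral_Ico_le)
      show "set_strongly_integrable \<mu> {c..<d} (\<lambda>s. U 0 d (g s) - \<Phi> s (g s))"
        by (rule set_strong_integral_diff(1)[OF Ug(1) J[OF cd']])
      fix s assume s: "s \<in> {c..<d}"
      have "norm (U 0 d - \<Phi> s) \<le> 4 * N * (h d - right_lim h s)"
        by (rule \<Phi>_increment_le(1)[OF N(2,3)]) (use s cd in auto)
      also have "\<dots> \<le> 4 * N * \<epsilon>"
        using N(1) eps(1) mono_right_lim(3)[OF mono_h, of c s] s by (intro mult_left_mono) auto
      finally have "norm (U 0 d - \<Phi> s) * norm (g s) \<le> 4 * N * \<epsilon> * M"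
        using M[of s] M0 N(1) eps(3) by (intro mult_mono) auto
      then show "norm (U 0 d (g s) - \<Phi> s (g s)) \<le> 4 * N * \<epsilon> * M"
        unfolding blinfun.diff_left[symmetric] by (rule order_trans[OF norm_blinfun])
    qed (use M0 N(1) eps(3) cd' in auto)
    then have 2: "norm (U 0 d (G d - G c) - ?J c d) \<le> (4 * N * \<epsilon> * M) * (u d - u c)"
      using set_strong_integral_diff(2)[OF Ug(1) J[OF cd']] Ug(2) by simp
    have "D c d = U 0 d (y d - (G d - G c)) + (U 0 d (G d - G c) - ?J c d)"
      by (simp add: D_def y_def blinfun.diff_right U_compose)
    then have "norm (D c d) \<le> N * (2 * (M * (u d - u c)) * \<epsilon>) + (4 * N * \<epsilon> * M) * (u d - u c)"
      by (simp only:) (rule order_trans[OF norm_triangle_ineq add_mono[OF 1 2]])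
    also have "\<dots> = 6 * N * M * \<epsilon> * (u d - u c)" by (simp add: algebra_simps)
    finally show ?thesis .
  qed
  have Dcc: "D c c = 0" for c
    using add[of c c c] by simp
  have bound: "norm (D a b) \<le> 6 * N * M * \<epsilon> * (u b - u a)" if eps: "\<epsilon> \<le> 1 / 2" "0 < \<epsilon>" for \<epsilon>
  proof -
    have "a \<le> a \<and> b \<le> b \<longrightarrow> norm (D a b) \<le> 6 * N * M * \<epsilon> * (u b - u a)"
      using ab
    proof (induction rule: Bolzano[where P = "\<lambda>c d. a \<le> c \<and> d \<le> b \<longrightarrow> norm (D c d) \<le> 6 * N * M * \<epsilon> * (u d - u c)"])
      case (trans c d e)
      show ?case
      proof
        assume ce: "a \<le> c \<and> e \<le> b"
        have "norm (D c e) \<le> norm (D c d) + norm (D d e)" unfolding add[OF trans(3,4)] by (rule norm_triangle_ineq)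
        also have "\<dots> \<le> 6 * N * M * \<epsilon> * (u d - u c) + 6 * N * M * \<epsilon> * (u e - u d)"
          using trans ce by (intro add_mono) auto
        finally show "norm (D c e) \<le> 6 * N * M * \<epsilon> * (u e - u c)" by (simp add: algebra_simps)
      qed
    next
      case (local x)
      obtain \<delta> where d: "\<delta> > 0" "\<And>r. x - \<delta> < r \<Longrightarrow> r \<le> x \<Longrightarrow> h x - h r \<le> \<epsilon>"
        "\<And>r. r < x + \<delta> \<Longrightarrow> x < r \<Longrightarrow> h r - right_lim h x \<le> \<epsilon>"
        using mono_left_continuous_small_oscillation[OF mono_h left_h eps(2), of x] by auto
      have "norm (D c d) \<le> 6 * N * M * \<epsilon> * (u d - u c)"
        if cd: "c \<le> x" "x \<le> d" "d - c < \<delta>" "a \<le> c" "d \<le> b" for c d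
      proof -
        have l: "norm (D c x) \<le> 6 * N * M * \<epsilon> * (u x - u c)"
        proof (cases "c = x")
          case False
          then show ?thesis
            using cd d(2)[of c] mono_right_lim(1)[OF mono_h, of c] eps by (intro small) auto
        qed (simp add: Dcc)
        have r: "norm (D x d) \<le> 6 * N * M * \<epsilon> * (u d - u x)"
        proof (cases "x = d")
          case False
          then show ?thesis using cd d(3)[of d] eps by (intro small) auto
        qed (simp add: Dcc)
        have "norm (D c d) \<le> norm (D c x) + norm (D x d)" unfolding add[OF cd(1,2)] by (rule norm_triangle_ineq)
        also have "\<dots> \<le> 6 * N * M * \<epsilon> * (u x - u c) + 6 * N * M * \<epsilon> * (u d - u x)" using l r by (rule add_mono)
        finally show ?thesis by (simp add: algebra_simps)
      qed
      then show ?case using d(1) by blast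
    qed
    then show ?thesis by simp
  qed
  have "((\<lambda>\<epsilon>. 6 * N * M * \<epsilon> * (u b - u a)) \<longlongrightarrow> 6 * N * M * 0 * (u b - u a)) (at_right 0)"
    by (intro tendsto_intros)
  then have "norm (D a b) \<le> 6 * N * M * 0 * (u b - u a)"
    by (rule tendsto_lowerbound) (use bound in \<open>auto simp: eventually_at_right_field intro!: exI[of _ "1 / 2"]\<close>)
  then show ?thesis by (simp add: D_def)
qed

end

section \<open>The Lyapunov--Perron construction\<close>

text \<open>
  Banach's fixed point theorem for the supremum distance over \<open>S\<close>. The functions are arbitrary
  outside \<open>S\<close>, and completeness is replaced by closedness of \<open>X\<close> under uniform approximation.
\<close>

lemma uniform_contraction_fixed_point:
  fixes T :: "('a \<Rightarrow> 'b::banach) \<Rightarrow> 'a \<Rightarrow> 'b"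
  assumes z0: "z0 \<in> X" and TX: "\<And>z. z \<in> X \<Longrightarrow> T z \<in> X"
    and closed: "\<And>z. (\<And>e. e > 0 \<Longrightarrow> \<exists>w\<in>X. \<forall>t\<in>S. norm (w t - z t) \<le> e) \<Longrightarrow> z \<in> X"
    and contraction: "\<And>z w D t. z \<in> X \<Longrightarrow> w \<in> X \<Longrightarrow> D \<ge> 0 \<Longrightarrow> (\<And>t. t \<in> S \<Longrightarrow> norm (z t - w t) \<le> D) \<Longrightarrow>
      t \<in> S \<Longrightarrow> norm (T z t - T w t) \<le> D / 2"
    and start: "\<And>t. t \<in> S \<Longrightarrow> norm (T z0 t - z0 t) \<le> B" and "B \<ge> 0"
  obtains z where "z \<in> X" "\<And>t. t \<in> S \<Longrightarrow> T z t = z t"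
proof -
  define zn where "zn n = (T ^^ n) z0" for n
  have znX: "zn n \<in> X" for n by (induction n) (auto simp: zn_def z0 TX)
  have Suc: "zn (Suc n) = T (zn n)" for n by (simp add: zn_def)
  have step: "norm (zn (Suc n) t - zn n t) \<le> B / 2 ^ n" if "t \<in> S" for n t
    using that
  proof (induction n arbitrary: t)
    case 0
    then show ?case using start by (simp add: zn_def)
  next
    case (Suc n)
    have "norm (T (zn (Suc n)) t - T (zn n) t) \<le> (B / 2 ^ n) / 2"
      by (rule contraction[OF znX znX _ Suc.IH Suc.prems]) (simp add: \<open>B \<ge> 0\<close>)
    then show ?case by (simp add: \<open>\<And>n. zn (Suc n) = T (zn n)\<close>)
  qed
  have diff: "norm (zn (n + k) t - zn n t) \<le> 2 * B / 2 ^ n * (1 - 1 / 2 ^ k)" if "t \<in> S" for n k t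
  proof (induction k)
    case (Suc k)
    have "norm (zn (n + Suc k) t - zn n t) \<le> norm (zn (Suc (n + k)) t - zn (n + k) t) + norm (zn (n + k) t - zn n t)"
      using norm_triangle_ineq[of "zn (Suc (n + k)) t - zn (n + k) t" "zn (n + k) t - zn n t"] by simp
    also have "\<dots> \<le> B / 2 ^ (n + k) + 2 * B / 2 ^ n * (1 - 1 / 2 ^ k)"
      by (intro add_mono step that Suc.IH)
    also have "\<dots> = 2 * B / 2 ^ n * (1 - 1 / 2 ^ Suc k)" by (simp add: field_simps power_add)
    finally show ?case .
  qed simp
  have diff': "norm (zn m t - zn n t) \<le> 2 * B / 2 ^ n" if "t \<in> S" "n \<le> m" for n m t
  proof -
    have "norm (zn (n + (m - n)) t - zn n t) \<le> 2 * B / 2 ^ n * (1 - 1 / 2 ^ (m - n))" by (rule diff[OF that(1)])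
    also have "\<dots> \<le> 2 * B / 2 ^ n * 1" using \<open>B \<ge> 0\<close> by (intro mult_left_mono) auto
    finally show ?thesis using that(2) by simp
  qed
  have lim0: "(\<lambda>n. 2 * B / 2 ^ n) \<longlonglongrightarrow> 0"
    using tendsto_mult[OF tendsto_const[of "2 * B"] LIMSEQ_power_zero[of "1 / 2 :: real"]] by (simp add: power_divide)
  have "convergent (\<lambda>n. zn n t)" if "t \<in> S" for t
  proof (rule Cauchy_convergent, rule CauchyI)
    fix e :: real assume "e > 0"
    then obtain N where N: "2 * B / 2 ^ N < e / 2"
      using order_tendstoD(2)[OF lim0, of "e / 2"] by (auto simp: eventually_sequentially)
    have "norm (zn m t - zn n t) < e" if "m \<ge> N" "n \<ge> N" for m n
    proof -
      have "norm (zn m t - zn n t) \<le> norm (zn m t - zn N t) + norm (zn n t - zn N t)"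
        using norm_triangle_ineq4[of "zn m t - zn N t" "zn n t - zn N t"] by simp
      with diff'[OF \<open>t \<in> S\<close> that(1)] diff'[OF \<open>t \<in> S\<close> that(2)] N show ?thesis by linarith
    qed
    then show "\<exists>M. \<forall>m\<ge>M. \<forall>n\<ge>M. norm (zn m t - zn n t) < e" by blast
  qed
  then have "\<forall>t. \<exists>l. t \<in> S \<longrightarrow> (\<lambda>n. zn n t) \<longlonglongrightarrow> l" by (auto simp: convergent_def)
  from choice[OF this] obtain z where z0: "\<forall>t. t \<in> S \<longrightarrow> (\<lambda>n. zn n t) \<longlonglongrightarrow> z t" ..
  have z: "(\<lambda>n. zn n t) \<longlonglongrightarrow> z t" if "t \<in> S" for t by (rule mp[OF spec[OF z0] that])
  have near: "norm (zn n t - z t) \<le> 2 * B / 2 ^ n" if "t \<in> S" for n t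
  proof (rule LIMSEQ_le_const2)
    show "(\<lambda>m. norm (zn n t - zn m t)) \<longlonglongrightarrow> norm (zn n t - z t)" by (intro tendsto_intros z that)
    have "norm (zn n t - zn m t) \<le> 2 * B / 2 ^ n" if "m \<ge> n" for m
      using diff'[OF \<open>t \<in> S\<close> that] unfolding norm_minus_commute[of "zn n t"] .
    then show "\<exists>N. \<forall>m\<ge>N. norm (zn n t - zn m t) \<le> 2 * B / 2 ^ n" by iprover
  qed
  have zX: "z \<in> X"
  proof (rule closed)
    fix e :: real assume "e > 0"
    then obtain n where "2 * B / 2 ^ n < e"
      using order_tendstoD(2)[OF lim0, of e] by (auto simp: eventually_sequentially)
    then have "\<forall>t\<in>S. norm (zn n t - z t) \<le> e" using near by (meson less_imp_le order_trans)
    then show "\<exists>w\<in>X. \<forall>t\<in>S. norm (w t - z t) \<le> e" using znX by blast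
  qed
  have "T z t = z t" if t: "t \<in> S" for t
  proof -
    have le: "norm (zn (Suc n) t - T z t) \<le> 2 * B / 2 ^ n / 2" for n
      unfolding Suc by (rule contraction[OF znX zX _ near t]) (simp add: \<open>B \<ge> 0\<close>)
    have "(\<lambda>n. 2 * B / 2 ^ n / 2) \<longlonglongrightarrow> 0" using tendsto_divide[OF lim0 tendsto_const[of 2]] by simp
    then have "(\<lambda>n. zn (Suc n) t - T z t) \<longlonglongrightarrow> 0"
      by (rule Lim_null_comparison[OF always_eventually[OF allI[OF le]]])
    then have "(\<lambda>n. zn (Suc n) t) \<longlonglongrightarrow> T z t" by (rule LIM_zero_cancel)
    moreover have "(\<lambda>n. zn (Suc n) t) \<longlonglongrightarrow> z t" using z[OF t] by (rule LIMSEQ_Suc)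
    ultimately show ?thesis by (rule LIMSEQ_unique)
  qed
  with zX show thesis by (rule that)
qed

text \<open>
  The exponential rate in the unstable estimate forces the homogeneous unstable component of a
  bounded function to vanish; the stable estimate enters through the constant \<open>K\<close>.
\<close>

locale lyapunov_perron = bounded_evolution A C u hA hC FA FC U V
  for A C :: "real \<Rightarrow> 'z::banach \<Rightarrow>\<^sub>L 'z" and u hA hC FA FC U V +
  fixes P :: "real \<Rightarrow> 'z \<Rightarrow>\<^sub>L 'z" and K \<alpha> :: real and H :: "real \<Rightarrow> 'z \<Rightarrow> 'z" and M L :: real
  assumes P_idem: "\<And>t x. P t (P t x) = P t x" and P_U: "\<And>t s x. P t (U t s x) = U t s (P s x)"
    and K: "K > 0" and \<alpha>: "\<alpha> > 0"
    and stable_le: "\<And>t s x. s \<le> t \<Longrightarrow> norm (U t s (P s x)) \<le> K * norm x"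
    and unstable_le: "\<And>t s x. t < s \<Longrightarrow> norm (U t s (x - P s x)) \<le> K * exp (\<alpha> * (t - s)) * norm x"
    and H_integrable: "\<And>x a b. a \<le> b \<Longrightarrow> set_strongly_integrable (stieltjes_measure u) {a..<b} (\<lambda>t. H t x)"
    and H_zero: "\<And>t. H t 0 = 0" and H_le: "\<And>t x. norm (H t x) \<le> M"
    and H_lip: "\<And>t x y. norm (H t x - H t y) \<le> L * norm (x - y)" and L: "L \<ge> 0" and small: "K * L * V \<le> 1 / 2"
begin

lemma M_nonneg: "M \<ge> 0" using H_le[of 0 0] norm_ge_zero order_trans by blast

lemma unstable_le':
  assumes ts: "t < s"
  shows "norm (U t s (x - P s x)) \<le> K * norm x"
proof -
  have "exp (\<alpha> * (t - s)) \<le> 1" using \<alpha> ts by (simp add: mult_nonneg_nonpos)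
  then have "K * exp (\<alpha> * (t - s)) * norm x \<le> K * 1 * norm x" using K by (intro mult_right_mono mult_left_mono) auto
  then show ?thesis using unstable_le[OF ts, of x] by simp
qed

text \<open>
  By the cocycle property and commutation, \<open>U t 0 (P 0 (U 0 r x))\<close> is \<open>U t r (P r x)\<close>. Letting \<open>r\<close>
  decrease to \<open>s\<close> transfers the dichotomy estimate to the right limit.
\<close>

lemma stable_kernel_le: "s < t \<Longrightarrow> norm (U t 0 (P 0 (\<Phi> s x))) \<le> K * norm x"
proof (rule tendsto_upperbound[of "\<lambda>r. norm (U t 0 (P 0 (U 0 r x)))" _ "at_right s"])
  show "((\<lambda>r. norm (U t 0 (P 0 (U 0 r x)))) \<longlongrightarrow> norm (U t 0 (P 0 (\<Phi> s x)))) (at_right s)"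
    by (intro tendsto_intros tendsto_\<Phi>)
  have "norm (U t 0 (P 0 (U 0 r x))) \<le> K * norm x" if "r < t" for r
    using stable_le[of r t x] that by (simp add: P_U U_compose)
  then show "s < t \<Longrightarrow> \<forall>\<^sub>F r in at_right s. norm (U t 0 (P 0 (U 0 r x))) \<le> K * norm x"
    by (auto simp: eventually_at_right_field)
qed simp

lemma unstable_kernel_le: "t \<le> s \<Longrightarrow> norm (U t 0 (\<Phi> s x - P 0 (\<Phi> s x))) \<le> K * norm x"
proof (rule tendsto_upperbound[of "\<lambda>r. norm (U t 0 (U 0 r x - P 0 (U 0 r x)))" _ "at_right s"])
  show "((\<lambda>r. norm (U t 0 (U 0 r x - P 0 (U 0 r x)))) \<longlongrightarrow> norm (U t 0 (\<Phi> s x - P 0 (\<Phi> s x)))) (at_right s)"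
    by (intro tendsto_intros tendsto_\<Phi>)
  have "norm (U t 0 (U 0 r x - P 0 (U 0 r x))) \<le> K * norm x" if "t < r" for r
    using unstable_le'[of t r x] that by (simp add: P_U U_compose blinfun.diff_right)
  then show "t \<le> s \<Longrightarrow> \<forall>\<^sub>F r in at_right s. norm (U t 0 (U 0 r x - P 0 (U 0 r x))) \<le> K * norm x"
    by (auto simp: eventually_at_right_field intro!: exI[of _ "s + 1"])
qed simp

definition admissible :: "real \<Rightarrow> (real \<Rightarrow> 'z) \<Rightarrow> bool" where
  "admissible s g \<longleftrightarrow> (\<forall>b\<ge>s. set_strongly_integrable \<mu> {s..<b} g) \<and> (\<exists>M. \<forall>t. norm (g t) \<le> M)"

lemma admissible_diff:
  assumes "admissible s f" "admissible s g"
  shows "admissible s (\<lambda>t. f t - g t)"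
proof -
  obtain M1 M2 where M: "\<And>t. norm (f t) \<le> M1" "\<And>t. norm (g t) \<le> M2"
    using assms by (auto simp: admissible_def)
  have "norm (f t - g t) \<le> M1 + M2" for t
    by (rule order_trans[OF norm_triangle_ineq4]) (intro add_mono M)
  then show ?thesis using assms set_strong_integral_diff(1) unfolding admissible_def by blast
qed

lemma admissible_\<Phi>:
  assumes "admissible s g" "s \<le> a" "a \<le> b"
  shows "set_strongly_integrable \<mu> {a..<b} (\<lambda>t. \<Phi> t (g t))"
proof -
  obtain M1 where "\<And>t. norm (g t) \<le> M1" using assms by (auto simp: admissible_def)
  moreover have "set_strongly_integrable \<mu> {a..<b} g"
  proof (rule set_strongly_integrable_subset)
    show "set_strongly_integrable \<mu> {s..<b} g" using assms by (simp add: admissible_def)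
  qed (use assms in \<open>auto intro: sets_stieltjes_measure\<close>)
  ultimately show ?thesis by (intro \<Phi>_integrable)
qed

abbreviation unstable_part :: "(real \<Rightarrow> 'z) \<Rightarrow> real \<Rightarrow> 'z" where
  "unstable_part g \<equiv> \<lambda>r. \<Phi> r (g r) - P 0 (\<Phi> r (g r))"

lemma unstable_part_integrable_Ico:
  assumes "admissible s g" "s \<le> a" "a \<le> b"
  shows "set_strongly_integrable \<mu> {a..<b} (unstable_part g)"
    and "set_strong_integral \<mu> {a..<b} (unstable_part g) =
      set_strong_integral \<mu> {a..<b} (\<lambda>r. \<Phi> r (g r)) - P 0 (set_strong_integral \<mu> {a..<b} (\<lambda>r. \<Phi> r (g r)))"
proof -
  note f = admissible_\<Phi>[OF assms]
  note Pf = set_strong_integral_linear[OF blinfun.bounded_linear_right f, of "P 0"]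
  show "set_strongly_integrable \<mu> {a..<b} (unstable_part g)" by (rule set_strong_integral_diff(1)[OF f Pf(1)])
  show "set_strong_integral \<mu> {a..<b} (unstable_part g) =
      set_strong_integral \<mu> {a..<b} (\<lambda>r. \<Phi> r (g r)) - P 0 (set_strong_integral \<mu> {a..<b} (\<lambda>r. \<Phi> r (g r)))"
    using set_strong_integral_diff(2)[OF f Pf(1)] unfolding Pf(2) .
qed

lemma unstable_part_integrable:
  assumes g: "admissible s g" and t: "s \<le> t"
  shows "set_strongly_integrable \<mu> {t..} (unstable_part g)"
proof -
  obtain M1 where M1: "\<And>t. norm (g t) \<le> M1" using g by (auto simp: admissible_def)
  have U: "(\<Union>n. {t..<t + real n}) = {t..}"
  proof (intro equalityI subsetI)
    fix x assume "x \<in> {t..}"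
    moreover obtain n where "x - t < real n" using reals_Archimedean2 by blast
    ultimately show "x \<in> (\<Union>n. {t..<t + real n})" by (auto intro!: exI[of _ n])
  qed auto
  have "set_strongly_integrable \<mu> (\<Union>n. {t..<t + real n}) (unstable_part g)"
  proof (rule set_strongly_integrable_Union[OF finite_measure_\<mu>])
    show "set_strongly_integrable \<mu> {t..<t + real n} (unstable_part g)" for n
      by (rule unstable_part_integrable_Ico(1)[OF g t]) simp
    show "{t..<t + real n} \<in> sets \<mu>" for n by (rule sets_stieltjes_measure) simp
    show "incseq (\<lambda>n. {t..<t + real n})" by (auto simp: incseq_def)
    fix x assume "x \<in> (\<Union>n. {t..<t + real n})"
    then have x: "t \<le> x" by auto
    have "unstable_part g x = U 0 t (U t 0 (unstable_part g x))" by (simp add: U_compose U_ident)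
    also have "norm \<dots> \<le> norm (U 0 t) * norm (U t 0 (unstable_part g x))" by (rule norm_blinfun)
    also have "\<dots> \<le> norm (U 0 t) * (K * M1)"
      using unstable_kernel_le[OF x, of "g x"] M1[of x] K
      by (intro mult_left_mono) (auto intro: order_trans mult_left_mono)
    finally show "norm (unstable_part g x) \<le> norm (U 0 t) * (K * M1)" .
  qed
  then show ?thesis unfolding U .
qed

text \<open>
  The Lyapunov--Perron operator applied to the forcing \<open>g\<close>: its stable part is integrated from \<open>s\<close>,
  its unstable part from infinity.
\<close>

definition perron :: "real \<Rightarrow> (real \<Rightarrow> 'z) \<Rightarrow> real \<Rightarrow> 'z" where
  "perron s g t = U t 0 (P 0 (set_strong_integral \<mu> {s..<t} (\<lambda>r. \<Phi> r (g r))) - set_strong_integral \<mu> {t..} (unstable_part g))"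

lemma perron_diff:
  assumes f: "admissible s f" and g: "admissible s g" and t: "s \<le> t"
  shows "perron s (\<lambda>r. f r - g r) t = perron s f t - perron s g t"
proof -
  have 1: "set_strong_integral \<mu> {s..<t} (\<lambda>r. \<Phi> r (f r - g r)) =
      set_strong_integral \<mu> {s..<t} (\<lambda>r. \<Phi> r (f r)) - set_strong_integral \<mu> {s..<t} (\<lambda>r. \<Phi> r (g r))"
    using set_strong_integral_diff(2)[OF admissible_\<Phi>[OF f _ t] admissible_\<Phi>[OF g _ t]] by (simp add: blinfun.diff_right)
  have "unstable_part (\<lambda>r. f r - g r) = (\<lambda>r. unstable_part f r - unstable_part g r)"
    by (simp add: blinfun.diff_right fun_eq_iff)
  then have 2: "set_strong_integral \<mu> {t..} (unstable_part (\<lambda>r. f r - g r)) =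
      set_strong_integral \<mu> {t..} (unstable_part f) - set_strong_integral \<mu> {t..} (unstable_part g)"
    using set_strong_integral_diff(2)[OF unstable_part_integrable[OF f t] unstable_part_integrable[OF g t]] by simp
  show ?thesis unfolding perron_def 1 2 by (simp add: blinfun.diff_right)
qed

lemma norm_perron_le:
  assumes g: "admissible s g" and t: "s \<le> t" and B: "\<And>r. r \<ge> s \<Longrightarrow> norm (g r) \<le> B" "B \<ge> 0"
  shows "norm (perron s g t) \<le> K * B * V"
proof -
  have sets: "{s..<t} \<in> sets \<mu>" "{t..} \<in> sets \<mu>" by (auto intro: sets_stieltjes_measure)
  have KB: "K * norm (g r) \<le> K * B" if "r \<ge> s" for r using B(1)[OF that] K by (intro mult_left_mono) auto
  note lin = bounded_linear_compose[OF blinfun.bounded_linear_right[of "U t 0"] blinfun.bounded_linear_right[of "P 0"]]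
  note f1 = set_strong_integral_linear[OF lin admissible_\<Phi>[OF g order_refl t]]
  note f2 = set_strong_integral_linear[OF blinfun.bounded_linear_right unstable_part_integrable[OF g t], of "U t 0"]
  have 1: "norm (U t 0 (P 0 (set_strong_integral \<mu> {s..<t} (\<lambda>r. \<Phi> r (g r))))) \<le> K * B * measure \<mu> {s..<t}"
    unfolding f1(2)[symmetric]
  proof (rule norm_set_strong_integral_le[OF f1(1) sets(1)])
    show "norm (U t 0 (P 0 (\<Phi> r (g r)))) \<le> K * B" if "r \<in> {s..<t}" for r
      using stable_kernel_le[of r t "g r"] KB[of r] that by simp
  qed (use K B in \<open>auto simp: emeasure_eq_measure\<close>)
  have 2: "norm (U t 0 (set_strong_integral \<mu> {t..} (unstable_part g))) \<le> K * B * measure \<mu> {t..}"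
    unfolding f2(2)[symmetric]
  proof (rule norm_set_strong_integral_le[OF f2(1) sets(2)])
    show "norm (U t 0 (unstable_part g r)) \<le> K * B" if "r \<in> {t..}" for r
      using unstable_kernel_le[of t r "g r"] KB[of r] that t by simp
  qed (use K B in \<open>auto simp: emeasure_eq_measure\<close>)
  have "measure \<mu> {s..<t} + measure \<mu> {t..} = measure \<mu> ({s..<t} \<union> {t..})"
    using sets by (intro finite_measure_Union[symmetric]) auto
  also have "\<dots> \<le> V" by (rule measure_le_V)
  finally have "K * B * (measure \<mu> {s..<t} + measure \<mu> {t..}) \<le> K * B * V" using K B by (intro mult_left_mono) auto
  then show ?thesis
    unfolding perron_def blinfun.diff_right[of "U t 0"]
    using order_trans[OF norm_triangle_ineq4 add_mono[OF 1 2]] by (simp add: distrib_left)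
qed

lemma perron_increment:
  assumes g: "admissible s g" and ab: "s \<le> a" "a \<le> b"
  shows "U 0 b (perron s g b) - U 0 a (perron s g a) = set_strong_integral \<mu> {a..<b} (\<lambda>r. \<Phi> r (g r))"
proof -
  have sb: "s \<le> b" using ab by simp
  have "{a..<b} \<union> {b..} = {a..}" "{a..<b} \<inter> {b..} = {}" using ab by auto
  then have 1: "set_strong_integral \<mu> {a..} (unstable_part g) =
      set_strong_integral \<mu> {a..<b} (unstable_part g) + set_strong_integral \<mu> {b..} (unstable_part g)"
    using set_strong_integral_Un(2)[OF unstable_part_integrable_Ico(1)[OF g ab] unstable_part_integrable[OF g sb]] by simp
  have 2: "set_strong_integral \<mu> {s..<b} (\<lambda>r. \<Phi> r (g r)) =
      set_strong_integral \<mu> {s..<a} (\<lambda>r. \<Phi> r (g r)) + set_strong_integral \<mu> {a..<b} (\<lambda>r. \<Phi> r (g r))"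
    by (rule set_strong_integral_Ico_split[OF admissible_\<Phi>[OF g order_refl ab(1)] admissible_\<Phi>[OF g ab] ab])
  show ?thesis
    unfolding perron_def 1 2 unstable_part_integrable_Ico(2)[OF g ab]
    by (simp add: U_compose U_ident blinfun.bilinear_simps)
qed

lemma P_perron: "admissible s g \<Longrightarrow> P s (perron s g s) = 0"
proof -
  assume g: "admissible s g"
  have "set_strong_integral \<mu> {s..<s} (\<lambda>r. \<Phi> r (g r)) = 0"
    using set_strong_integral_Ico_split[OF admissible_\<Phi>[OF g order_refl order_refl] admissible_\<Phi>[OF g order_refl order_refl]] by simp
  moreover have "P 0 (set_strong_integral \<mu> {s..} (unstable_part g)) = set_strong_integral \<mu> {s..} (\<lambda>r. P 0 (unstable_part g r))"
    by (rule set_strong_integral_linear(2)[OF blinfun.bounded_linear_right unstable_part_integrable[OF g order_refl], symmetric])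
  moreover have "(\<lambda>r. P 0 (unstable_part g r)) = (\<lambda>r. blinfun_apply (0 :: 'z \<Rightarrow>\<^sub>L 'z) (unstable_part g r))"
    by (simp add: blinfun.diff_right P_idem fun_eq_iff)
  moreover have "set_strong_integral \<mu> {s..} (\<lambda>r. blinfun_apply (0 :: 'z \<Rightarrow>\<^sub>L 'z) (unstable_part g r)) = blinfun_apply (0 :: 'z \<Rightarrow>\<^sub>L 'z) (set_strong_integral \<mu> {s..} (unstable_part g))"
    by (rule set_strong_integral_linear(2)[OF blinfun.bounded_linear_right unstable_part_integrable[OF g order_refl]])
  ultimately show ?thesis
    unfolding perron_def by (simp add: P_U blinfun.diff_right blinfun.minus_right blinfun.zero_right)
qed

text \<open>
  The variation of constants formula for the nonlinear equation, which is all that the construction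
  of the manifold uses of the equation.
\<close>

definition mild_on :: "real \<Rightarrow> (real \<Rightarrow> 'z) \<Rightarrow> bool" where
  "mild_on s z \<longleftrightarrow> (\<forall>b\<ge>s. set_strongly_integrable \<mu> {s..<b} (\<lambda>t. H t (z t))) \<and>
     (\<forall>a b. s \<le> a \<longrightarrow> a \<le> b \<longrightarrow> U 0 b (z b) - U 0 a (z a) = set_strong_integral \<mu> {a..<b} (\<lambda>t. \<Phi> t (H t (z t))))"

definition bounded_mild :: "real \<Rightarrow> (real \<Rightarrow> 'z) \<Rightarrow> bool" where
  "bounded_mild s z \<longleftrightarrow> mild_on s z \<and> (\<exists>B. \<forall>t\<ge>s. norm (z t) \<le> B)"

lemma mild_on_admissible: "mild_on s z \<Longrightarrow> admissible s (\<lambda>t. H t (z t))"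
  using H_le by (auto simp: mild_on_def admissible_def)

text \<open>
  Subtracting the Perron operator from \<open>z\<close> leaves a bounded solution of the linear equation. Pulled
  back to time zero it is a constant \<open>c\<close>, whose unstable component is at most a multiple of
  \<open>exp (- \<alpha> * r)\<close> for all large \<open>r\<close>, hence zero.
\<close>

lemma bounded_mild_eq_perron:
  assumes z: "bounded_mild s z" and t: "s \<le> t"
  shows "z t = U t s (P s (z s)) + perron s (\<lambda>r. H r (z r)) t"
proof -
  have m: "mild_on s z" using z by (simp add: bounded_mild_def)
  obtain B where B: "\<And>t. t \<ge> s \<Longrightarrow> norm (z t) \<le> B" using z by (auto simp: bounded_mild_def)
  let ?g = "\<lambda>r. H r (z r)"
  have g: "admissible s ?g" by (rule mild_on_admissible[OF m])
  define w where "w r = z r - perron s ?g r" for r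
  have const: "U 0 r (w r) = U 0 s (w s)" if "s \<le> r" for r
  proof -
    have "U 0 r (z r) - U 0 s (z s) = U 0 r (perron s ?g r) - U 0 s (perron s ?g s)"
      using m that perron_increment[OF g order_refl that] by (simp add: mild_on_def)
    then show ?thesis by (simp add: w_def blinfun.diff_right algebra_simps)
  qed
  have wB: "norm (w r) \<le> B + K * M * V" if "s \<le> r" for r
    unfolding w_def
    by (rule order_trans[OF norm_triangle_ineq4 add_mono[OF B[OF that] norm_perron_le[OF g that _ M_nonneg]]]) (rule H_le)
  define c where "c = U 0 s (w s)"
  \<comment> \<open>The dichotomy estimate from \<open>r\<close> back to \<open>0\<close> applies to the whole unstable part,
    as \<open>c\<close> is the same for all \<open>r\<close>.\<close>
  have "norm (c - P 0 c) \<le> K * exp (\<alpha> * (0 - r)) * (B + K * M * V)" if "r > max 0 s" for r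
  proof -
    have "c - P 0 c = U 0 r (w r - P r (w r))"
      using const[of r] that by (simp add: c_def blinfun.diff_right flip: P_U)
    also have "norm \<dots> \<le> K * exp (\<alpha> * (0 - r)) * norm (w r)" using that by (intro unstable_le) simp
    also have "\<dots> \<le> K * exp (\<alpha> * (0 - r)) * (B + K * M * V)" using that wB[of r] K by (intro mult_left_mono) auto
    finally show ?thesis .
  qed
  then have "\<forall>\<^sub>F r in at_top. norm (c - P 0 c) \<le> K * exp (\<alpha> * (0 - r)) * (B + K * M * V)"
    unfolding eventually_at_top_dense by (intro exI[of _ "max 0 s"]) blast
  moreover have "((\<lambda>r. K * exp (\<alpha> * (0 - r)) * (B + K * M * V)) \<longlongrightarrow> K * 0 * (B + K * M * V)) at_top"
  proof (intro tendsto_intros filterlim_compose[OF exp_at_bot])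
    have "filterlim (\<lambda>r. \<alpha> * r) at_top at_top"
      using \<alpha> by (rule filterlim_tendsto_pos_mult_at_top[OF tendsto_const _ filterlim_ident])
    then show "filterlim (\<lambda>r. \<alpha> * (0 - r)) at_bot at_top"
      by (simp add: filterlim_uminus_at_bot)
  qed
  ultimately have "norm (c - P 0 c) \<le> K * 0 * (B + K * M * V)"
    by (intro tendsto_lowerbound[of _ _ at_top]) auto
  then have c: "c = P 0 c" by simp
  have "P s (w s) = P s (z s)" by (simp add: w_def blinfun.diff_right P_perron[OF g])
  then have "c = U 0 s (P s (z s))" using c by (simp add: c_def P_U)
  then have "U t 0 (U 0 t (w t)) = U t 0 (U 0 s (P s (z s)))" using const[OF t] by (simp add: c_def)
  then have "w t = U t s (P s (z s))" by (simp add: U_compose U_ident)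
  then show ?thesis by (simp add: w_def algebra_simps)
qed

lemma norm_perron_Lipschitz:
  assumes "admissible s (\<lambda>r. H r (z r))" "admissible s (\<lambda>r. H r (w r))" "s \<le> t"
    and D: "\<And>r. r \<ge> s \<Longrightarrow> norm (z r - w r) \<le> D" "D \<ge> 0"
  shows "norm (perron s (\<lambda>r. H r (z r)) t - perron s (\<lambda>r. H r (w r)) t) \<le> D / 2"
proof -
  have "norm (perron s (\<lambda>r. H r (z r) - H r (w r)) t) \<le> K * (L * D) * V"
  proof (rule norm_perron_le[OF admissible_diff[OF assms(1,2)] assms(3)])
    show "norm (H r (z r) - H r (w r)) \<le> L * D" if "r \<ge> s" for r
      using H_lip[of r "z r" "w r"] mult_left_mono[OF D(1)[OF that] L] by simp
  qed (use L D in simp)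
  also have "\<dots> = (K * L * V) * D" by (simp add: mult_ac)
  also have "\<dots> \<le> 1 / 2 * D" using small D(2) by (rule mult_right_mono)
  finally show ?thesis using perron_diff[OF assms(1-3)] by simp
qed

text \<open>
  In the representation of \<open>bounded_mild_eq_perron\<close> the perturbation contributes at most half of the
  supremum of the difference. So the difference is at most twice its linear part, and half of that
  bounds its unstable component at \<open>s\<close>.
\<close>

lemma bounded_mild_Lipschitz:
  assumes z: "bounded_mild s z" and w: "bounded_mild s w"
  defines "\<delta> \<equiv> norm (P s (z s) - P s (w s))"
  shows "s \<le> t \<Longrightarrow> norm (z t - w t) \<le> 2 * (K * \<delta>)"
    and "norm ((z s - P s (z s)) - (w s - P s (w s))) \<le> K * \<delta>"
proof -
  have adm: "admissible s (\<lambda>r. H r (z r))" "admissible s (\<lambda>r. H r (w r))"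
    using z w by (auto simp: bounded_mild_def intro: mild_on_admissible)
  obtain B1 B2 where B: "\<And>t. t \<ge> s \<Longrightarrow> norm (z t) \<le> B1" "\<And>t. t \<ge> s \<Longrightarrow> norm (w t) \<le> B2"
    using z w by (auto simp: bounded_mild_def)
  have bound: "norm (z t - w t) \<le> 2 * (K * \<delta>)" if "t \<in> {s..}" for t
  proof (rule norm_le_twice_if_halving[of "{s..}" "\<lambda>t. z t - w t" "B1 + B2", OF _ _ that])
    show "norm (z t - w t) \<le> B1 + B2" if "t \<in> {s..}" for t
      using that by (intro order_trans[OF norm_triangle_ineq4] add_mono B) auto
    fix D r assume D: "D \<ge> 0" "\<And>r. r \<in> {s..} \<Longrightarrow> norm (z r - w r) \<le> D" and r: "r \<in> {s..}"
    have "z r - w r = U r s (P s (P s (z s) - P s (w s)))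
      + (perron s (\<lambda>r. H r (z r)) r - perron s (\<lambda>r. H r (w r)) r)"
      using bounded_mild_eq_perron[OF z, of r] bounded_mild_eq_perron[OF w, of r] r
      by (simp add: blinfun.diff_right P_idem)
    also have "norm \<dots> \<le> K * \<delta> + D / 2"
      unfolding \<delta>_def using r D
      by (intro order_trans[OF norm_triangle_ineq] add_mono stable_le norm_perron_Lipschitz adm) auto
    finally show "norm (z r - w r) \<le> D / 2 + K * \<delta>" by simp
  qed
  then show "s \<le> t \<Longrightarrow> norm (z t - w t) \<le> 2 * (K * \<delta>)" by simp
  have "(z s - P s (z s)) - (w s - P s (w s)) = perron s (\<lambda>r. H r (z r)) s - perron s (\<lambda>r. H r (w r)) s"
    using bounded_mild_eq_perron[OF z order_refl] bounded_mild_eq_perron[OF w order_refl]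
    by (simp add: U_ident algebra_simps)
  also have "norm \<dots> \<le> 2 * (K * \<delta>) / 2"
    using bound K by (intro norm_perron_Lipschitz adm) (auto simp: \<delta>_def)
  finally show "norm ((z s - P s (z s)) - (w s - P s (w s))) \<le> K * \<delta>" by simp
qed

lemma H_compose_admissible:
  assumes "\<And>b. s \<le> b \<Longrightarrow> set_strongly_integrable \<mu> {s..<b} z"
  shows "admissible s (\<lambda>t. H t (z t))"
  unfolding admissible_def
proof (intro conjI allI impI exI[of _ M] H_le)
  fix b assume b: "s \<le> b"
  have "strongly_integrable \<mu> (\<lambda>t. indicat_real {s..<b} t *\<^sub>R H t (indicat_real {s..<b} t *\<^sub>R z t))"
  proof (rule strongly_integrable_Lipschitz_compose[where H = "\<lambda>t x. indicat_real {s..<b} t *\<^sub>R H t x" and L = L])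
    show "strongly_integrable \<mu> (\<lambda>t. indicat_real {s..<b} t *\<^sub>R z t)"
      using assms[OF b] by (simp add: set_strongly_integrable_def)
    show "strongly_integrable \<mu> (\<lambda>t. indicat_real {s..<b} t *\<^sub>R H t x)" for x
      using H_integrable[OF b] by (simp add: set_strongly_integrable_def)
    show "norm (indicat_real {s..<b} t *\<^sub>R H t x - indicat_real {s..<b} t *\<^sub>R H t y) \<le> L * norm (x - y)" for t x y
      using H_lip[of t x y] L by (auto simp: indicator_def)
  qed
  moreover have "(\<lambda>t. indicat_real {s..<b} t *\<^sub>R H t (indicat_real {s..<b} t *\<^sub>R z t)) = (\<lambda>t. indicat_real {s..<b} t *\<^sub>R H t (z t))"
    by (auto simp: indicator_def fun_eq_iff)
  ultimately show "set_strongly_integrable \<mu> {s..<b} (\<lambda>t. H t (z t))" by (simp add: set_strongly_integrable_def)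
qed

lemma norm_\<Phi>_integral_le:
  assumes g: "admissible s g" and ab: "s \<le> a" "a \<le> b"
    and N: "\<And>t. t \<in> {a..b} \<Longrightarrow> norm (U 0 t) \<le> N" "\<And>t. t \<in> {a..b} \<Longrightarrow> norm (U t 0) \<le> N"
    and B: "\<And>t. t \<in> {a..<b} \<Longrightarrow> norm (g t) \<le> B" "B \<ge> 0"
  shows "norm (set_strong_integral \<mu> {a..<b} (\<lambda>t. \<Phi> t (g t))) \<le> N * B * (u b - u a)"
proof (rule norm_set_strong_integral_Ico_le[OF admissible_\<Phi>[OF g ab] _ _ ab(2)])
  have N0: "N \<ge> 0" using N(1)[of a] ab order_trans[OF norm_ge_zero] by auto
  then show "N * B \<ge> 0" using B by simp
  fix x assume x: "x \<in> {a..<b}"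
  have "norm (\<Phi> x) \<le> N" by (rule \<Phi>_increment_le(3)[OF N]) (use x in auto)
  then have "norm (\<Phi> x) * norm (g x) \<le> N * B" using B(1)[OF x] N0 by (intro mult_mono) auto
  then show "norm (\<Phi> x (g x)) \<le> N * B" by (rule order_trans[OF norm_blinfun])
qed

text \<open>
  The iterates of the fixed point argument must remain integrable. Their increments on a compact
  interval are dominated by those of a combination of \<open>u\<close> and \<open>h\<close>.
\<close>

lemma mild_integrable:
  assumes g: "admissible s g" and B: "\<And>t. t \<ge> s \<Longrightarrow> norm (z t) \<le> B"
    and eq: "\<And>a b. s \<le> a \<Longrightarrow> a \<le> b \<Longrightarrow> U 0 b (z b) - U 0 a (z a) = set_strong_integral \<mu> {a..<b} (\<lambda>t. \<Phi> t (g t))"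
    and b: "s \<le> b"
  shows "set_strongly_integrable \<mu> {s..<b} z"
proof -
  obtain M1 where M1: "\<And>t. norm (g t) \<le> M1" using g by (auto simp: admissible_def)
  have M1': "M1 \<ge> 0" using M1[of 0] norm_ge_zero[of "g 0"] by linarith
  have B': "B \<ge> 0" by (rule order_trans[OF norm_ge_zero B[OF order_refl]])
  obtain N where N: "N > 0" "\<And>t. t \<in> {s..b} \<Longrightarrow> norm (U 0 t) \<le> N" "\<And>t. t \<in> {s..b} \<Longrightarrow> norm (U t 0) \<le> N"
    using U_bounded_on_compact[OF b] by auto
  \<comment> \<open>The two terms come from the increment of \<open>U 0 t (z t)\<close> and from that of
    \<open>U t 0\<close>.\<close>
  define v where "v t = N * (N * M1) * u t + 4 * N * (N * B) * h t" for t
  show ?thesis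
  proof (rule set_strongly_integrable_dominated)
    show "mono v"
      unfolding v_def using N(1) M1' B' mono_u mono_h by (auto simp: mono_def intro!: add_mono mult_left_mono)
    fix r t assume rt: "s \<le> r" "r \<le> t" "t < b"
    have y: "norm (U 0 t (z t) - U 0 r (z r)) \<le> (N * M1) * (u t - u r)"
      unfolding eq[OF rt(1,2)]
      by (rule norm_\<Phi>_integral_le[OF g rt(1,2)]) (use N M1 M1' rt in auto)
    have "z t - z r = U t 0 (U 0 t (z t) - U 0 r (z r)) + (U t 0 - U r 0) (U 0 r (z r))"
      by (simp add: blinfun.bilinear_simps U_compose U_ident)
    also have "norm \<dots> \<le> N * ((N * M1) * (u t - u r)) + (4 * N * (h t - h r)) * (N * B)"
    proof (rule order_trans[OF norm_triangle_ineq], rule add_mono)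
      have "norm (U t 0) * norm (U 0 t (z t) - U 0 r (z r)) \<le> N * ((N * M1) * (u t - u r))"
        using N(1) N(3)[of t] y rt by (intro mult_mono) auto
      then show "norm (U t 0 (U 0 t (z t) - U 0 r (z r))) \<le> N * ((N * M1) * (u t - u r))"
        by (rule order_trans[OF norm_blinfun])
      have "norm (U 0 r) * norm (z r) \<le> N * B" using N(1) N(2)[of r] B[of r] rt by (intro mult_mono) auto
      then have zr: "norm (U 0 r (z r)) \<le> N * B" by (rule order_trans[OF norm_blinfun])
      have Ur: "norm (U t 0 - U r 0) \<le> 4 * N * (h t - h r)"
        by (rule U_increment_le(2)[OF N(2,3)]) (use rt in auto)
      have "norm (U t 0 - U r 0) * norm (U 0 r (z r)) \<le> (4 * N * (h t - h r)) * (N * B)"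
        using N(1) monoD[OF mono_h rt(2)] by (intro mult_mono Ur zr) auto
      then show "norm ((U t 0 - U r 0) (U 0 r (z r))) \<le> (4 * N * (h t - h r)) * (N * B)"
        by (rule order_trans[OF norm_blinfun])
    qed
    also have "\<dots> = v t - v r" by (simp add: v_def algebra_simps)
    finally show "norm (z t - z r) \<le> v t - v r" .
  qed
qed

text \<open>
  The fixed point of the Lyapunov--Perron operator, sought among functions that are integrable on
  bounded intervals; boundedness on \<open>{s..}\<close> comes with the operator, whose values are bounded.
\<close>

lemma bounded_mild_exists:
  assumes \<zeta>: "P s \<zeta> = \<zeta>"
  obtains z where "bounded_mild s z" "P s (z s) = \<zeta>"
proof -
  define X where "X = {z :: real \<Rightarrow> 'z. \<forall>b\<ge>s. set_strongly_integrable \<mu> {s..<b} z}"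
  define T where "T z t = U t s \<zeta> + perron s (\<lambda>r. H r (z r)) t" for z t
  have adm: "admissible s (\<lambda>t. H t (z t))" if "z \<in> X" for z
    using that by (intro H_compose_admissible) (simp add: X_def)
  have T_le: "norm (T z t) \<le> K * norm \<zeta> + K * M * V" if "z \<in> X" "s \<le> t" for z t
    unfolding T_def
  proof (intro order_trans[OF norm_triangle_ineq] add_mono)
    show "norm (U t s \<zeta>) \<le> K * norm \<zeta>" using stable_le[OF that(2), of \<zeta>] \<zeta> by simp
    show "norm (perron s (\<lambda>r. H r (z r)) t) \<le> K * M * V"
      by (rule norm_perron_le[OF adm[OF that(1)] that(2) H_le M_nonneg])
  qed
  have T_eq: "U 0 b (T z b) - U 0 a (T z a) = set_strong_integral \<mu> {a..<b} (\<lambda>t. \<Phi> t (H t (z t)))"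
    if "z \<in> X" "s \<le> a" "a \<le> b" for z a b
    using perron_increment[OF adm[OF that(1)] that(2,3)] by (simp add: T_def blinfun.add_right U_compose)
  have TX: "T z \<in> X" if "z \<in> X" for z
    unfolding X_def using mild_integrable[OF adm[OF that] T_le[OF that] T_eq[OF that]] by simp
  obtain z where z: "z \<in> X" "\<And>t. t \<in> {s..} \<Longrightarrow> T z t = z t"
  proof (rule uniform_contraction_fixed_point[of "\<lambda>_. 0" X T "{s..}" "K * norm \<zeta> + K * M * V"])
    show zero: "(\<lambda>_. 0) \<in> X" by (simp add: X_def set_strongly_integrable_def strongly_integrable_zero)
    show "T z \<in> X" if "z \<in> X" for z by (rule TX[OF that])
    show "norm (T (\<lambda>_. 0) t - 0) \<le> K * norm \<zeta> + K * M * V" if "t \<in> {s..}" for t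
      using T_le[OF zero, of t] that by simp
    show "K * norm \<zeta> + K * M * V \<ge> 0" using K M_nonneg V_nonneg by simp
    show "norm (T z t - T w t) \<le> D / 2"
      if "z \<in> X" "w \<in> X" "D \<ge> 0" "\<And>t. t \<in> {s..} \<Longrightarrow> norm (z t - w t) \<le> D" "t \<in> {s..}" for z w D t
      using norm_perron_Lipschitz[OF adm[OF that(1)] adm[OF that(2)], of t D] that(3,4,5) by (simp add: T_def)
    fix z assume near: "\<And>e. e > 0 \<Longrightarrow> \<exists>w\<in>X. \<forall>t\<in>{s..}. norm (w t - z t) \<le> e"
    show "z \<in> X"
      unfolding X_def mem_Collect_eq set_strongly_integrable_def
    proof (intro allI impI strongly_integrable_closed)
      fix b e :: real assume b: "s \<le> b" and e: "e > 0"
      define e' where "e' = e / (V + 1)"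
      have e': "e' > 0" using e V_nonneg by (simp add: e'_def)
      obtain w where w: "w \<in> X" "\<And>t. t \<ge> s \<Longrightarrow> norm (w t - z t) \<le> e'" using near[OF e'] by auto
      have "e' * measure \<mu> UNIV \<le> e' * (V + 1)" using e' measure_le_V[of UNIV] by (intro mult_left_mono) auto
      also have "\<dots> = e" using V_nonneg by (simp add: e'_def)
      finally have "L1_close \<mu> (\<lambda>x. indicat_real {s..<b} x *\<^sub>R z x) (\<lambda>x. indicat_real {s..<b} x *\<^sub>R w x) e"
        using w(2) e' by (intro L1_close_uniform[OF finite_measure_\<mu>, of e']) (auto simp: indicator_def norm_minus_commute)
      moreover have "strongly_integrable \<mu> (\<lambda>x. indicat_real {s..<b} x *\<^sub>R w x)"
        using w(1) b by (simp add: X_def set_strongly_integrable_def)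
      ultimately show "\<exists>g. strongly_integrable \<mu> g \<and> L1_close \<mu> (\<lambda>x. indicat_real {s..<b} x *\<^sub>R z x) g e" by blast
    qed
  qed (rule that; simp)
  show thesis
  proof (rule that)
    have "mild_on s z"
      unfolding mild_on_def
      using adm[OF z(1)] T_eq[OF z(1)] z(2) by (auto simp: admissible_def)
    moreover have "\<forall>t\<ge>s. norm (z t) \<le> K * norm \<zeta> + K * M * V" using T_le[OF z(1)] z(2) by auto
    ultimately show "bounded_mild s z" unfolding bounded_mild_def by blast
    show "P s (z s) = \<zeta>"
      using z(2)[of s] P_perron[OF adm[OF z(1)]] by (simp add: T_def U_ident blinfun.add_right \<zeta> flip: z(2)[of s])
  qed
qed

end

section \<open>The invariant graph\<close>

context lyapunov_perron
begin

lemma mild_on_subset: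
  assumes "mild_on s z" "s \<le> t"
  shows "mild_on t z"
  unfolding mild_on_def
proof (intro conjI allI impI)
  fix b assume "t \<le> b"
  show "set_strongly_integrable \<mu> {t..<b} (\<lambda>t. H t (z t))"
  proof (rule set_strongly_integrable_subset)
    show "set_strongly_integrable \<mu> {s..<b} (\<lambda>t. H t (z t))" using assms \<open>t \<le> b\<close> by (simp add: mild_on_def)
  qed (use assms in \<open>auto intro: sets_stieltjes_measure\<close>)
qed (use assms in \<open>simp add: mild_on_def\<close>)

lemma mild_on_bounded:
  assumes z: "mild_on s z" and b: "s \<le> b"
  obtains B where "\<And>t. t \<in> {s..b} \<Longrightarrow> norm (z t) \<le> B"
proof -
  obtain N where N: "N > 0" "\<And>t. t \<in> {s..b} \<Longrightarrow> norm (U 0 t) \<le> N" "\<And>t. t \<in> {s..b} \<Longrightarrow> norm (U t 0) \<le> N"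
    using U_bounded_on_compact[OF b] by auto
  have "norm (z t) \<le> N * (norm (U 0 s (z s)) + N * M * V)" if t: "t \<in> {s..b}" for t
  proof -
    let ?J = "set_strong_integral \<mu> {s..<t} (\<lambda>r. \<Phi> r (H r (z r)))"
    have st: "s \<le> t" using t by simp
    have "norm ?J \<le> N * M * (u t - u s)"
      by (rule norm_\<Phi>_integral_le[OF mild_on_admissible[OF z] order_refl st])
        (use N t H_le M_nonneg in auto)
    also have "\<dots> \<le> N * M * V" using N(1) M_nonneg V[OF st] by (intro mult_left_mono) auto
    finally have J: "norm ?J \<le> N * M * V" .
    have "U 0 t (z t) - U 0 s (z s) = ?J" using z st by (simp add: mild_on_def)
    then have "U 0 t (z t) = U 0 s (z s) + ?J" by (simp add: algebra_simps)
    then have "z t = U t 0 (U 0 s (z s) + ?J)" by (metis U_compose U_ident id_blinfun.rep_eq)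
    also have "norm \<dots> \<le> norm (U t 0) * norm (U 0 s (z s) + ?J)" by (rule norm_blinfun)
    also have "\<dots> \<le> N * (norm (U 0 s (z s)) + N * M * V)"
      using N(1) N(3)[OF t] J by (intro mult_mono norm_triangle_le add_left_mono) auto
    finally show ?thesis .
  qed
  then show thesis by (rule that)
qed

text \<open>
  Forward uniqueness by bisection along \<open>u\<close>. If two functions agree at \<open>c\<close>, then the integrand of
  their difference vanishes at \<open>c\<close>, so the atom of \<open>du\<close> at \<open>c\<close> does not count, and on an interval
  where the rest of \<open>du\<close> has mass at most \<open>\<epsilon>\<close> the difference is at most half of its
  supremum.
\<close>

lemma mild_on_unique:
  assumes z: "mild_on s z" and w: "mild_on s w" and b: "s \<le> b" and eq: "z s = w s"
  shows "z b = w b"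
proof -
  obtain N where N: "N > 0" "\<And>t. t \<in> {s..b} \<Longrightarrow> norm (U 0 t) \<le> N" "\<And>t. t \<in> {s..b} \<Longrightarrow> norm (U t 0) \<le> N"
    using U_bounded_on_compact[OF b] by auto
  obtain B1 where B1: "\<And>t. t \<in> {s..b} \<Longrightarrow> norm (z t) \<le> B1" by (rule mild_on_bounded[OF z b], rule that; iprover)
  obtain B2 where B2: "\<And>t. t \<in> {s..b} \<Longrightarrow> norm (w t) \<le> B2" by (rule mild_on_bounded[OF w b], rule that; iprover)
  define \<epsilon> where "\<epsilon> = 1 / (2 * (N * N * L + 1))"
  have pos: "N * N * L + 1 > 0" using N(1) L by (simp add: add_nonneg_pos)
  then have \<epsilon>: "\<epsilon> > 0" by (simp add: \<epsilon>_def)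
  have \<epsilon>': "N * N * L * \<epsilon> \<le> 1 / 2"
    using pos by (simp add: \<epsilon>_def field_simps)
  note adm = mild_on_admissible[OF z] mild_on_admissible[OF w]
  define g where "g t = H t (z t) - H t (w t)" for t
  have g: "admissible s g" unfolding g_def by (rule admissible_diff[OF adm])
  have diff: "U 0 r (z r - w r) = set_strong_integral \<mu> {c..<r} (\<lambda>t. \<Phi> t (g t))"
    if c: "s \<le> c" "c \<le> r" "z c = w c" for c r
  proof -
    have "set_strong_integral \<mu> {c..<r} (\<lambda>t. \<Phi> t (g t)) =
        set_strong_integral \<mu> {c..<r} (\<lambda>t. \<Phi> t (H t (z t))) - set_strong_integral \<mu> {c..<r} (\<lambda>t. \<Phi> t (H t (w t)))"
      unfolding g_def blinfun.diff_right
      by (rule set_strong_integral_diff(2)[OF admissible_\<Phi>[OF adm(1) c(1,2)] admissible_\<Phi>[OF adm(2) c(1,2)]])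
    also have "set_strong_integral \<mu> {c..<r} (\<lambda>t. \<Phi> t (H t (z t))) = U 0 r (z r) - U 0 c (z c)"
      using z c(1,2) by (simp add: mild_on_def)
    also have "set_strong_integral \<mu> {c..<r} (\<lambda>t. \<Phi> t (H t (w t))) = U 0 r (w r) - U 0 c (w c)"
      using w c(1,2) by (simp add: mild_on_def)
    also have "U 0 r (z r) - U 0 c (z c) - (U 0 r (w r) - U 0 c (w c)) = U 0 r (z r - w r)" using c(3) by (simp add: blinfun.diff_right)
    finally show ?thesis by simp
  qed
  have step: "z r = w r" if c: "s \<le> c" "z c = w c" and d: "d \<le> b" "u d - right_lim u c \<le> \<epsilon>" and r: "r \<in> {c..d}" for c d r
  proof -
    have "norm (z r - w r) \<le> 2 * 0"
    proof (rule norm_le_twice_if_halving[of "{c..d}" "\<lambda>t. z t - w t" "B1 + B2", OF _ _ r])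
      show "norm (z t - w t) \<le> B1 + B2" if "t \<in> {c..d}" for t
        using that c d by (intro order_trans[OF norm_triangle_ineq4] add_mono B1 B2) auto
      fix D t assume D: "D \<ge> 0" "\<And>t. t \<in> {c..d} \<Longrightarrow> norm (z t - w t) \<le> D" and t: "t \<in> {c..d}"
      show "norm (z t - w t) \<le> D / 2 + 0"
      proof (cases "c = t")
        case True
        then show ?thesis using c D by simp
      next
        case False
        then have ct: "c < t" using t by simp
        have gc: "g c = 0" by (simp add: g_def c)
        \<comment> \<open>The integrand vanishes at \<open>c\<close>, which removes the atom at the left end
          point.\<close>
        have cong: "indicat_real {c..<t} x *\<^sub>R \<Phi> x (g x) = indicat_real {c<..<t} x *\<^sub>R \<Phi> x (g x)" for x
          using gc by (cases "x = c") (auto simp: indicator_def blinfun.zero_right)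
        have int: "set_strongly_integrable \<mu> {c<..<t} (\<lambda>t. \<Phi> t (g t))"
          using admissible_\<Phi>[OF g c(1), of t] ct set_strong_integral_cong(1)[OF cong] by simp
        have "norm (set_strong_integral \<mu> {c<..<t} (\<lambda>t. \<Phi> t (g t))) \<le> N * (L * D) * measure \<mu> {c<..<t}"
        proof (rule norm_set_strong_integral_le[OF int])
          show "{c<..<t} \<in> sets \<mu>" by (rule sets_stieltjes_measure) simp
          fix x assume x: "x \<in> {c<..<t}"
          have "norm (\<Phi> x) \<le> N" by (rule \<Phi>_increment_le(3)[OF N(2,3)]) (use x c d t in auto)
          moreover have "norm (g x) \<le> L * D"
            unfolding g_def by (rule order_trans[OF H_lip mult_left_mono[OF D(2) L]]) (use x t in auto)
          ultimately have "norm (\<Phi> x) * norm (g x) \<le> N * (L * D)" using N(1) by (intro mult_mono) auto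
          then show "norm (\<Phi> x (g x)) \<le> N * (L * D)" by (rule order_trans[OF norm_blinfun])
        qed (use N(1) L D in \<open>auto simp: emeasure_eq_measure\<close>)
        also have "measure \<mu> {c<..<t} \<le> \<epsilon>"
          using measure_Ioo_le[OF ct] monoD[OF mono_u, of t d] t d by simp
        then have "N * (L * D) * measure \<mu> {c<..<t} \<le> N * (L * D) * \<epsilon>" using N(1) L D by (intro mult_left_mono) auto
        finally have J: "norm (U 0 t (z t - w t)) \<le> N * (L * D) * \<epsilon>"
          unfolding diff[OF c(1) less_imp_le[OF ct] c(2)] set_strong_integral_cong(2)[OF cong] .
        have "z t - w t = U t 0 (U 0 t (z t - w t))" by (simp add: U_compose U_ident)
        also have "norm \<dots> \<le> norm (U t 0) * norm (U 0 t (z t - w t))" by (rule norm_blinfun)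
        also have "\<dots> \<le> N * (N * (L * D) * \<epsilon>)"
          using J N(1) N(3)[of t] t c d by (intro mult_mono) auto
        also have "\<dots> = (N * N * L * \<epsilon>) * D" by (simp add: mult_ac)
        also have "\<dots> \<le> 1 / 2 * D" using \<epsilon>' D(1) by (rule mult_right_mono)
        finally show ?thesis by simp
      qed
    qed
    then show ?thesis by simp
  qed
  have "s \<le> s \<and> b \<le> b \<and> z s = w s \<longrightarrow> (\<forall>r\<in>{s..b}. z r = w r)"
    using b
  proof (induction rule: Bolzano[where P = "\<lambda>c d. s \<le> c \<and> d \<le> b \<and> z c = w c \<longrightarrow> (\<forall>r\<in>{c..d}. z r = w r)"])
    case (trans c d e)
    show ?case
    proof (intro impI ballI)
      fix r assume a: "s \<le> c \<and> e \<le> b \<and> z c = w c" and r: "r \<in> {c..e}"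
      have cd: "\<forall>r\<in>{c..d}. z r = w r" using trans a by simp
      then have "z d = w d" using trans(3) by simp
      then have "\<forall>r\<in>{d..e}. z r = w r" using trans a by simp
      with cd r show "z r = w r" by (cases "r \<le> d") auto
    qed
  next
    case (local x)
    obtain d where d: "d > 0" "\<And>r. x - d < r \<Longrightarrow> r \<le> x \<Longrightarrow> u x - u r \<le> \<epsilon>"
      "\<And>r. r < x + d \<Longrightarrow> x < r \<Longrightarrow> u r - right_lim u x \<le> \<epsilon>"
      using mono_left_continuous_small_oscillation[OF mono_u left_u \<epsilon>, of x] by auto
    have near: "z r = w r" if ab: "c \<le> x" "x \<le> e" "e - c < d" "s \<le> c" "e \<le> b" "z c = w c" and r: "r \<in> {c..e}" for c e r
    proof -
      have left: "z t = w t" if "t \<in> {c..x}" for t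
      proof (rule step[OF ab(4,6) _ _ that])
        show "u x - right_lim u c \<le> \<epsilon>" using d(2)[of c] mono_right_lim(1)[OF mono_u, of c] ab by simp
      qed (use ab in simp)
      show ?thesis
      proof (cases "r \<le> x")
        case False
        then have xe: "x < e" using r by simp
        have "z x = w x" using left[of x] ab by simp
        show ?thesis
        proof (rule step[OF _ \<open>z x = w x\<close> ab(5)])
          show "s \<le> x" using ab by simp
          show "u e - right_lim u x \<le> \<epsilon>" using d(3)[of e] ab xe by simp
          show "r \<in> {x..e}" using r False by simp
        qed
      qed (use left r in simp)
    qed
    have "\<forall>c e. c \<le> x \<and> x \<le> e \<and> e - c < d \<longrightarrow> s \<le> c \<and> e \<le> b \<and> z c = w c \<longrightarrow> (\<forall>r\<in>{c..e}. z r = w r)"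
      by (intro allI impI ballI, elim conjE) (rule near; assumption)
    with d(1) show ?case by iprover
  qed
  then show ?thesis using eq b by simp
qed

lemma mild_on_paste:
  assumes z: "mild_on t z" and w: "mild_on s w" and ts: "t \<le> s" and eq: "z s = w s"
  shows "mild_on t (\<lambda>r. if r \<le> s then z r else w r)"
proof -
  define v where "v r = (if r \<le> s then z r else w r)" for r
  have vz: "v r = z r" if "r \<le> s" for r using that by (simp add: v_def)
  have vw: "v r = w r" if "s \<le> r" for r using that eq by (cases "r = s") (auto simp: v_def)
  have congz: "indicat_real {a..<b} r *\<^sub>R F r (v r) = indicat_real {a..<b} r *\<^sub>R F r (z r)"
    if "b \<le> s" for a b r and F :: "real \<Rightarrow> 'z \<Rightarrow> 'z" using that vz[of r] by (auto simp: indicator_def)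
  have congw: "indicat_real {a..<b} r *\<^sub>R F r (v r) = indicat_real {a..<b} r *\<^sub>R F r (w r)"
    if "s \<le> a" for a b r and F :: "real \<Rightarrow> 'z \<Rightarrow> 'z" using that vw[of r] by (auto simp: indicator_def)
  have intz: "set_strongly_integrable \<mu> {t..<b} (\<lambda>r. H r (v r))" if "t \<le> b" "b \<le> s" for b
    using z that set_strong_integral_cong(1)[OF congz[OF that(2), of t _ H], of \<mu>] by (simp add: mild_on_def)
  have intw: "set_strongly_integrable \<mu> {s..<b} (\<lambda>r. H r (v r))" if "s \<le> b" for b
    using w that set_strong_integral_cong(1)[OF congw[OF order_refl, of b _ H], of \<mu>] by (simp add: mild_on_def)
  have int: "set_strongly_integrable \<mu> {t..<b} (\<lambda>r. H r (v r))" if "t \<le> b" for b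
  proof (cases "b \<le> s")
    case False
    then have "{t..<s} \<union> {s..<b} = {t..<b}" "{t..<s} \<inter> {s..<b} = {}" using ts by auto
    then show ?thesis using set_strong_integral_Un(1)[OF intz[OF ts order_refl] intw[of b]] False by simp
  qed (use intz that in simp)
  have adm: "admissible t (\<lambda>r. H r (v r))" using int H_le by (auto simp: admissible_def)
  let ?J = "\<lambda>a b. set_strong_integral \<mu> {a..<b} (\<lambda>r. \<Phi> r (H r (v r)))"
  have eqz: "U 0 b (v b) - U 0 a (v a) = ?J a b" if "t \<le> a" "a \<le> b" "b \<le> s" for a b
    using z that set_strong_integral_cong(2)[OF congz[OF that(3), of a _ "\<lambda>r x. \<Phi> r (H r x)"], of \<mu>] by (simp add: mild_on_def vz)
  have eqw: "U 0 b (v b) - U 0 a (v a) = ?J a b" if "s \<le> a" "a \<le> b" for a b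
    using w that set_strong_integral_cong(2)[OF congw[OF that(1), of b _ "\<lambda>r x. \<Phi> r (H r x)"], of \<mu>] by (simp add: mild_on_def vw)
  have "U 0 b (v b) - U 0 a (v a) = ?J a b" if ab: "t \<le> a" "a \<le> b" for a b
  proof -
    consider "b \<le> s" | "s \<le> a" | "a \<le> s" "s \<le> b" by linarith
    then show ?thesis
    proof cases
      case 3
      have "?J a b = ?J a s + ?J s b"
        using 3 ab ts by (intro set_strong_integral_Ico_split admissible_\<Phi>[OF adm]) auto
      also have "\<dots> = (U 0 s (v s) - U 0 a (v a)) + (U 0 b (v b) - U 0 s (v s))"
        unfolding eqz[OF ab(1) 3(1) order_refl] eqw[OF order_refl 3(2)] ..
      finally show ?thesis by simp
    qed (use eqz eqw ab in auto)
  qed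
  with int have "mild_on t v" by (simp add: mild_on_def)
  then show ?thesis unfolding v_def .
qed

lemma bounded_mild_zero: "bounded_mild s (\<lambda>_. 0)"
proof -
  have "set_strongly_integrable \<mu> E (\<lambda>t. 0 :: 'z)" "set_strong_integral \<mu> E (\<lambda>t. 0 :: 'z) = 0" for E
  proof -
    show i: "set_strongly_integrable \<mu> E (\<lambda>t. 0 :: 'z)"
      by (simp add: set_strongly_integrable_def strongly_integrable_zero)
    show "set_strong_integral \<mu> E (\<lambda>t. 0 :: 'z) = 0" using set_strong_integral_diff(2)[OF i i] by simp
  qed
  then show ?thesis by (auto simp: bounded_mild_def mild_on_def H_zero blinfun.zero_right)
qed

text \<open>
  The choice of \<open>z\<close> does not matter, by \<open>bounded_mild_Lipschitz\<close>.
\<close>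

definition graph_map :: "real \<Rightarrow> 'z \<Rightarrow> 'z" where
  "graph_map s \<zeta> = (let z = (SOME z. bounded_mild s z \<and> P s (z s) = \<zeta>) in z s - P s (z s))"

lemma stable_space_iff: "\<zeta> \<in> stable_space P s \<longleftrightarrow> P s \<zeta> = \<zeta>"
  unfolding stable_space_def by (metis P_idem rangeE rangeI)

lemma graph_map_eq:
  assumes "bounded_mild s z"
  shows "graph_map s (P s (z s)) = z s - P s (z s)"
proof -
  let ?w = "SOME w. bounded_mild s w \<and> P s (w s) = P s (z s)"
  have w: "bounded_mild s ?w \<and> P s (?w s) = P s (z s)" by (rule someI[of _ z]) (simp add: assms)
  then have "norm ((?w s - P s (?w s)) - (z s - P s (z s))) \<le> K * 0"
    using bounded_mild_Lipschitz(2)[of s ?w z] assms by simp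
  then show ?thesis by (simp add: graph_map_def Let_def)
qed

lemma graph_map_in_graph_class: "graph_map \<in> graph_class P K"
  unfolding graph_class_def
proof (intro CollectI allI conjI ballI)
  fix s
  show "graph_map s 0 = 0" using graph_map_eq[OF bounded_mild_zero, of s] by (simp add: blinfun.zero_right)
  show "graph_map s \<zeta> \<in> unstable_space P s" for \<zeta>
    unfolding graph_map_def Let_def unstable_space_def by (auto simp: blinfun.diff_left intro!: image_eqI)
  fix \<zeta> \<zeta>' assume "\<zeta> \<in> stable_space P s" "\<zeta>' \<in> stable_space P s"
  then have *: "P s \<zeta> = \<zeta>" "P s \<zeta>' = \<zeta>'" by (simp_all add: stable_space_iff)
  obtain z where z: "bounded_mild s z" "P s (z s) = \<zeta>" using bounded_mild_exists[OF *(1)] .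
  obtain w where w: "bounded_mild s w" "P s (w s) = \<zeta>'" using bounded_mild_exists[OF *(2)] .
  show "norm (graph_map s \<zeta> - graph_map s \<zeta>') \<le> K * norm (\<zeta> - \<zeta>')"
    using bounded_mild_Lipschitz(2)[OF z(1) w(1)] graph_map_eq[OF z(1)] graph_map_eq[OF w(1)] z(2) w(2) by simp
qed

lemma graph_manifold_iff: "(s, y) \<in> graph_manifold P graph_map \<longleftrightarrow> (\<exists>z. bounded_mild s z \<and> z s = y)"
proof
  assume "(s, y) \<in> graph_manifold P graph_map"
  then obtain \<zeta> where \<zeta>: "P s \<zeta> = \<zeta>" "y = \<zeta> + graph_map s \<zeta>" by (auto simp: graph_manifold_def stable_space_iff)
  obtain z where z: "bounded_mild s z" "P s (z s) = \<zeta>" using bounded_mild_exists[OF \<zeta>(1)] .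
  then have "z s = y" using graph_map_eq[OF z(1)] \<zeta>(2) by simp
  with z show "\<exists>z. bounded_mild s z \<and> z s = y" by blast
next
  assume "\<exists>z. bounded_mild s z \<and> z s = y"
  then obtain z where z: "bounded_mild s z" "z s = y" by blast
  have "y = P s (z s) + graph_map s (P s (z s))" using graph_map_eq[OF z(1)] z(2) by simp
  moreover have "P s (z s) \<in> stable_space P s" by (simp add: stable_space_iff P_idem)
  ultimately show "(s, y) \<in> graph_manifold P graph_map" by (auto simp: graph_manifold_def)
qed

lemma graph_manifold_invariant:
  assumes z: "\<And>s. mild_on s z" and s: "(s, z s) \<in> graph_manifold P graph_map"
  shows "(t, z t) \<in> graph_manifold P graph_map"
proof -
  obtain w where w: "bounded_mild s w" "w s = z s" using s by (auto simp: graph_manifold_iff)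
  then have wm: "mild_on s w" by (simp add: bounded_mild_def)
  obtain B where B: "\<And>t. t \<ge> s \<Longrightarrow> norm (w t) \<le> B" using w(1) by (auto simp: bounded_mild_def)
  show ?thesis
  proof (cases "s \<le> t")
    case True
    have "w t = z t" by (rule mild_on_unique[OF wm z True w(2)])
    moreover have "bounded_mild t w"
      using mild_on_subset[OF wm True] B True by (auto simp: bounded_mild_def intro!: exI[of _ B])
    ultimately show ?thesis by (auto simp: graph_manifold_iff)
  next
    case False
    then have ts: "t \<le> s" by simp
    let ?v = "\<lambda>r. if r \<le> s then z r else w r"
    have "mild_on t ?v" by (rule mild_on_paste[OF z wm ts w(2)[symmetric]])
    moreover obtain B' where B': "\<And>r. r \<in> {t..s} \<Longrightarrow> norm (z r) \<le> B'"
      by (rule mild_on_bounded[OF z ts], rule that; iprover)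
    have "norm (?v r) \<le> max B B'" if "t \<le> r" for r
      using B[of r] B'[of r] that by (auto simp: le_max_iff_disj)
    ultimately have "bounded_mild t ?v" unfolding bounded_mild_def by blast
    moreover have "?v t = z t" using ts by simp
    ultimately show ?thesis unfolding graph_manifold_iff by blast
  qed
qed

end

section \<open>Measure differential equations with a dichotomy\<close>

text \<open>
  Passes from the Bochner integral on the restricted measure space to the integral of a function on
  the whole line that vanishes outside the interval.
\<close>

lemma ls_integral_eq_set_strong_integral:
  fixes f :: "real \<Rightarrow> 'b::banach"
  assumes "ls_integrable f u a b" "a \<le> b"
  shows "set_strongly_integrable (stieltjes_measure u) {a..<b} f"
    and "ls_integral f u a b = set_strong_integral (stieltjes_measure u) {a..<b} f"
proof -
  have strong: "has_strong_integral (stieltjes_measure u) (\<lambda>x. indicat_real {a..<b} x *\<^sub>R f x) I"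
    if "has_ls_integral f u I a b" for I
    using that unfolding has_ls_integral_def
    by (rule bochner_integral_is_restrict_space) (auto intro: sets_stieltjes_measure)
  obtain I where I: "has_ls_integral f u I a b" using assms(1) by (auto simp: ls_integrable_def)
  show "set_strongly_integrable (stieltjes_measure u) {a..<b} f"
    unfolding set_strongly_integrable_def by (rule has_strong_integral_imp_strongly_integrable[OF strong[OF I]])
  have "(THE I. has_ls_integral f u I a b) = I"
    by (rule the_equality, rule I, rule has_strong_integral_unique[OF strong strong[OF I]])
  moreover have "set_strong_integral (stieltjes_measure u) {a..<b} f = I"
    unfolding set_strong_integral_def by (rule strong_integral_eqI[OF strong[OF I]])
  ultimately show "ls_integral f u a b = set_strong_integral (stieltjes_measure u) {a..<b} f"
    using assms(2) by (simp add: ls_integral_def oriented_def)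
qed

lemma (in lyapunov_perron) mde_solution_mild_on:
  assumes z: "mde_solution A C H u UNIV z"
  shows "mild_on s z"
proof -
  let ?g = "\<lambda>t. H t (z t)"
  have A: "(\<lambda>s. A s (z s)) integrable_on {c..d}" and C: "ps_integrable (\<lambda>s. C s (z s)) u c d"
    and g: "ls_integrable ?g u c d" if "c \<le> d" for c d
    using z that by (auto simp: mde_solution_def)
  note W1 = ps_primitive_perron_integral(1)[of "\<lambda>s. A s (z s)", OF A]
  note W2 = ps_primitive_ps_integral[of "\<lambda>s. C s (z s)", OF C]
  have gi: "set_strongly_integrable \<mu> {a..<b} ?g" if "a \<le> b" for a b
    by (rule ls_integral_eq_set_strong_integral(1)[OF g[OF that] that])
  let ?I = "\<lambda>a b. set_strong_integral \<mu> {a..<b} ?g"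
  define G where "G t = (if 0 \<le> t then ?I 0 t else - ?I t 0)" for t
  have G: "G b - G a = ?I a b" if ab: "a \<le> b" for a b
  proof -
    have split: "?I a b = ?I a c + ?I c b" if "a \<le> c" "c \<le> b" for a b c
      by (rule set_strong_integral_Ico_split[OF gi[OF that(1)] gi[OF that(2)] that])
    consider "0 \<le> a" | "a < 0" "0 \<le> b" | "b < 0" by linarith
    then show ?thesis
    proof cases
      case 1 then show ?thesis using split[of 0 a b] ab by (simp add: G_def)
    next
      case 2 then show ?thesis using split[of a 0 b] by (simp add: G_def)
    next
      case 3 then show ?thesis using split[of a b 0] ab by (simp add: G_def)
    qed
  qed
  let ?W1 = "perron_integral (\<lambda>s. A s (z s)) 0" and ?W2 = "ps_integral (\<lambda>s. C s (z s)) u 0"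
  have eq: "z b - z a = (?W1 b - ?W1 a) + (?W2 b - ?W2 a) + (G b - G a)" if "a \<le> b" for a b
  proof -
    have "z b = z a + perron_integral (\<lambda>s. A s (z s)) a b + ps_integral (\<lambda>s. C s (z s)) u a b + ls_integral ?g u a b"
      using z by (auto simp: mde_solution_def)
    moreover have "perron_integral (\<lambda>s. A s (z s)) a b = ?W1 b - ?W1 a"
      using ps_integral_primitive[OF W1, of a b] ps_primitive_perron_integral(2)[of "\<lambda>s. A s (z s)", OF A] by simp
    ultimately show ?thesis
      using ps_integral_primitive[OF W2, of a b] G[OF that] ls_integral_eq_set_strong_integral(2)[OF g[OF that] that]
      by simp
  qed
  have "forced_solution G z"
    unfolding forced_solution_def
  proof (intro conjI)
    have "norm (G b - G a) \<le> M * (u b - u a)" if "a \<le> b" for a b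
      unfolding G[OF that] using H_le M_nonneg that by (intro norm_set_strong_integral_Ico_le gi) auto
    then show "\<exists>M. \<forall>c d. c \<le> d \<longrightarrow> norm (G d - G c) \<le> M * (u d - u c)" by blast
    have "z t - z s = (?W1 t - ?W1 s) + (?W2 t - ?W2 s) + (G t - G s)" for s t
      using eq[of s t] eq[of t s] by (cases "s \<le> t") (auto simp: algebra_simps)
    then show "\<exists>W1 W2. ps_primitive (\<lambda>s. A s (z s)) (\<lambda>x. x) W1 \<and> ps_primitive (\<lambda>s. C s (z s)) u W2 \<and>
       (\<forall>s t. z t - z s = (W1 t - W1 s) + (W2 t - W2 s) + (G t - G s))"
      using W1 W2 by blast
  qed
  from variation_of_constants[OF this gi H_le G] gi show ?thesis by (simp add: mild_on_def)
qed

lemma increment_le_total_variation_bound: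
  assumes "(SUP (c, d) \<in> {(c, d). c < d}. total_variation u c d) < \<infinity>"
  obtains V where "V \<ge> 0" "\<And>c d. c \<le> d \<Longrightarrow> u d - u c \<le> V"
proof -
  let ?S = "SUP (c, d) \<in> {(c, d). c < d}. total_variation u c d"
  have V: "u d - u c \<le> enn2real ?S" if "c \<le> d" for c d
  proof (cases "c = d")
    case False
    with that have cd: "c < d" by simp
    have "{{c..d}} division_of {c..d}" using division_of_self[of c d] cd by simp
    then have "(\<Sum>k\<in>{{c..d}}. ennreal \<bar>u (Sup k) - u (Inf k)\<bar>) \<le> total_variation u c d"
      unfolding total_variation_def by (intro SUP_upper) simp
    also have "(\<Sum>k\<in>{{c..d}}. ennreal \<bar>u (Sup k) - u (Inf k)\<bar>) = ennreal \<bar>u d - u c\<bar>"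
      using that by simp
    also have "total_variation u c d \<le> ?S" by (rule SUP_upper2[of "(c, d)"]) (use cd in simp_all)
    also have "?S = ennreal (enn2real ?S)" using assms by (subst ennreal_enn2real) simp_all
    finally have "\<bar>u d - u c\<bar> \<le> enn2real ?S" by (subst (asm) ennreal_le_iff) simp_all
    then show ?thesis by simp
  qed simp
  show thesis by (rule that[of "enn2real ?S"]) (simp_all add: V)
qed

text \<open>
  The controls are the indefinite integrals of the two dominating functions. The first is a Perron
  primitive and so continuous; the second is left-continuous because half-open intervals \<open>{a..<t}\<close>
  are exhausted from the left.
\<close>

lemma standing_assumptions_linear_mde:
  assumes "standing_assumptions A C u" and "mono u"
  obtains hA hC FA FC where "linear_mde A C u hA hC FA FC"
proof -
  note D = assms(1)[unfolded standing_assumptions_def]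
  have A: "\<And>c d. A integrable_on {c..d}" and left_u: "\<And>t. continuous (at_left t) u"
    and C: "\<And>c d. ps_integrable C u c d"
    and inv: "\<And>t. \<not> isCont u t \<Longrightarrow> blinfun_invertible (jump_operator C u t)"
    using D by simp_all
  obtain m1 :: "real \<Rightarrow> real" where m1: "\<And>c d. c < d \<Longrightarrow> set_integrable lebesgue {c..d} m1"
      "\<And>c d. c < d \<Longrightarrow> norm (perron_integral A c d) \<le> (LINT s:{c..d}|lebesgue. m1 s)"
    using D by (elim conjE exE) metis
  obtain m2 :: "real \<Rightarrow> real" where m2: "\<And>c d. c < d \<Longrightarrow> set_integrable (stieltjes_measure u) {c..<d} m2"
      "\<And>c d. c < d \<Longrightarrow> norm (ps_integral C u c d) \<le> (LINT s:{c..<d}|stieltjes_measure u. m2 s)"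
    using D by (elim conjE exE) metis
  have left: "(u \<longlongrightarrow> u t) (at_left t)" for t using left_u by (simp add: continuous_within)
  define FA where "FA = perron_integral A 0"
  define FC where "FC = ps_integral C u 0"
  have FA: "ps_primitive A (\<lambda>x. x) FA" unfolding FA_def by (rule ps_primitive_perron_integral(1)) (rule A)
  have FA': "perron_integral A c d = FA d - FA c" for c d
    using ps_integral_primitive[OF FA] ps_primitive_perron_integral(2)[OF A] by simp
  have FC: "ps_primitive C u FC" unfolding FC_def by (rule ps_primitive_ps_integral) (rule C)
  note FC' = ps_integral_primitive[OF FC]
  define hA where "hA = perron_integral m1 0"
  have m1': "m1 integrable_on {c..d}" "(LINT s:{c..d}|lebesgue. m1 s) = integral {c..d} m1" if "c < d" for c d
    using set_lebesgue_integral_eq_integral[OF m1(1)[OF that]] by auto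
  have "m1 integrable_on {c..d}" if "c \<le> d" for c d
    using m1'(1)[of c d] that by (cases "c = d") (auto simp: integrable_on_def intro: has_integral_refl(2))
  note m1'' = ps_primitive_perron_integral[of m1, OF this]
  have hA: "ps_primitive m1 (\<lambda>x. x) hA" unfolding hA_def by (rule m1''(1))
  have hA_eq: "hA d - hA c = (LINT s:{c..d}|lebesgue. m1 s)" if "c < d" for c d
    using ps_integral_primitive[OF hA, of c d] m1'(2)[OF that] that
    by (simp add: m1''(2)[symmetric] perron_integral_def oriented_def)
  have left_hA: "(hA \<longlongrightarrow> hA t) (at_left t)" for t
  proof -
    have "((\<lambda>r. hA r - hA t - (r - t) *\<^sub>R m1 t) \<longlongrightarrow> 0) (at_left t)"
      using ps_primitive_jump[OF hA] by (rule filterlim_mono) (auto simp: at_le)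
    moreover have "((\<lambda>r. (r - t) *\<^sub>R m1 t) \<longlongrightarrow> (t - t) *\<^sub>R m1 t) (at_left t)" by (intro tendsto_intros)
    ultimately have "((\<lambda>r. hA r - hA t - (r - t) *\<^sub>R m1 t + (r - t) *\<^sub>R m1 t + hA t) \<longlongrightarrow> 0 + (t - t) *\<^sub>R m1 t + hA t) (at_left t)"
      by (intro tendsto_intros)
    then show ?thesis by simp
  qed
  let ?\<mu> = "stieltjes_measure u"
  let ?J = "\<lambda>c d. LINT s:{c..<d}|?\<mu>. m2 s"
  have m2i: "set_integrable ?\<mu> {c..<d} m2" for c d
    using m2(1)[of c d] by (cases "c < d") (auto simp: set_integrable_def)
  have J_split: "?J a b = ?J a c + ?J c b" if "a \<le> c" "c \<le> b" for a b c
  proof -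
    have "{a..<b} = {a..<c} \<union> {c..<b}" "{a..<c} \<inter> {c..<b} = {}" using that by auto
    then show ?thesis using set_integral_Un[OF _ m2i m2i] by metis
  qed
  define hC where "hC t = (if 0 \<le> t then ?J 0 t else - ?J t 0)" for t
  have hC_eq: "hC d - hC c = ?J c d" if cd: "c \<le> d" for c d
  proof -
    consider "0 \<le> c" | "c < 0" "0 \<le> d" | "d < 0" by linarith
    then show ?thesis
    proof cases
      case 1 then show ?thesis using J_split[of 0 c d] cd by (simp add: hC_def)
    next
      case 2 then show ?thesis using J_split[of c 0 d] by (simp add: hC_def)
    next
      case 3 then show ?thesis using J_split[of c d 0] cd by (simp add: hC_def)
    qed
  qed
  have left_hC: "(hC \<longlongrightarrow> hC t) (at_left t)" for t
  proof (rule tendsto_at_left_sequentially[of "t - 1"])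
    fix S :: "nat \<Rightarrow> real" assume S: "\<And>n. S n < t" "\<And>n. t - 1 < S n" "incseq S" "S \<longlonglongrightarrow> t"
    have un: "(\<Union>n. {t - 1..<S n}) = {t - 1..<t}"
    proof (intro equalityI subsetI)
      fix x assume x: "x \<in> {t - 1..<t}"
      then have "\<forall>\<^sub>F n in sequentially. x < S n" using order_tendstoD(1)[OF S(4)] by simp
      then obtain n where "x < S n" using eventually_happens by force
      then show "x \<in> (\<Union>n. {t - 1..<S n})" using x by auto
    next
      fix x assume "x \<in> (\<Union>n. {t - 1..<S n})"
      then obtain n where "t - 1 \<le> x" "x < S n" by auto
      then show "x \<in> {t - 1..<t}" using S(1)[of n] by simp
    qed
    have "(\<lambda>n. ?J (t - 1) (S n)) \<longlonglongrightarrow> (LINT s:(\<Union>n. {t - 1..<S n})|?\<mu>. m2 s)"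
    proof (rule set_integral_cont_up)
      show "incseq (\<lambda>n. {t - 1..<S n})" using S(3) by (force simp: incseq_def)
      show "set_integrable ?\<mu> (\<Union>n. {t - 1..<S n}) m2" unfolding un by (rule m2i)
    qed (auto intro: sets_stieltjes_measure)
    then have "(\<lambda>n. hC (t - 1) + ?J (t - 1) (S n)) \<longlonglongrightarrow> hC (t - 1) + ?J (t - 1) t"
      unfolding un by (intro tendsto_intros)
    moreover have "hC (t - 1) + ?J (t - 1) (S n) = hC (S n)" for n
      using hC_eq[of "t - 1" "S n"] S(2)[of n] by simp
    moreover have "hC (t - 1) + ?J (t - 1) t = hC t" using hC_eq[of "t - 1" t] by simp
    ultimately show "(\<lambda>n. hC (S n)) \<longlonglongrightarrow> hC t" by simp
  qed simp
  have jump: "jump_operator C u t = id_blinfun + (right_lim u t - u t) *\<^sub>R C t" for t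
  proof -
    have "((\<lambda>r. FC r - FC t - (u r - u t) *\<^sub>R C t) \<longlongrightarrow> 0) (at_right t)"
      using ps_primitive_jump[OF FC] by (rule filterlim_mono) (auto simp: at_le)
    moreover have "((\<lambda>r. (u r - u t) *\<^sub>R C t) \<longlongrightarrow> (right_lim u t - u t) *\<^sub>R C t) (at_right t)"
      by (intro tendsto_intros mono_tendsto_right_lim assms(2))
    ultimately have "((\<lambda>r. FC r - FC t - (u r - u t) *\<^sub>R C t + (u r - u t) *\<^sub>R C t) \<longlongrightarrow> 0 + (right_lim u t - u t) *\<^sub>R C t) (at_right t)"
      by (rule tendsto_add)
    then have "((\<lambda>r. ps_integral C u t r) \<longlongrightarrow> (right_lim u t - u t) *\<^sub>R C t) (at_right t)" by (simp add: FC')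
    then show ?thesis unfolding jump_operator_def by (simp add: tendsto_Lim)
  qed
  have "linear_mde A C u hA hC FA FC"
  proof
    show "norm (FA d - FA c) \<le> hA d - hA c" if "c \<le> d" for c d
      using m1(2)[of c d] hA_eq[of c d] that by (cases "c = d") (auto simp: FA')
    show "norm (FC d - FC c) \<le> hC d - hC c" if "c \<le> d" for c d
      using m2(2)[of c d] hC_eq[of c d] that by (cases "c = d") (auto simp: FC')
    show "\<exists>V. V o\<^sub>L (id_blinfun + (right_lim u t - u t) *\<^sub>R C t) = id_blinfun" if "\<not> isCont u t" for t
      using inv[OF that] unfolding jump blinfun_invertible_def by blast
  qed (fact FA FC assms(2) left left_hA left_hC)+
  then show thesis by (rule that)
qed

lemma (in linear_mde) fundamental_operator_linear_evolution:
  assumes U: "fundamental_operator A C u U"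
  shows "linear_evolution A C u hA hC FA FC U"
proof -
  have AU: "(\<lambda>r. A r o\<^sub>L U r s) integrable_on {c..d}" and CU: "ps_integrable (\<lambda>r. C r o\<^sub>L U r s) u c d" for s c d
    using U unfolding fundamental_operator_def by blast+
  have U_eq: "U t s = id_blinfun + perron_integral (\<lambda>r. A r o\<^sub>L U r s) s t + ps_integral (\<lambda>r. C r o\<^sub>L U r s) u s t" for s t
    using U unfolding fundamental_operator_def by blast
  have WA: "ps_primitive (\<lambda>r. A r o\<^sub>L U r s) (\<lambda>x. x) (perron_integral (\<lambda>r. A r o\<^sub>L U r s) 0)" for s
    by (rule ps_primitive_perron_integral(1)) (rule AU)
  have WC: "ps_primitive (\<lambda>r. C r o\<^sub>L U r s) u (ps_integral (\<lambda>r. C r o\<^sub>L U r s) u 0)" for s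
    by (rule ps_primitive_ps_integral) (rule CU)
  have U_eq': "U t s = id_blinfun
      + (perron_integral (\<lambda>r. A r o\<^sub>L U r s) 0 t - perron_integral (\<lambda>r. A r o\<^sub>L U r s) 0 s)
      + (ps_integral (\<lambda>r. C r o\<^sub>L U r s) u 0 t - ps_integral (\<lambda>r. C r o\<^sub>L U r s) u 0 s)" for s t
    using U_eq[of t s] ps_integral_primitive[OF WA[of s], of s t] ps_integral_primitive[OF WC[of s], of s t]
      ps_primitive_perron_integral(2)[OF AU[of s]] by simp
  show ?thesis
  proof
    show "U s s = id_blinfun" for s using U_eq'[of s s] by simp
    fix s x
    have lin: "bounded_linear (\<lambda>T :: 'z \<Rightarrow>\<^sub>L 'z. blinfun_apply T x)" by (rule blinfun.bounded_linear_left)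
    show "linear_solution (\<lambda>r. U r s x)"
      unfolding forced_solution_def
    proof (rule conjI, goal_cases)
      case 1
      show ?case by (rule exI[of _ 0]) simp
    next
      case 2
      show ?case
      proof (rule exI[of _ "\<lambda>t. perron_integral (\<lambda>r. A r o\<^sub>L U r s) 0 t x"],
          rule exI[of _ "\<lambda>t. ps_integral (\<lambda>r. C r o\<^sub>L U r s) u 0 t x"], intro conjI allI)
        show "ps_primitive (\<lambda>r. A r (U r s x)) (\<lambda>x. x) (\<lambda>t. perron_integral (\<lambda>r. A r o\<^sub>L U r s) 0 t x)"
          using ps_primitive_linear[OF lin WA[of s]] by simp
        show "ps_primitive (\<lambda>r. C r (U r s x)) u (\<lambda>t. ps_integral (\<lambda>r. C r o\<^sub>L U r s) u 0 t x)"
          using ps_primitive_linear[OF lin WC[of s]] by simp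
        fix r t
        have "U t s - U r s = (perron_integral (\<lambda>r. A r o\<^sub>L U r s) 0 t - perron_integral (\<lambda>r. A r o\<^sub>L U r s) 0 r)
            + (ps_integral (\<lambda>r. C r o\<^sub>L U r s) u 0 t - ps_integral (\<lambda>r. C r o\<^sub>L U r s) u 0 r)"
          using U_eq'[of t s] U_eq'[of r s] by simp
        then have "(U t s - U r s) x = ((perron_integral (\<lambda>r. A r o\<^sub>L U r s) 0 t - perron_integral (\<lambda>r. A r o\<^sub>L U r s) 0 r)
            + (ps_integral (\<lambda>r. C r o\<^sub>L U r s) u 0 t - ps_integral (\<lambda>r. C r o\<^sub>L U r s) u 0 r)) x" by (rule arg_cong)
        then show "U t s x - U r s x = (perron_integral (\<lambda>r. A r o\<^sub>L U r s) 0 t x - perron_integral (\<lambda>r. A r o\<^sub>L U r s) 0 r x)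
            + (ps_integral (\<lambda>r. C r o\<^sub>L U r s) u 0 t x - ps_integral (\<lambda>r. C r o\<^sub>L U r s) u 0 r x) + (0 - 0)"
          by (simp add: blinfun.bilinear_simps)
      qed
    qed
  qed
qed

theorem theorem4p4:
  fixes A C :: "real \<Rightarrow> ('z::banach \<Rightarrow>\<^sub>L 'z)"
    and u :: "real \<Rightarrow> real"
    and P :: "real \<Rightarrow> ('z \<Rightarrow>\<^sub>L 'z)"
    and K \<alpha> C\<^sub>g :: real
  assumes "standing_assumptions A C u"
    and "exponential_dichotomy A C u P K \<alpha>"
    and "C\<^sub>g > 0"
    and "\<And>t. \<not> isCont u t \<Longrightarrow> norm (blinfun_inverse (jump_operator C u t)) \<le> C\<^sub>g"
    and "mono u"
    and "(SUP (c, d) \<in> {(c, d). c < d}. total_variation u c d) < \<infinity>"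
  shows "\<exists>\<epsilon>>0. \<forall>(H :: real \<Rightarrow> 'z \<Rightarrow> 'z) (M\<^sub>H :: real) (L\<^sub>H :: real).
           (\<forall>x c d. ls_integrable (\<lambda>t. H t x) u c d) \<and>
           (\<forall>t. H t 0 = 0) \<and>
           M\<^sub>H > 0 \<and> (\<forall>t x. norm (H t x) \<le> M\<^sub>H) \<and>
           (\<forall>t x y. norm (H t x - H t y) \<le> L\<^sub>H * norm (x - y)) \<and>
           L\<^sub>H < \<epsilon> \<longrightarrow>
           (\<exists>C\<^sub>m>0. \<exists>m\<in>graph_class P C\<^sub>m. invariant_set A C H u (graph_manifold P m))"
proof -
  obtain hA hC FA FC where "linear_mde A C u hA hC FA FC"
    using standing_assumptions_linear_mde[OF assms(1,5)] .
  then interpret linear_mde A C u hA hC FA FC .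
  obtain U where U: "fundamental_operator A C u U" and K: "K > 0" "\<alpha> > 0" and P: "\<And>t. P t o\<^sub>L P t = P t"
    "\<And>t s. P t o\<^sub>L U t s = U t s o\<^sub>L P s"
    and st: "\<And>t s. s \<le> t \<Longrightarrow> norm (U t s o\<^sub>L P s) \<le> K * exp (- \<alpha> * (t - s))"
    and un: "\<And>t s. t < s \<Longrightarrow> norm (U t s o\<^sub>L (id_blinfun - P s)) \<le> K * exp (\<alpha> * (t - s))"
    using assms(2) unfolding exponential_dichotomy_def by blast
  interpret linear_evolution A C u hA hC FA FC U by (rule fundamental_operator_linear_evolution[OF U])
  obtain V where V0: "V \<ge> 0" and V: "\<And>c d. c \<le> d \<Longrightarrow> u d - u c \<le> V"
    using increment_le_total_variation_bound[OF assms(6)] by blast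
  define \<epsilon> where "\<epsilon> = 1 / (2 * K * (V + 1))"
  have \<epsilon>: "\<epsilon> > 0" using K(1) V0 by (simp add: \<epsilon>_def)
  show ?thesis
  proof (rule exI[of _ \<epsilon>], intro conjI \<epsilon> allI impI, elim conjE)
    fix H :: "real \<Rightarrow> 'z \<Rightarrow> 'z" and M\<^sub>H L\<^sub>H :: real
    assume H: "\<forall>x c d. ls_integrable (\<lambda>t. H t x) u c d" "\<forall>t. H t 0 = 0" "\<forall>t x. norm (H t x) \<le> M\<^sub>H"
      "\<forall>t x y. norm (H t x - H t y) \<le> L\<^sub>H * norm (x - y)" and L: "L\<^sub>H < \<epsilon>"
    \<comment> \<open>On a trivial state space the given Lipschitz constant may be negative.\<close>
    define L where "L = max L\<^sub>H 0"
    have "L \<le> \<epsilon>" using L \<epsilon> by (simp add: L_def)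
    then have "K * L * V \<le> K * \<epsilon> * (V + 1)" using K(1) V0 \<epsilon> by (intro mult_mono) (auto simp: L_def)
    also have "\<dots> = 1 / 2"
    proof -
      have "V + 1 > 0" using V0 by simp
      then show ?thesis using K(1) by (simp add: \<epsilon>_def divide_simps)
    qed
    finally have KLV: "K * L * V \<le> 1 / 2" .
    have lip: "norm (H t x - H t y) \<le> L * norm (x - y)" for t x y
    proof -
      have "norm (H t x - H t y) \<le> L\<^sub>H * norm (x - y)" using H(4) by simp
      also have "\<dots> \<le> L * norm (x - y)" by (intro mult_right_mono) (auto simp: L_def)
      finally show ?thesis .
    qed
    interpret lyapunov_perron A C u hA hC FA FC U V P K \<alpha> H M\<^sub>H L
    proof
      show "u d - u c \<le> V" if "c \<le> d" for c d by (rule V[OF that])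
      show "P t (P t x) = P t x" for t x using P(1)[of t] by (metis blinfun_apply_blinfun_compose)
      show "P t (U t s x) = U t s (P s x)" for t s x using P(2)[of t s] by (metis blinfun_apply_blinfun_compose)
      show "norm (U t s (P s x)) \<le> K * norm x" if "s \<le> t" for t s x
      proof -
        have "norm (U t s (P s x)) \<le> norm (U t s o\<^sub>L P s) * norm x" using norm_blinfun[of "U t s o\<^sub>L P s" x] by simp
        also have "\<dots> \<le> K * norm x"
        proof (rule mult_right_mono)
          have "exp (- \<alpha> * (t - s)) \<le> 1" using K(2) that by simp
          then have "K * exp (- \<alpha> * (t - s)) \<le> K * 1" using K(1) by (intro mult_left_mono) auto
          then show "norm (U t s o\<^sub>L P s) \<le> K" using st[OF that] by simp
        qed simp
        finally show ?thesis .
      qed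
      show "norm (U t s (x - P s x)) \<le> K * exp (\<alpha> * (t - s)) * norm x" if "t < s" for t s x
      proof -
        have "norm (U t s (x - P s x)) \<le> norm (U t s o\<^sub>L (id_blinfun - P s)) * norm x"
          using norm_blinfun[of "U t s o\<^sub>L (id_blinfun - P s)" x] by (simp add: blinfun.diff_left)
        also have "\<dots> \<le> K * exp (\<alpha> * (t - s)) * norm x" by (rule mult_right_mono[OF un[OF that]]) simp
        finally show ?thesis .
      qed
      show "set_strongly_integrable (stieltjes_measure u) {a..<b} (\<lambda>t. H t x)" if "a \<le> b" for x a b
        using H(1) that by (intro ls_integral_eq_set_strong_integral(1)) auto
      show "L \<ge> 0" by (simp add: L_def)
    qed (use K H KLV lip in auto)
    have "invariant_set A C H u (graph_manifold P graph_map)"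
      unfolding invariant_set_def
    proof (intro allI impI, elim conjE exE)
      fix z t s assume z: "mde_solution A C H u UNIV z" and s: "(s, z s) \<in> graph_manifold P graph_map"
      show "(t, z t) \<in> graph_manifold P graph_map"
        by (rule graph_manifold_invariant[OF mde_solution_mild_on[OF z] s])
    qed
    with graph_map_in_graph_class K(1)
    show "\<exists>C\<^sub>m>0. \<exists>m\<in>graph_class P C\<^sub>m. invariant_set A C H u (graph_manifold P m)" by blast
  qed
qed

end
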